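(* Let $d>1$, let $Q:=(0,1)^d$ be endowed with the $d$-dimensional Lebesgue measure $\mathbb M$, $\mathcal H:=L^2(Q,\mathbb M;\mathbb R^d)$, and $\iota(X):=X_\sharp\mathbb M$. If $\mathfrak g$ is a nondegenerate Gaussian measure on the Banach space $\mathcal B=C^1(\overline Q;\mathbb R^d)\subset\mathcal H$, then $\mathtt G=\iota_\sharp\mathfrak g\in\mathcal P_2(\mathcal P_2(\mathbb R^d))$ is super-G-regular with full support in $\mathcal P_2(\mathbb R^d)$.
   Context: $\mathcal P_2(\mathbb R^d)$: Borel probability measures on $\mathbb R^d$ with finite quadratic moment, with 2-Wasserstein metric; $\mathcal P_2(\mathcal P_2(\mathbb R^d))$: Borel probability measures on it with finite quadratic moment. A Gaussian measure on a separable Banach space is nondegenerate if every nonzero continuous linear functional has a Gaussian law with positive variance; a Borel subset of $\mathcal H$ is Gaussian-null if it is negligible for every nondegenerate Gaussian measure on $\mathcal H$. d.c. hypersurface of $\mathbb R^d$: a set $\{x+(f(x)-g(x))v:x\in v^\perp\}$ with $v\neq0$ and $f,g:v^\perp\to\mathbb R$ Lipschitz convex. $\mathcal P_2^r(\mathbb R^d)$: measures in $\mathcal P_2(\mathbb R^d)$ vanishing on all d.c. hypersurfaces. $\mathtt M\in\mathcal P_2(\mathcal P_2(\mathbb R^d))$ is super-G-regular if (i) $\mathtt M$ is concentrated on $\mathcal P_2^r(\mathbb R^d)$ and (ii) $\mathtt M(B)=0$ for every Borel $B\subset\mathcal P_2(\mathbb R^d)$ such that $\iota^{-1}(B)$ is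 Gaussian-null in $\mathcal H$. *)

theory Defs
  imports "HOL-Probability.Probability"
begin

section \<open>The Wasserstein space of order two\<close>

typedef (overloaded) 'a P2 =
  "{\<mu> :: 'a::euclidean_space measure.
      sets \<mu> = sets borel \<and> prob_space \<mu> \<and> integrable \<mu> (\<lambda>x. (norm x)\<^sup>2)}"
  morphisms measure_of_P2 Abs_P2
proof -
  have "return borel (0::'a) \<in> {\<mu>. sets \<mu> = sets borel \<and> prob_space \<mu> \<and>
      integrable \<mu> (\<lambda>x. (norm x)\<^sup>2)}"
  proof (intro CollectI conjI)
    show "prob_space (return borel (0::'a))"
      by (rule prob_space_return) simp
    have "(\<integral>\<^sup>+x. ennreal (norm ((norm x)\<^sup>2)) \<partial>return borel (0::'a)) = ennreal (norm ((norm (0::'a))\<^sup>2))"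
      by (rule nn_integral_return) simp_all
    then show "integrable (return borel (0::'a)) (\<lambda>x. (norm x)\<^sup>2)"
      by (intro integrableI_bounded) simp_all
  qed simp
  then show ?thesis by blast
qed

setup_lifting type_definition_P2

definition couplings :: "'a::euclidean_space measure \<Rightarrow> 'a measure \<Rightarrow> ('a \<times> 'a) measure set" where
  "couplings \<mu> \<nu> =
    {\<gamma>. sets \<gamma> = sets borel \<and> distr \<gamma> borel fst = \<mu> \<and> distr \<gamma> borel snd = \<nu>}"

text \<open>On \<open>P2\<close> the set of couplings is nonempty and all costs are finite, so the
  conversion to the reals loses nothing.\<close>

definition W2 :: "'a::euclidean_space P2 \<Rightarrow> 'a P2 \<Rightarrow> real" where
  "W2 \<mu> \<nu> = sqrt (enn2real
    (INF \<gamma>\<in>couplings (measure_of_P2 \<mu>) (measure_of_P2 \<nu>).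
      \<integral>\<^sup>+ z. ennreal ((dist (fst z) (snd z))\<^sup>2) \<partial>\<gamma>))"

text \<open>The topology of the metric \<open>W2\<close>.  It is introduced through the class of topological
  spaces, which does not require the metric axioms to be established first; the type class
  then supplies the Borel sets of the Wasserstein space.\<close>

instantiation P2 :: (euclidean_space) topological_space
begin

definition open_P2 :: "'a P2 set \<Rightarrow> bool" where
  "open_P2 U \<longleftrightarrow> (\<forall>\<mu>\<in>U. \<exists>e>0. \<forall>\<nu>. W2 \<nu> \<mu> < e \<longrightarrow> \<nu> \<in> U)"

instance
proof
  show "open (UNIV :: 'a P2 set)"
    unfolding open_P2_def using zero_less_one by blast
next
  fix S T :: "'a P2 set"
  assume S: "open S" and T: "open T"
  show "open (S \<inter> T)"
    unfolding open_P2_def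
  proof
    fix \<mu> assume \<mu>: "\<mu> \<in> S \<inter> T"
    obtain d where "d > 0" "\<forall>\<nu>. W2 \<nu> \<mu> < d \<longrightarrow> \<nu> \<in> S"
      using S \<mu> unfolding open_P2_def by blast
    moreover obtain e where "e > 0" "\<forall>\<nu>. W2 \<nu> \<mu> < e \<longrightarrow> \<nu> \<in> T"
      using T \<mu> unfolding open_P2_def by blast
    ultimately show "\<exists>e>0. \<forall>\<nu>. W2 \<nu> \<mu> < e \<longrightarrow> \<nu> \<in> S \<inter> T"
      by (intro exI[of _ "min d e"]) auto
  qed
next
  fix K :: "'a P2 set set"
  assume K: "\<forall>S\<in>K. open S"
  show "open (\<Union>K)"
    unfolding open_P2_def
  proof
    fix \<mu> assume "\<mu> \<in> \<Union>K"
    then obtain S where S: "S \<in> K" "\<mu> \<in> S" by blast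
    with K have "open S" by blast
    with S obtain e where "e > 0" "\<forall>\<nu>. W2 \<nu> \<mu> < e \<longrightarrow> \<nu> \<in> S"
      unfolding open_P2_def by blast
    with S show "\<exists>e>0. \<forall>\<nu>. W2 \<nu> \<mu> < e \<longrightarrow> \<nu> \<in> \<Union>K" by blast
  qed
qed

end

definition P2_P2 :: "'a::euclidean_space P2 measure set" where
  "P2_P2 = {M. sets M = sets borel \<and> prob_space M \<and>
     (\<exists>\<mu>\<^sub>0. (\<integral>\<^sup>+ \<mu>. ennreal ((W2 \<mu> \<mu>\<^sub>0)\<^sup>2) \<partial>M) < \<infinity>)}"

definition measure_support :: "'a::topological_space measure \<Rightarrow> 'a set" where
  "measure_support M = {x. \<forall>U. open U \<longrightarrow> x \<in> U \<longrightarrow> emeasure M U > 0}"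


section \<open>Measures vanishing on d.c. hypersurfaces\<close>

definition dc_hypersurface :: "'a::euclidean_space set \<Rightarrow> bool" where
  "dc_hypersurface S \<longleftrightarrow>
    (\<exists>v f g Lf Lg. v \<noteq> 0 \<and>
       convex_on {x. x \<bullet> v = 0} f \<and> Lf-lipschitz_on {x. x \<bullet> v = 0} f \<and>
       convex_on {x. x \<bullet> v = 0} g \<and> Lg-lipschitz_on {x. x \<bullet> v = 0} g \<and>
       S = {x + (f x - g x) *\<^sub>R v |x. x \<bullet> v = 0})"

definition P2_regular :: "'a::euclidean_space P2 set" where
  "P2_regular = {\<mu>. \<forall>S. dc_hypersurface S \<longrightarrow> S \<in> null_sets (measure_of_P2 \<mu>)}"


section \<open>Gaussian measures\<close>

text \<open>Gaussian measures need not be centred.  The definitions make sense on every normed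
  space; they are used below only on separable Banach spaces.\<close>

definition nondegenerate_gaussian :: "'b::real_normed_vector measure \<Rightarrow> bool" where
  "nondegenerate_gaussian \<gamma> \<longleftrightarrow>
    sets \<gamma> = sets borel \<and> prob_space \<gamma> \<and>
    (\<forall>l :: 'b \<Rightarrow>\<^sub>L real. l \<noteq> 0 \<longrightarrow>
      (\<exists>m \<sigma>. \<sigma> > 0 \<and>
        distributed \<gamma> lborel (blinfun_apply l) (\<lambda>x. ennreal (normal_density m \<sigma> x))))"

definition gaussian_null :: "'b::real_normed_vector set \<Rightarrow> bool" where
  "gaussian_null B \<longleftrightarrow>
    B \<in> sets borel \<and> (\<forall>\<gamma>. nondegenerate_gaussian \<gamma> \<longrightarrow> B \<in> null_sets \<gamma>)"


section \<open>The Hilbert space of square integrable maps on the unit cube\<close>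

definition cube_measure :: "(real^'n) measure" where
  "cube_measure = restrict_space lborel (box 0 1)"

lemma space_cube_measure: "space cube_measure = box 0 1"
  by (simp add: cube_measure_def space_restrict_space)

lemma emeasure_box_01: "emeasure lborel (box 0 (1::real^'n)) = 1"
proof -
  have "(1::real^'n) \<bullet> b = 1" if "b \<in> Basis" for b
    using that by (auto simp: Basis_vec_def inner_axis)
  then show ?thesis
    by (subst emeasure_lborel_box) auto
qed

lemma prob_space_cube_measure: "prob_space (cube_measure :: (real^'n) measure)"
  by (rule prob_spaceI)
    (simp add: space_cube_measure, simp add: cube_measure_def emeasure_restrict_space emeasure_box_01)

definition square_integrable :: "(real^'n \<Rightarrow> real^'n) \<Rightarrow> bool" where
  "square_integrable f \<longleftrightarrow>
    f \<in> borel_measurable cube_measure \<and> integrable cube_measure (\<lambda>x. (norm (f x))\<^sup>2)"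

lemma square_integrable_inner:
  assumes "square_integrable f" "square_integrable g"
  shows "integrable cube_measure (\<lambda>x. f x \<bullet> g x)"
proof (rule Bochner_Integration.integrable_bound)
  show "integrable cube_measure (\<lambda>x. (norm (f x))\<^sup>2 + (norm (g x))\<^sup>2)"
    using assms by (auto simp: square_integrable_def)
  show "(\<lambda>x. f x \<bullet> g x) \<in> borel_measurable cube_measure"
    using assms by (auto simp: square_integrable_def)
  have "\<bar>u \<bullet> w\<bar> \<le> (norm u)\<^sup>2 + (norm w)\<^sup>2" for u w :: "real^'n"
  proof -
    have "\<bar>u \<bullet> w\<bar> \<le> norm u * norm w" by (rule Cauchy_Schwarz_ineq2)
    also have "\<dots> \<le> (norm u)\<^sup>2 + (norm w)\<^sup>2"
    proof -
      have "2 * (norm u * norm w) \<le> (norm u)\<^sup>2 + (norm w)\<^sup>2"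
        using sum_squares_bound[of "norm u" "norm w"] by (simp add: mult.assoc)
      moreover have "0 \<le> norm u * norm w" by simp
      ultimately show ?thesis by linarith
    qed
    finally show ?thesis .
  qed
  then show "AE x in cube_measure. norm (f x \<bullet> g x) \<le> norm ((norm (f x))\<^sup>2 + (norm (g x))\<^sup>2)"
    by auto
qed

lemma square_integrable_0: "square_integrable (\<lambda>_. 0)"
  by (simp add: square_integrable_def)

lemma square_integrable_scaleR:
  "square_integrable f \<Longrightarrow> square_integrable (\<lambda>x. c *\<^sub>R f x)"
  by (auto simp: square_integrable_def power_mult_distrib)

lemma square_integrable_add:
  assumes "square_integrable f" "square_integrable g"
  shows "square_integrable (\<lambda>x. f x + g x)"
proof -
  have "(norm (f x + g x))\<^sup>2 = (norm (f x))\<^sup>2 + (norm (g x))\<^sup>2 + 2 * (f x \<bullet> g x)" for x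
    by (simp add: power2_norm_eq_inner inner_add_left inner_add_right inner_commute)
  then show ?thesis
    using assms square_integrable_inner[OF assms] by (auto simp: square_integrable_def)
qed

lemma square_integrable_uminus: "square_integrable f \<Longrightarrow> square_integrable (\<lambda>x. - f x)"
  by (auto simp: square_integrable_def)

lemma square_integrable_diff:
  "square_integrable f \<Longrightarrow> square_integrable g \<Longrightarrow> square_integrable (\<lambda>x. f x - g x)"
  using square_integrable_add[of f "\<lambda>x. - g x"] square_integrable_uminus[of g] by simp

definition L2_rel :: "(real^'n \<Rightarrow> real^'n) \<Rightarrow> (real^'n \<Rightarrow> real^'n) \<Rightarrow> bool" where
  "L2_rel f g \<longleftrightarrow>
    square_integrable f \<and> square_integrable g \<and> (AE x in cube_measure. f x = g x)"

lemma L2_rel_part_equivp: "part_equivp L2_rel"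
proof (rule part_equivpI)
  show "\<exists>f. L2_rel f f"
    using square_integrable_0 by (auto simp: L2_rel_def)
  show "symp L2_rel"
    by (rule sympI) (auto simp: L2_rel_def elim: eventually_mono)
  show "transp L2_rel"
  proof (rule transpI)
    fix f g h :: "real^'n \<Rightarrow> real^'n"
    assume fg: "L2_rel f g" and gh: "L2_rel g h"
    have "AE x in cube_measure. f x = g x" "AE x in cube_measure. g x = h x"
      using fg gh by (simp_all add: L2_rel_def)
    then have "AE x in cube_measure. f x = h x"
      by eventually_elim simp
    with fg gh show "L2_rel f h"
      by (simp add: L2_rel_def)
  qed
qed

lemma L2_relI: "square_integrable f \<Longrightarrow> f = g \<Longrightarrow> L2_rel f g"
  by (simp add: L2_rel_def)

lemmas square_integrable_intros = square_integrable_0 square_integrable_add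
  square_integrable_scaleR square_integrable_uminus square_integrable_diff

quotient_type 'n cube_L2 = "real^'n \<Rightarrow> real^'n" / partial: L2_rel
  by (rule L2_rel_part_equivp)

instantiation cube_L2 :: (finite) real_vector
begin

lift_definition zero_cube_L2 :: "'a cube_L2" is "\<lambda>_. 0"
  by (simp add: L2_rel_def square_integrable_0)

lift_definition plus_cube_L2 :: "'a cube_L2 \<Rightarrow> 'a cube_L2 \<Rightarrow> 'a cube_L2"
  is "\<lambda>f g x. f x + g x"
  by (auto simp: L2_rel_def square_integrable_add)

lift_definition minus_cube_L2 :: "'a cube_L2 \<Rightarrow> 'a cube_L2 \<Rightarrow> 'a cube_L2"
  is "\<lambda>f g x. f x - g x"
  by (auto simp: L2_rel_def square_integrable_diff)

lift_definition uminus_cube_L2 :: "'a cube_L2 \<Rightarrow> 'a cube_L2" is "\<lambda>f x. - f x"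
  by (auto simp: L2_rel_def square_integrable_uminus)

lift_definition scaleR_cube_L2 :: "real \<Rightarrow> 'a cube_L2 \<Rightarrow> 'a cube_L2" is "\<lambda>c f x. c *\<^sub>R f x"
  by (auto simp: L2_rel_def square_integrable_scaleR)

instance
proof
  fix X Y Z :: "'a cube_L2" and a b :: real
  note [intro] = square_integrable_intros
  note [simp] = L2_rel_def
  show "X + Y + Z = X + (Y + Z)"
    by transfer (rule L2_relI, auto simp: add.assoc)
  show "X + Y = Y + X"
    by transfer (rule L2_relI, auto simp: add.commute)
  show "0 + X = X"
    by transfer simp
  show "- X + X = 0"
    by transfer (rule L2_relI, auto)
  show "X - Y = X + - Y"
    by transfer (rule L2_relI, auto)
  show "a *\<^sub>R (X + Y) = a *\<^sub>R X + a *\<^sub>R Y"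
    by transfer (rule L2_relI, auto simp: scaleR_add_right)
  show "(a + b) *\<^sub>R X = a *\<^sub>R X + b *\<^sub>R X"
    by transfer (rule L2_relI, auto simp: scaleR_add_left)
  show "a *\<^sub>R b *\<^sub>R X = (a * b) *\<^sub>R X"
    by transfer (rule L2_relI, auto)
  show "1 *\<^sub>R X = X"
    by transfer simp
qed

end

instantiation cube_L2 :: (finite) real_inner
begin

lift_definition inner_cube_L2 :: "'a cube_L2 \<Rightarrow> 'a cube_L2 \<Rightarrow> real"
  is "\<lambda>f g. \<integral>x. f x \<bullet> g x \<partial>cube_measure"
proof -
  fix f f' g g' :: "real^'a \<Rightarrow> real^'a"
  assume "L2_rel f f'" "L2_rel g g'"
  then show "(\<integral>x. f x \<bullet> g x \<partial>cube_measure) = (\<integral>x. f' x \<bullet> g' x \<partial>cube_measure)"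
    by (intro integral_cong_AE) (auto simp: L2_rel_def square_integrable_def)
qed

definition norm_cube_L2 :: "'a cube_L2 \<Rightarrow> real" where
  "norm_cube_L2 X = sqrt (X \<bullet> X)"

definition dist_cube_L2 :: "'a cube_L2 \<Rightarrow> 'a cube_L2 \<Rightarrow> real" where
  "dist_cube_L2 X Y = norm (X - Y)"

definition sgn_cube_L2 :: "'a cube_L2 \<Rightarrow> 'a cube_L2" where
  "sgn_cube_L2 X = X /\<^sub>R norm X"

definition uniformity_cube_L2 :: "('a cube_L2 \<times> 'a cube_L2) filter" where
  "uniformity_cube_L2 = (INF e\<in>{0<..}. principal {(X, Y). dist X Y < e})"

definition open_cube_L2 :: "'a cube_L2 set \<Rightarrow> bool" where
  "open_cube_L2 U = (\<forall>X\<in>U. \<forall>\<^sub>F (X', Y) in uniformity. X' = X \<longrightarrow> Y \<in> U)"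

instance
proof
  fix X Y Z :: "'a cube_L2" and a :: real
  show "X \<bullet> Y = Y \<bullet> X"
    by transfer (simp add: inner_commute)
  show "(X + Y) \<bullet> Z = X \<bullet> Z + Y \<bullet> Z"
    by transfer (auto simp: L2_rel_def inner_add_left square_integrable_inner)
  show "(a *\<^sub>R X) \<bullet> Y = a * (X \<bullet> Y)"
    by transfer (auto simp: L2_rel_def square_integrable_inner)
  show "0 \<le> X \<bullet> X"
    by transfer simp
  show "X \<bullet> X = 0 \<longleftrightarrow> X = 0"
  proof transfer
    fix f :: "real^'a \<Rightarrow> real^'a"
    assume "L2_rel f f"
    then have f: "square_integrable f" by (simp add: L2_rel_def)
    have "(\<integral>x. f x \<bullet> f x \<partial>cube_measure) = 0 \<longleftrightarrow> (AE x in cube_measure. f x \<bullet> f x = 0)"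
      by (intro integral_nonneg_eq_0_iff_AE square_integrable_inner f) simp
    then show "(\<integral>x. f x \<bullet> f x \<partial>cube_measure) = 0 \<longleftrightarrow> L2_rel f (\<lambda>_. 0)"
      using f by (simp add: L2_rel_def square_integrable_0)
  qed
qed (rule norm_cube_L2_def dist_cube_L2_def sgn_cube_L2_def uniformity_cube_L2_def
      open_cube_L2_def)+

end

lift_definition iota :: "'n::finite cube_L2 \<Rightarrow> (real^'n) P2" is "\<lambda>f. distr cube_measure borel f"
proof -
  fix f g :: "real^'n \<Rightarrow> real^'n"
  assume fg: "L2_rel f g"
  then have f: "f \<in> borel_measurable cube_measure" and g: "g \<in> borel_measurable cube_measure"
    by (auto simp: L2_rel_def square_integrable_def)
  show "(sets (distr cube_measure borel f) = sets borel \<and> prob_space (distr cube_measure borel f) \<and>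
      integrable (distr cube_measure borel f) (\<lambda>x. (norm x)\<^sup>2)) \<and>
    distr cube_measure borel f = distr cube_measure borel g"
  proof (intro conjI)
    show "prob_space (distr cube_measure borel f)"
      by (rule prob_space.prob_space_distr[OF prob_space_cube_measure f])
    show "integrable (distr cube_measure borel f) (\<lambda>x. (norm x)\<^sup>2)"
      using fg f by (subst integrable_distr_eq) (auto simp: L2_rel_def square_integrable_def)
    show "distr cube_measure borel f = distr cube_measure borel g"
      using fg f g by (intro distr_cong_AE) (auto simp: L2_rel_def)
  qed simp
qed

definition super_G_regular :: "(real^'n) P2 measure \<Rightarrow> bool" where
  "super_G_regular M \<longleftrightarrow>
    M \<in> P2_P2 \<and>
    (AE \<mu> in M. \<mu> \<in> P2_regular) \<and>
    (\<forall>B\<in>sets borel. gaussian_null (iota -` B :: 'n cube_L2 set) \<longrightarrow> emeasure M B = 0)"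


section \<open>The Banach space of continuously differentiable maps on the closed unit cube\<close>

text \<open>A map is continuously differentiable on the closed cube if it is continuous there,
  differentiable in the interior, and its derivative extends continuously to the closed cube.
  Elements of the type are normalised to vanish off the closed cube, so that each map on the
  closed cube has exactly one representative.\<close>

definition C1_on_cube :: "(real^'n \<Rightarrow> real^'n) \<Rightarrow> bool" where
  "C1_on_cube f \<longleftrightarrow>
    continuous_on (cbox 0 1) f \<and>
    (\<exists>f' :: real^'n \<Rightarrow> (real^'n) \<Rightarrow>\<^sub>L (real^'n). continuous_on (cbox 0 1) f' \<and>
      (\<forall>x\<in>box 0 1. (f has_derivative blinfun_apply (f' x)) (at x)))"

lemma C1_on_cube_0: "C1_on_cube (\<lambda>_. 0)"
  by (auto simp: C1_on_cube_def zero_blinfun.rep_eq intro!: exI[of _ "\<lambda>_. 0"])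

typedef 'n cube_C1 =
  "{f :: real^'n \<Rightarrow> real^'n. C1_on_cube f \<and> (\<forall>x. x \<notin> cbox 0 1 \<longrightarrow> f x = 0)}"
  by (rule exI[of _ "\<lambda>_. 0"]) (simp add: C1_on_cube_0)

setup_lifting type_definition_cube_C1

lemma C1_on_cube_add:
  assumes "C1_on_cube f" "C1_on_cube g"
  shows "C1_on_cube (\<lambda>x. f x + g x)"
proof -
  from assms obtain f' g' where
    "continuous_on (cbox 0 1) f'" "\<forall>x\<in>box 0 1. (f has_derivative blinfun_apply (f' x)) (at x)"
    "continuous_on (cbox 0 1) g'" "\<forall>x\<in>box 0 1. (g has_derivative blinfun_apply (g' x)) (at x)"
    by (auto simp: C1_on_cube_def)
  then show ?thesis
    using assms unfolding C1_on_cube_def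
    by (auto intro!: exI[of _ "\<lambda>x. f' x + g' x"] continuous_intros derivative_eq_intros
        simp: blinfun.bilinear_simps)
qed

lemma C1_on_cube_scaleR:
  assumes "C1_on_cube f"
  shows "C1_on_cube (\<lambda>x. c *\<^sub>R f x)"
proof -
  from assms obtain f' where
    "continuous_on (cbox 0 1) f'" "\<forall>x\<in>box 0 1. (f has_derivative blinfun_apply (f' x)) (at x)"
    by (auto simp: C1_on_cube_def)
  then show ?thesis
    using assms unfolding C1_on_cube_def
    by (auto intro!: exI[of _ "\<lambda>x. c *\<^sub>R f' x"] continuous_intros derivative_eq_intros
        simp: blinfun.bilinear_simps)
qed

lemma C1_on_cube_uminus: "C1_on_cube f \<Longrightarrow> C1_on_cube (\<lambda>x. - f x)"
  using C1_on_cube_scaleR[of f "-1"] by simp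

lemma C1_on_cube_diff:
  "C1_on_cube f \<Longrightarrow> C1_on_cube g \<Longrightarrow> C1_on_cube (\<lambda>x. f x - g x)"
  using C1_on_cube_add[of f "\<lambda>x. - g x"] C1_on_cube_uminus[of g] by simp

definition C1_norm :: "(real^'n \<Rightarrow> real^'n) \<Rightarrow> real" where
  "C1_norm f =
    (SUP x\<in>cbox 0 1. norm (f x)) + (SUP x\<in>box 0 1. onorm (frechet_derivative f (at x)))"

lemma cube_nonempty: "box 0 (1::real^'n) \<noteq> {}" "cbox 0 (1::real^'n) \<noteq> {}"
proof -
  show "box 0 (1::real^'n) \<noteq> {}"
    using emeasure_box_01[where 'n='n] by (metis emeasure_empty zero_neq_one)
  then show "cbox 0 (1::real^'n) \<noteq> {}"
    using box_subset_cbox[of 0 "1::real^'n"] by blast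
qed

lemma C1_differentiable:
  assumes "C1_on_cube f" "x \<in> box 0 1"
  shows "(f has_derivative frechet_derivative f (at x)) (at x)"
proof -
  obtain f' where "\<forall>x\<in>box 0 1. (f has_derivative blinfun_apply (f' x)) (at x)"
    using assms(1) by (auto simp: C1_on_cube_def)
  with assms(2) have "f differentiable (at x)"
    by (auto simp: differentiable_def)
  then show ?thesis
    by (simp add: frechet_derivative_works)
qed

lemma C1_bounded_linear:
  assumes "C1_on_cube f" "x \<in> box 0 1"
  shows "bounded_linear (frechet_derivative f (at x))"
  using C1_differentiable[OF assms] by (rule has_derivative_bounded_linear)

lemma C1_bdd_above:
  assumes "C1_on_cube f"
  shows "bdd_above ((\<lambda>x. norm (f x)) ` cbox 0 1)"
    and "bdd_above ((\<lambda>x. onorm (frechet_derivative f (at x))) ` box 0 1)"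
proof -
  from assms obtain f' where f: "continuous_on (cbox 0 1) f"
    and f': "continuous_on (cbox 0 1) f'"
    and d: "\<And>x. x \<in> box 0 1 \<Longrightarrow> (f has_derivative blinfun_apply (f' x)) (at x)"
    by (auto simp: C1_on_cube_def)
  have "compact ((\<lambda>x. norm (f x)) ` cbox 0 1)"
    by (intro compact_continuous_image continuous_intros f compact_cbox)
  then show "bdd_above ((\<lambda>x. norm (f x)) ` cbox 0 1)"
    by (intro bounded_imp_bdd_above compact_imp_bounded)
  have "compact ((\<lambda>x. norm (f' x)) ` cbox 0 1)"
    by (intro compact_continuous_image continuous_intros f' compact_cbox)
  then have "bdd_above ((\<lambda>x. norm (f' x)) ` cbox 0 1)"
    by (intro bounded_imp_bdd_above compact_imp_bounded)
  then have "bdd_above ((\<lambda>x. norm (f' x)) ` box 0 1)"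
    by (rule bdd_above_mono) (intro image_mono box_subset_cbox)
  moreover have "onorm (frechet_derivative f (at x)) = norm (f' x)" if "x \<in> box 0 1" for x
    using frechet_derivative_at[OF d[OF that]] by (simp add: norm_blinfun.rep_eq)
  then have "(\<lambda>x. onorm (frechet_derivative f (at x))) ` box 0 1 = (\<lambda>x. norm (f' x)) ` box 0 1"
    by (intro image_cong) auto
  ultimately show "bdd_above ((\<lambda>x. onorm (frechet_derivative f (at x))) ` box 0 1)"
    by simp
qed

lemma C1_norm_parts:
  assumes "C1_on_cube f"
  shows "0 \<le> (SUP x\<in>cbox 0 1. norm (f x))"
    and "0 \<le> (SUP x\<in>box 0 1. onorm (frechet_derivative f (at x)))"
proof -
  obtain y :: "real^'a" where y: "y \<in> box 0 1" using cube_nonempty(1) by blast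
  then have y': "y \<in> cbox 0 1" using box_subset_cbox by blast
  show "0 \<le> (SUP x\<in>cbox 0 1. norm (f x))"
    using cSUP_upper[OF y' C1_bdd_above(1)[OF assms]] norm_ge_zero[of "f y"] by linarith
  show "0 \<le> (SUP x\<in>box 0 1. onorm (frechet_derivative f (at x)))"
    using cSUP_upper[OF y C1_bdd_above(2)[OF assms]] onorm_pos_le[OF C1_bounded_linear[OF assms y]]
    by linarith
qed

lemma C1_norm_triangle:
  assumes f: "C1_on_cube f" and g: "C1_on_cube g"
  shows "C1_norm (\<lambda>x. f x + g x) \<le> C1_norm f + C1_norm g"
proof -
  let ?D = "\<lambda>f x. onorm (frechet_derivative f (at x))"
  have "(SUP x\<in>cbox 0 1. norm (f x + g x)) \<le> (SUP x\<in>cbox 0 1. norm (f x)) + (SUP x\<in>cbox 0 1. norm (g x))"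
    by (intro cSUP_least cube_nonempty)
      (intro order_trans[OF norm_triangle_ineq] add_mono cSUP_upper C1_bdd_above f g)
  moreover have "(SUP x\<in>box 0 1. ?D (\<lambda>x. f x + g x) x) \<le> (SUP x\<in>box 0 1. ?D f x) + (SUP x\<in>box 0 1. ?D g x)"
  proof (intro cSUP_least cube_nonempty)
    fix x :: "real^'a" assume x: "x \<in> box 0 1"
    have "frechet_derivative (\<lambda>x. f x + g x) (at x) =
        (\<lambda>h. frechet_derivative f (at x) h + frechet_derivative g (at x) h)"
      by (intro frechet_derivative_at[symmetric] has_derivative_add C1_differentiable f g x)
    then have "?D (\<lambda>x. f x + g x) x \<le> ?D f x + ?D g x"
      using onorm_triangle[OF C1_bounded_linear[OF f x] C1_bounded_linear[OF g x]] by simp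
    also have "\<dots> \<le> (SUP x\<in>box 0 1. ?D f x) + (SUP x\<in>box 0 1. ?D g x)"
      by (intro add_mono cSUP_upper x C1_bdd_above f g)
    finally show "?D (\<lambda>x. f x + g x) x \<le> (SUP x\<in>box 0 1. ?D f x) + (SUP x\<in>box 0 1. ?D g x)" .
  qed
  ultimately show ?thesis by (simp add: C1_norm_def)
qed

lemma C1_norm_scaleR_le:
  assumes f: "C1_on_cube f"
  shows "C1_norm (\<lambda>x. c *\<^sub>R f x) \<le> \<bar>c\<bar> * C1_norm f"
proof -
  let ?D = "\<lambda>f x. onorm (frechet_derivative f (at x))"
  have "(SUP x\<in>cbox 0 1. norm (c *\<^sub>R f x)) \<le> \<bar>c\<bar> * (SUP x\<in>cbox 0 1. norm (f x))"
    by (intro cSUP_least cube_nonempty)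
      (auto intro!: mult_left_mono cSUP_upper C1_bdd_above f)
  moreover have "(SUP x\<in>box 0 1. ?D (\<lambda>x. c *\<^sub>R f x) x) \<le> \<bar>c\<bar> * (SUP x\<in>box 0 1. ?D f x)"
  proof (intro cSUP_least cube_nonempty)
    fix x :: "real^'a" assume x: "x \<in> box 0 1"
    have "frechet_derivative (\<lambda>x. c *\<^sub>R f x) (at x) = (\<lambda>h. c *\<^sub>R frechet_derivative f (at x) h)"
      by (intro frechet_derivative_at[symmetric] has_derivative_scaleR_right C1_differentiable f x)
    then have "?D (\<lambda>x. c *\<^sub>R f x) x = \<bar>c\<bar> * ?D f x"
      using onorm_scaleR[OF C1_bounded_linear[OF f x]] by simp
    also have "\<dots> \<le> \<bar>c\<bar> * (SUP x\<in>box 0 1. ?D f x)"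
      by (intro mult_left_mono cSUP_upper x C1_bdd_above f) auto
    finally show "?D (\<lambda>x. c *\<^sub>R f x) x \<le> \<bar>c\<bar> * (SUP x\<in>box 0 1. ?D f x)" .
  qed
  ultimately show ?thesis by (simp add: C1_norm_def distrib_left)
qed

lemma C1_norm_0: "C1_norm (\<lambda>_::real^'n. 0) = 0"
proof -
  have "frechet_derivative (\<lambda>_::real^'n. 0::real^'n) (at x) = (\<lambda>_. 0)" for x
    by (rule frechet_derivative_at[symmetric]) simp
  then show ?thesis
    by (simp add: C1_norm_def cube_nonempty onorm_zero)
qed

lemma C1_norm_scaleR:
  assumes f: "C1_on_cube f"
  shows "C1_norm (\<lambda>x. c *\<^sub>R f x) = \<bar>c\<bar> * C1_norm f"
proof (cases "c = 0")
  case True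
  then show ?thesis by (simp add: C1_norm_0)
next
  case False
  then have "C1_norm f \<le> \<bar>inverse c\<bar> * C1_norm (\<lambda>x. c *\<^sub>R f x)"
    using C1_norm_scaleR_le[OF C1_on_cube_scaleR[OF f, of c], of "inverse c"] by simp
  then have "\<bar>c\<bar> * C1_norm f \<le> \<bar>c\<bar> * (\<bar>inverse c\<bar> * C1_norm (\<lambda>x. c *\<^sub>R f x))"
    by (intro mult_left_mono) auto
  also have "\<dots> = C1_norm (\<lambda>x. c *\<^sub>R f x)"
    using False by (simp add: abs_inverse)
  finally show ?thesis
    using C1_norm_scaleR_le[OF f, of c] by linarith
qed

lemma C1_norm_eq_0:
  assumes f: "C1_on_cube f" and "C1_norm f = 0" and x: "x \<in> cbox 0 1"
  shows "f x = 0"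
proof -
  have "(SUP x\<in>cbox 0 1. norm (f x)) = 0"
    using C1_norm_parts[OF f] assms(2) by (simp add: C1_norm_def)
  then show ?thesis
    using cSUP_upper[OF x C1_bdd_above(1)[OF f]] by simp
qed

instantiation cube_C1 :: (finite) real_vector
begin

lift_definition zero_cube_C1 :: "'a cube_C1" is "\<lambda>_. 0"
  by (simp add: C1_on_cube_0)

lift_definition plus_cube_C1 :: "'a cube_C1 \<Rightarrow> 'a cube_C1 \<Rightarrow> 'a cube_C1"
  is "\<lambda>f g x. f x + g x"
  by (simp add: C1_on_cube_add)

lift_definition minus_cube_C1 :: "'a cube_C1 \<Rightarrow> 'a cube_C1 \<Rightarrow> 'a cube_C1"
  is "\<lambda>f g x. f x - g x"
  by (simp add: C1_on_cube_diff)

lift_definition uminus_cube_C1 :: "'a cube_C1 \<Rightarrow> 'a cube_C1" is "\<lambda>f x. - f x"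
  by (simp add: C1_on_cube_uminus)

lift_definition scaleR_cube_C1 :: "real \<Rightarrow> 'a cube_C1 \<Rightarrow> 'a cube_C1" is "\<lambda>c f x. c *\<^sub>R f x"
  by (simp add: C1_on_cube_scaleR)

instance
proof
  fix X Y Z :: "'a cube_C1" and a b :: real
  show "X + Y + Z = X + (Y + Z)" "X + Y = Y + X" "0 + X = X" "- X + X = 0" "X - Y = X + - Y"
    "a *\<^sub>R (X + Y) = a *\<^sub>R X + a *\<^sub>R Y" "(a + b) *\<^sub>R X = a *\<^sub>R X + b *\<^sub>R X"
    "a *\<^sub>R b *\<^sub>R X = (a * b) *\<^sub>R X" "1 *\<^sub>R X = X"
    by (transfer, simp add: algebra_simps)+
qed

end

instantiation cube_C1 :: (finite) real_normed_vector
begin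

lift_definition norm_cube_C1 :: "'a cube_C1 \<Rightarrow> real" is C1_norm .

definition dist_cube_C1 :: "'a cube_C1 \<Rightarrow> 'a cube_C1 \<Rightarrow> real" where
  "dist_cube_C1 X Y = norm (X - Y)"

definition sgn_cube_C1 :: "'a cube_C1 \<Rightarrow> 'a cube_C1" where
  "sgn_cube_C1 X = X /\<^sub>R norm X"

definition uniformity_cube_C1 :: "('a cube_C1 \<times> 'a cube_C1) filter" where
  "uniformity_cube_C1 = (INF e\<in>{0<..}. principal {(X, Y). dist X Y < e})"

definition open_cube_C1 :: "'a cube_C1 set \<Rightarrow> bool" where
  "open_cube_C1 U = (\<forall>X\<in>U. \<forall>\<^sub>F (X', Y) in uniformity. X' = X \<longrightarrow> Y \<in> U)"

instance
proof
  fix X Y :: "'a cube_C1" and a :: real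
  show "norm X = 0 \<longleftrightarrow> X = 0"
  proof transfer
    fix f :: "real^'a \<Rightarrow> real^'a"
    assume f: "C1_on_cube f \<and> (\<forall>x. x \<notin> cbox 0 1 \<longrightarrow> f x = 0)"
    show "C1_norm f = 0 \<longleftrightarrow> f = (\<lambda>_. 0)"
    proof
      assume "C1_norm f = 0"
      with f show "f = (\<lambda>_. 0)"
        using C1_norm_eq_0[of f] by blast
    qed (simp add: C1_norm_0)
  qed
  show "norm (X + Y) \<le> norm X + norm Y"
    by transfer (simp add: C1_norm_triangle)
  show "norm (a *\<^sub>R X) = \<bar>a\<bar> * norm X"
    by transfer (simp add: C1_norm_scaleR)
qed (rule dist_cube_C1_def sgn_cube_C1_def uniformity_cube_C1_def open_cube_C1_def)+

end

lift_definition C1_to_L2 :: "'n::finite cube_C1 \<Rightarrow> 'n cube_L2" is "\<lambda>f. f"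
proof -
  fix f :: "real^'n \<Rightarrow> real^'n"
  assume "C1_on_cube f \<and> (\<forall>x. x \<notin> cbox 0 1 \<longrightarrow> f x = 0)"
  then have f: "C1_on_cube f" by simp
  have "continuous_on (box 0 1) f"
    using f box_subset_cbox by (auto simp: C1_on_cube_def intro: continuous_on_subset)
  then have m: "f \<in> borel_measurable cube_measure"
    unfolding cube_measure_def
    using borel_measurable_continuous_on_restrict[of "box 0 1" f]
    by (simp add: measurable_def space_restrict_space sets_restrict_space)
  obtain C where C: "\<And>x. x \<in> cbox 0 1 \<Longrightarrow> norm (f x) \<le> C"
    using C1_bdd_above(1)[OF f] by (auto simp: bdd_above_def)
  interpret prob_space "cube_measure :: (real^'n) measure"
    by (rule prob_space_cube_measure)
  have "integrable cube_measure (\<lambda>x. (norm (f x))\<^sup>2)"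
  proof (rule integrable_const_bound)
    show "AE x in cube_measure. norm ((norm (f x))\<^sup>2) \<le> C\<^sup>2"
      using C box_subset_cbox[of 0 "1::real^'n"]
      by (intro AE_I2) (auto simp: space_cube_measure intro!: power_mono)
    show "(\<lambda>x. (norm (f x))\<^sup>2) \<in> borel_measurable cube_measure"
      using m by simp
  qed
  with m show "L2_rel f f"
    by (simp add: L2_rel_def square_integrable_def)
qed

end

theory Submission
  imports Defs
begin

text \<open>
  Everything rests on one symmetry: if \<open>X\<close>, \<open>Y\<close>, \<open>Z\<close> are independent with a Gaussian law \<open>h\<close> and
  \<open>a + b + c = 1 = a\<^sup>2 + b\<^sup>2 + c\<^sup>2\<close>, then \<open>a X + b Y + c Z\<close> again has law \<open>h\<close>, since its
  characteristic functional is unchanged.  The support of \<open>h\<close> is therefore a closed affine subspace of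
  full measure, hence in a separable Hilbert space everything when \<open>h\<close> is nondegenerate.  Applied to the image
  of the given measure in \<open>L\<^sup>2\<close>, together with the density of the laws of \<open>L\<^sup>2\<close> maps, this gives
  full support; that image is itself a nondegenerate Gaussian measure, so condition (ii) is immediate.

  For condition (i), the derivative \<open>D X(x)\<close> is a nondegenerate Gaussian matrix.  With \<open>p\<close> the
  probability that its determinant vanishes, the determinant of \<open>a A + b B + c C\<close> for independent copies is a
  polynomial along a rational parametrisation of the admissible triples; it vanishes with probability \<open>p\<close> at
  every parameter, and identically only if two of the copies are singular, so \<open>p \<le> p\<^sup>2\<close>, while
  \<open>p < 1\<close> by full support.  By Fubini, almost every \<open>X\<close> is a local diffeomorphism near almost every
  point, so its law is absolutely continuous and does not charge d.c. hypersurfaces, which are Lipschitz images of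
  hyperplanes.
\<close>

section \<open>Finite measures with equal trigonometric integrals\<close>

text \<open>The definition of a nondegenerate Gaussian measure speaks only of one-dimensional laws,
  so every use of the symmetry rests on the fact that the characteristic functional determines the
  law. This is proved on separable inner product spaces, where closed balls are countable
  intersections of half-spaces. The symmetry is therefore applied to the images of the given measure
  in \<open>L^2\<close> and in the space of matrices, never on \<open>C^1\<close> itself.
  Completeness of \<open>L^2\<close> supplies nearest points in the support; separability supplies
  both uniqueness and the full measure of the support.

  The finite second moment comes from a quantile: a ball of radius \<open>R\<close> in
  \<open>C^1\<close> with mass at least 3/4 bounds every coordinate of every evaluation at once, and
  for a one-dimensional Gaussian law such a bound controls mean and variance.\<close>

lemma finite_measure_eqI_trig:
  fixes M N :: "real measure"
  assumes "finite_measure M" "finite_measure N" "sets M = sets borel" "sets N = sets borel"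
    and c: "\<And>t. (\<integral>x. cos (t * x) \<partial>M) = (\<integral>x. cos (t * x) \<partial>N)"
    and s: "\<And>t. (\<integral>x. sin (t * x) \<partial>M) = (\<integral>x. sin (t * x) \<partial>N)"
  shows "M = N"
proof -
  interpret M: finite_measure M by fact
  interpret N: finite_measure N by fact
  note [measurable_cong] = assms(3,4)
  have sp: "space M = UNIV" "space N = UNIV"
    using assms(3,4) by (simp_all add: sets_eq_imp_space_eq)
  \<comment> \<open>The frequency \<open>t = 0\<close> shows that both total masses equal
    \<open>r\<close>. Division by \<open>r\<close> then gives probability measures, to which Levy's
    uniqueness theorem applies; the zero measure is treated apart.\<close>
  define r where "r = measure M UNIV"
  have rN: "r = measure N UNIV"
    using c[of 0] by (simp add: r_def sp)
  have eM: "emeasure M UNIV = ennreal r" and eN: "emeasure N UNIV = ennreal r"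
    by (simp_all add: r_def rN[unfolded r_def] M.emeasure_eq_measure N.emeasure_eq_measure)
  show ?thesis
  proof (cases "r = 0")
    case True
    show ?thesis
    proof (rule measure_eqI)
      fix A assume "A \<in> sets M"
      have "emeasure M A \<le> emeasure M UNIV" "emeasure N A \<le> emeasure N UNIV"
        using assms(3,4) by (auto intro!: emeasure_mono)
      then show "emeasure M A = emeasure N A" using True eM eN by simp
    qed (simp add: assms)
  next
    case False
    then have r: "r > 0" by (simp add: r_def less_le)
    let ?s = "\<lambda>M. scale_measure (ennreal (1 / r)) (M :: real measure)"
    have dist: "real_distribution (?s K)" if "emeasure K UNIV = ennreal r" "sets K = sets borel" for K
    proof -
      have "space K = UNIV" using that by (simp add: sets_eq_imp_space_eq)
      then show ?thesis
        using r that by (auto simp: real_distribution_def real_distribution_axioms_def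
            space_scale_measure ennreal_mult'[symmetric] intro!: prob_spaceI)
    qed
    have sc: "?s K = density K (\<lambda>_. ennreal (1 / r))" for K
      by (rule measure_eqI) (auto simp: emeasure_density nn_integral_cmult)
    have ch: "char (?s K) t = complex_of_real ((\<integral>x. cos (t * x) \<partial>K) / r) + \<i> * complex_of_real ((\<integral>x. sin (t * x) \<partial>K) / r)"
      if K: "finite_measure K" "sets K = sets borel" for K t
    proof -
      interpret K: finite_measure K by fact
      note [measurable_cong] = K(2)
      have i: "integrable K (\<lambda>x. cos (t * x))" "integrable K (\<lambda>x. sin (t * x))"
        by (auto intro!: K.integrable_const_bound[of _ 1])
      have iexp: "iexp y = complex_of_real (cos y) + \<i> * complex_of_real (sin y)" for y
        by (simp add: cis_conv_exp[symmetric] complex_eq_iff)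
      have "char (?s K) t = (CLINT x|K. complex_of_real (1 / r) * iexp (t * x))"
        unfolding char_def sc using r
        by (subst integral_density) (auto simp: scaleR_conv_of_real simp del: of_real_mult)
      also have "\<dots> = (CLINT x|K. complex_of_real (cos (t * x)/r) + \<i> * complex_of_real (sin (t * x)/r))"
        by (intro Bochner_Integration.integral_cong refl, subst iexp) (simp add: add_divide_distrib)
      also have "\<dots> = complex_of_real ((\<integral>x. cos (t * x) \<partial>K) / r) + \<i> * complex_of_real ((\<integral>x. sin (t * x) \<partial>K) / r)"
        using i by (subst Bochner_Integration.integral_add) (auto simp del: of_real_divide)
      finally show ?thesis .
    qed
    have "?s M = ?s N"
    proof (rule Levy_uniqueness)
      show "char (?s M) = char (?s N)"
        using ch[OF assms(1,3)] ch[OF assms(2,4)] c s by (intro ext) simp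
    qed (use dist eM eN assms in auto)
    then have "emeasure (?s M) A = emeasure (?s N) A" for A by simp
    then have *: "ennreal (1/r) * emeasure M A = ennreal (1/r) * emeasure N A" for A by simp
    have "emeasure M A = emeasure N A" for A
      using *[of A] r by (auto simp: ennreal_mult_cancel_left)
    then show ?thesis
      by (intro measure_eqI) (simp_all add: assms)
  qed
qed

text \<open>Equality of the characteristic functionals, split into real and imaginary parts: the
  trigonometric functions then serve as real weights, hence, after a shift, as densities.\<close>

definition same_trig :: "'a::real_inner measure \<Rightarrow> 'a measure \<Rightarrow> bool" where
  "same_trig M N \<longleftrightarrow> (\<forall>e. (\<integral>x. cos (e \<bullet> x) \<partial>M) = (\<integral>x. cos (e \<bullet> x) \<partial>N) \<and>
     (\<integral>x. sin (e \<bullet> x) \<partial>M) = (\<integral>x. sin (e \<bullet> x) \<partial>N))"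

lemma borel_measurable_inner_left [measurable]:
  fixes u :: "'a::real_inner"
  shows "(\<lambda>x. u \<bullet> x) \<in> borel_measurable borel"
  by (intro borel_measurable_continuous_onI continuous_intros)

text \<open>With density \<open>w\<close>, the image of the measure under
  \<open>u \<bullet> x\<close> is a measure on the line, finite because of the bound
  \<open>b\<close>. The two hypotheses on cosine and sine are its trigonometric integrals, so
  uniqueness on the line identifies the two images.\<close>

lemma weighted_projection_eq:
  fixes u :: "'a::real_inner" and w :: "'a \<Rightarrow> real"
  assumes "finite_measure M" "finite_measure N" "sets M = sets borel" "sets N = sets borel"
    and w [measurable]: "w \<in> borel_measurable borel" and w01: "\<And>x. 0 \<le> w x" "\<And>x. w x \<le> b"
    and c: "\<And>t. (\<integral>x. w x * cos (t * (u \<bullet> x)) \<partial>M) = (\<integral>x. w x * cos (t * (u \<bullet> x)) \<partial>N)"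
    and s: "\<And>t. (\<integral>x. w x * sin (t * (u \<bullet> x)) \<partial>M) = (\<integral>x. w x * sin (t * (u \<bullet> x)) \<partial>N)"
    and A: "A \<in> sets borel"
  shows "(\<integral>x. w x * indicator A (u \<bullet> x) \<partial>M) = (\<integral>x. w x * indicator A (u \<bullet> x) \<partial>N)"
proof -
  let ?D = "\<lambda>K. distr (density K (\<lambda>x. ennreal (w x))) borel (\<lambda>x. u \<bullet> x)"
  have I: "(\<integral>y. f y \<partial>?D K) = (\<integral>x. w x * f (u \<bullet> x) \<partial>K)"
    if K: "sets K = sets borel" and f [measurable]: "f \<in> borel_measurable borel" for K and f :: "real \<Rightarrow> real"
  proof -
    note [measurable_cong] = K
    show ?thesis
      by (subst integral_distr) (auto simp: integral_density w01)
  qed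
  have fin: "finite_measure (?D K)" if K: "sets K = sets borel" "finite_measure K" for K
  proof -
    interpret finite_measure K by fact
    note [measurable_cong] = K(1)
    have "(\<integral>\<^sup>+x. ennreal (w x) \<partial>K) \<le> (\<integral>\<^sup>+x. ennreal b \<partial>K)"
      by (intro nn_integral_mono ennreal_leI w01)
    also have "\<dots> < \<infinity>" using emeasure_finite[of "space K"] by (simp add: ennreal_mult_less_top less_top[symmetric] ennreal_mult_eq_top_iff)
    finally have "finite_measure (density K (\<lambda>x. ennreal (w x)))"
      by (intro finite_measureI) (simp add: emeasure_density cong: nn_integral_cong_simp)
    then show ?thesis
      by (rule finite_measure.finite_measure_distr) simp
  qed
  have "?D M = ?D N"
    by (rule finite_measure_eqI_trig) (auto simp: I assms fin)
  then have "(\<integral>y. indicator A y \<partial>?D M) = (\<integral>y. indicator A y \<partial>?D N :: real)"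
    by simp
  then show ?thesis
    using A by (subst (asm) (1 2) I) (auto simp: assms borel_measurable_indicator)
qed

text \<open>Adding the constant 1 turns the weights \<open>cos (e \<bullet> x)\<close> and \<open>sin (e \<bullet> x)\<close> into
  nonnegative ones, so that the uniqueness theorem on the real line applies to the weighted images under
  \<open>u \<bullet> x\<close>.\<close>

lemma same_trig_restrict:
  fixes u :: "'a::real_inner"
  assumes fin: "finite_measure M" "finite_measure N" and sets: "sets M = sets borel" "sets N = sets borel"
    and MN: "same_trig M N" and A: "A \<in> sets borel"
  shows "same_trig (density M (indicator {x. u \<bullet> x \<in> A})) (density N (indicator {x. u \<bullet> x \<in> A}))"
proof -
  note [measurable] = A
  have int: "integrable K f" if "finite_measure K" "sets K = sets borel" "f \<in> borel_measurable borel" "\<And>x. \<bar>f x\<bar> \<le> 4"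
    for K and f :: "'a \<Rightarrow> real"
    using that by (intro finite_measure.integrable_const_bound[of _ _ 4]) (auto simp: measurable_cong_sets[OF that(2) refl])
  note i = int[OF fin(1) sets(1)] int[OF fin(2) sets(2)]
  have cs: "(\<integral>x. cos (e \<bullet> x) \<partial>M) = (\<integral>x. cos (e \<bullet> x) \<partial>N)" "(\<integral>x. sin (e \<bullet> x) \<partial>M) = (\<integral>x. sin (e \<bullet> x) \<partial>N)" for e
    using MN by (auto simp: same_trig_def)
  have b: "\<bar>cos x\<bar> \<le> 4" "\<bar>sin x\<bar> \<le> 4" for x :: real
    using abs_cos_le_one[of x] abs_sin_le_one[of x] by linarith+
  have b2: "\<bar>a * c\<bar> \<le> 4" if "\<bar>a\<bar> \<le> 1" "\<bar>c\<bar> \<le> 1" for a c :: real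
    using mult_mono[OF that] by (simp add: abs_mult)
  have half: "(\<integral>x. f x / 2 \<partial>K) = (\<integral>x. f x \<partial>K) / 2" for f :: "'a \<Rightarrow> real" and K
    by simp
  \<comment> \<open>The product formulas reduce a product of two trigonometric factors to single
    ones with the frequency vectors \<open>e + t *\<^sub>R u\<close> and
    \<open>e - t *\<^sub>R u\<close>, for which equality is assumed.\<close>
  have prod: "(\<integral>x. F (e \<bullet> x) * G (t * (u \<bullet> x)) \<partial>M) = (\<integral>x. F (e \<bullet> x) * G (t * (u \<bullet> x)) \<partial>N)"
    if F: "F \<in> {cos, sin}" "G \<in> {cos, sin}" for F G :: "real \<Rightarrow> real" and e t
  proof -
    have *: "e \<bullet> x + t * (u \<bullet> x) = (e + t *\<^sub>R u) \<bullet> x" "e \<bullet> x - t * (u \<bullet> x) = (e - t *\<^sub>R u) \<bullet> x" for x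
      by (simp_all add: inner_add_left inner_diff_left)
    show ?thesis
      using F
      by (auto simp: cos_times_cos sin_times_sin sin_times_cos cos_times_sin * half cs i b simp del: Bochner_Integration.integral_divide_zero
          Bochner_Integration.integral_divide)
  qed
  have one: "(\<integral>x. G (t * (u \<bullet> x)) \<partial>M) = (\<integral>x. G (t * (u \<bullet> x)) \<partial>N)"
    if "G \<in> {cos, sin}" for G :: "real \<Rightarrow> real" and t
    using that cs[of "t *\<^sub>R u"] by auto
  have key: "(\<integral>x. F (e \<bullet> x) * indicator A (u \<bullet> x) \<partial>M) = (\<integral>x. F (e \<bullet> x) * indicator A (u \<bullet> x) \<partial>N)"
    if F: "F \<in> {cos, sin}" for F :: "real \<Rightarrow> real" and e
  proof -
    have Fb: "\<bar>F y\<bar> \<le> 1" for y using F by auto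
    have [measurable]: "F \<in> borel_measurable borel" using F by auto
    have w: "(\<integral>x. w x * indicator A (u \<bullet> x) \<partial>M) = (\<integral>x. w x * indicator A (u \<bullet> x) \<partial>N)"
      if w: "w = (\<lambda>x. 1 + F (e \<bullet> x)) \<or> w = (\<lambda>x. 1)" for w
    proof (rule weighted_projection_eq[OF fin sets, where b=2])
      show "w \<in> borel_measurable borel" using w by auto
      show "0 \<le> w x" "w x \<le> 2" for x
        using w Fb[of "e \<bullet> x"] by (auto simp: abs_le_iff)
      show "(\<integral>x. w x * cos (t * (u \<bullet> x)) \<partial>M) = (\<integral>x. w x * cos (t * (u \<bullet> x)) \<partial>N)" for t
        using w prod[OF F, of cos e t] one[of cos t] by (auto simp: distrib_right i b b2 Fb)
      show "(\<integral>x. w x * sin (t * (u \<bullet> x)) \<partial>M) = (\<integral>x. w x * sin (t * (u \<bullet> x)) \<partial>N)" for t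
        using w prod[OF F, of sin e t] one[of sin t] by (auto simp: distrib_right i b b2 Fb)
    qed (rule A)
    have ib: "\<bar>indicator A (u \<bullet> x)\<bar> \<le> (1::real)" "\<bar>indicator A (u \<bullet> x)\<bar> \<le> (4::real)" for x by (auto simp: indicator_def)
    have "(\<lambda>x. indicator A (u \<bullet> x) :: real) \<in> borel_measurable borel"
      "(\<lambda>x. F (e \<bullet> x) * indicator A (u \<bullet> x)) \<in> borel_measurable borel" by measurable
    note ii = i(1)[OF this(1) ib(2)] i(2)[OF this(1) ib(2)]
      i(1)[OF this(2) b2[OF Fb ib(1)]] i(2)[OF this(2) b2[OF Fb ib(1)]]
    show ?thesis
      using w[of "\<lambda>x. 1 + F (e \<bullet> x)"] w[of "\<lambda>x. 1"]
      by (simp add: distrib_right ii)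
  qed
  have conv: "(\<integral>x. f x \<partial>density K (indicator {x. u \<bullet> x \<in> A})) = (\<integral>x. f x * indicator A (u \<bullet> x) \<partial>K)"
    if K: "sets K = sets borel" and [measurable]: "f \<in> borel_measurable borel" for K and f :: "'a \<Rightarrow> real"
  proof -
    note [measurable_cong] = K
    have "density K (indicator {x. u \<bullet> x \<in> A}) = density K (\<lambda>x. ennreal (indicator {x. u \<bullet> x \<in> A} x))"
      by (simp add: ennreal_indicator)
    then show ?thesis
      by (simp add: integral_density) (auto intro!: Bochner_Integration.integral_cong simp: indicator_def)
  qed
  show ?thesis
    unfolding same_trig_def using key[of cos] key[of sin] by (auto simp: conv sets)
qed

lemma sets_cylinder:
  fixes l :: "('a::real_inner \<times> real set) list"
  assumes "\<forall>(u, A)\<in>set l. A \<in> sets borel"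
  shows "{x. \<forall>(u, A)\<in>set l. u \<bullet> x \<in> A} \<in> sets borel"
  using assms
proof (induction l)
  case (Cons p l)
  obtain u A where p: "p = (u, A)" by (cases p)
  with Cons have [measurable]: "A \<in> sets borel" by auto
  have "{x. \<forall>(u, A)\<in>set (p # l). u \<bullet> x \<in> A} = {x. u \<bullet> x \<in> A} \<inter> {x. \<forall>(u, A)\<in>set l. u \<bullet> x \<in> A}"
    by (auto simp: p)
  also have "\<dots> \<in> sets borel"
    using Cons by (intro sets.Int) (measurable, auto)
  finally show ?case .
qed simp

text \<open>Each constraint is absorbed into the measures by restricting both of them to it, which
  preserves \<open>same_trig\<close>; hence the induction over all \<open>M\<close> and
  \<open>N\<close>. For the empty list, \<open>e = 0\<close> compares the total masses.\<close>

lemma same_trig_cylinder: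
  assumes "finite_measure M" "finite_measure N" "sets M = sets borel" "sets N = sets borel"
    and "same_trig M N" "\<forall>(u, A)\<in>set l. A \<in> sets borel"
  shows "emeasure M {x. \<forall>(u, A)\<in>set l. u \<bullet> x \<in> A} = emeasure N {x. \<forall>(u, A)\<in>set l. u \<bullet> x \<in> A}"
  using assms
proof (induction l arbitrary: M N)
  case Nil
  interpret M: finite_measure M by fact
  interpret N: finite_measure N by fact
  have "measure M UNIV = measure N UNIV"
    using Nil(5) sets_eq_imp_space_eq[OF Nil(3)] sets_eq_imp_space_eq[OF Nil(4)]
    unfolding same_trig_def by (auto dest!: spec[of _ 0])
  then show ?case by (simp add: M.emeasure_eq_measure N.emeasure_eq_measure)
next
  case (Cons p l)
  obtain u A where p: "p = (u, A)" by (cases p)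
  with Cons have A [measurable]: "A \<in> sets borel" by auto
  let ?C = "{x. \<forall>(u, A)\<in>set l. u \<bullet> x \<in> A}"
  have C [measurable]: "?C \<in> sets borel"
    using Cons by (intro sets_cylinder) auto
  let ?r = "\<lambda>K. density K (indicator {x. u \<bullet> x \<in> A})"
  have fin: "finite_measure (?r K)" if "finite_measure K" "sets K = sets borel" for K
    using that by (intro finite_measure.finite_measure_restricted) auto
  have "emeasure (?r M) ?C = emeasure (?r N) ?C"
    using Cons by (intro Cons.IH fin same_trig_restrict A) auto
  moreover have "emeasure (?r K) ?C = emeasure K {x. \<forall>(u, A)\<in>set (p # l). u \<bullet> x \<in> A}"
    if K: "sets K = sets borel" for K
  proof -
    note [measurable_cong] = K
    have "emeasure (?r K) ?C = emeasure K ({x. u \<bullet> x \<in> A} \<inter> ?C)"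
      by (subst emeasure_restricted) (auto simp: K)
    also have "{x. u \<bullet> x \<in> A} \<inter> ?C = {x. \<forall>(u, A)\<in>set (p # l). u \<bullet> x \<in> A}" by (auto simp: p)
    finally show ?thesis .
  qed
  ultimately show ?case using Cons by simp
qed

text \<open>By Cauchy-Schwarz, a closed ball is the intersection of the half-spaces
  \<open>d \<bullet> (x - a) \<le> r * norm d\<close>, and a countable dense set of directions
  \<open>d\<close> is enough. Open sets are countable unions of such balls.\<close>

lemma borel_eq_sigma_halfspaces:
  "sets (borel :: 'a::{real_inner, second_countable_topology} measure) =
    sigma_sets UNIV (range (\<lambda>(u, c). {x. u \<bullet> x \<le> c}))"
proof
  let ?G = "range (\<lambda>(u::'a, c). {x. u \<bullet> x \<le> c})"
  interpret sigma_algebra UNIV "sigma_sets UNIV ?G"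
    by (rule sigma_algebra_sigma_sets) auto
  obtain D :: "'a set" where D: "countable D" "\<And>U. open U \<Longrightarrow> U \<noteq> {} \<Longrightarrow> \<exists>d\<in>D. d \<in> U"
    by (rule countable_dense_setE) blast
  have D0: "D \<noteq> {}" using D(2)[of UNIV] by auto
  have cball: "cball a r \<in> sigma_sets UNIV ?G" if "r \<ge> 0" for a r
  proof -
    have "cball a r = (\<Inter>d\<in>D. {x. d \<bullet> x \<le> r * norm d + d \<bullet> a})"
    proof (intro set_eqI iffI)
      fix x assume "x \<in> cball a r"
      then have n: "norm (x - a) \<le> r" by (simp add: dist_norm norm_minus_commute)
      have "d \<bullet> (x - a) \<le> r * norm d" for d
        using norm_cauchy_schwarz[of d "x - a"] mult_left_mono[OF n, of "norm d"] by (simp add: mult.commute)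
      then show "x \<in> (\<Inter>d\<in>D. {x. d \<bullet> x \<le> r * norm d + d \<bullet> a})"
        by (auto simp: inner_diff_right algebra_simps)
    next
      fix x assume x: "x \<in> (\<Inter>d\<in>D. {x. d \<bullet> x \<le> r * norm d + d \<bullet> a})"
      \<comment> \<open>The directions violated by \<open>x\<close> form an open set, so if there
        were one, there would be one in \<open>D\<close>. The direction \<open>x - a\<close> itself
        then gives the bound on the norm.\<close>
      let ?U = "{d. d \<bullet> (x - a) > r * norm d}"
      have "open ?U" by (intro open_Collect_less continuous_intros)
      moreover have "\<not> (\<exists>d\<in>D. d \<in> ?U)"
        using x by (fastforce simp: inner_diff_right)
      ultimately have "?U = {}" using D(2)[of ?U] by blast
      then have "(x - a) \<bullet> (x - a) \<le> r * norm (x - a)" by (auto simp: not_less)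
      then have "norm (x - a) * norm (x - a) \<le> r * norm (x - a)"
        by (simp add: power2_norm_eq_inner[symmetric] power2_eq_square)
      then have "norm (x - a) \<le> r" using that by (cases "norm (x - a) = 0") auto
      then show "x \<in> cball a r" by (simp add: dist_norm norm_minus_commute)
    qed
    moreover have "{x. d \<bullet> x \<le> c} \<in> sigma_sets UNIV ?G" for d c
      by (rule sigma_sets.Basic) auto
    ultimately show ?thesis
      using D(1) D0 by (auto intro!: countable_INT')
  qed
  show "sets borel \<subseteq> sigma_sets UNIV ?G"
    unfolding borel_def
  proof (simp, rule sigma_sets_mono, rule subsetI)
    fix U :: "'a set" assume "U \<in> Collect open"
    then have U: "open U" by simp
    let ?I = "{(a, q). a \<in> D \<and> q \<in> \<rat> \<and> 0 \<le> q \<and> cball a q \<subseteq> U}"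
    have "?I \<subseteq> D \<times> \<rat>" by auto
    then have "countable ?I"
      by (rule countable_subset) (intro countable_SIGMA D(1) countable_rat)
    then have "(\<Union>(a, q)\<in>?I. cball a q) \<in> sigma_sets UNIV ?G"
      by (intro countable_UN') (auto intro: cball)
    moreover have "(\<Union>(a, q)\<in>?I. cball a q) = U"
    proof (intro equalityI subsetI)
      fix x assume "x \<in> U"
      then obtain e where e: "e > 0" "ball x e \<subseteq> U" using U openE by blast
      obtain q where q: "q \<in> \<rat>" "0 < q" "q < e / 2"
        using Rats_dense_in_real[of 0 "e/2"] e by auto
      obtain a where a: "a \<in> D" "a \<in> ball x q"
        using D(2)[of "ball x q"] q by auto
      have "cball a q \<subseteq> ball x e"
      proof
        fix y assume "y \<in> cball a q"
        then show "y \<in> ball x e"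
          using dist_triangle[of x y a] a q by simp
      qed
      with e a q show "x \<in> (\<Union>(a, q)\<in>?I. cball a q)"
        by (intro UN_I[of "(a, q)"]) (auto simp: dist_commute)
    qed auto
    ultimately show "U \<in> sigma_sets UNIV ?G" by simp
  qed
  show "sigma_sets UNIV ?G \<subseteq> sets borel"
  proof -
    have "{x::'a. u \<bullet> x \<le> c} \<in> sets borel" for u c by measurable
    then have "?G \<subseteq> sets borel" by auto
    then show ?thesis using sets.sigma_sets_subset[of ?G "borel::'a measure"] by simp
  qed
qed

text \<open>Cylinders form a generator stable under intersection: appending two lists of constraints
  intersects their cylinders, and every half-space is a cylinder with one constraint.\<close>

theorem measure_eqI_trig:
  fixes M N :: "'a::{real_inner, second_countable_topology} measure"
  assumes "finite_measure M" "finite_measure N" and sets: "sets M = sets borel" "sets N = sets borel"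
    and "same_trig M N"
  shows "M = N"
proof -
  define cyl where "cyl l = {x::'a. \<forall>(u, A)\<in>set l. u \<bullet> x \<in> A}" for l
  define L where "L = {l::('a \<times> real set) list. \<forall>(u, A)\<in>set l. A \<in> sets borel}"
  interpret M: finite_measure M by fact
  have "cyl ` L \<subseteq> sets borel"
    by (auto simp: cyl_def L_def intro!: sets_cylinder)
  then have "sigma_sets UNIV (cyl ` L) \<subseteq> sets borel"
    using sets.sigma_sets_subset[of "cyl ` L" "borel::'a measure"] by simp
  moreover have "sets borel \<subseteq> sigma_sets UNIV (cyl ` L)"
    unfolding borel_eq_sigma_halfspaces
  proof (rule sigma_sets_mono, rule subsetI)
    fix X assume "X \<in> range (\<lambda>(u::'a, c). {x. u \<bullet> x \<le> c})"
    then obtain u c where "X = cyl [(u, {..c})]" by (auto simp: cyl_def)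
    moreover have "[(u, {..c})] \<in> L" by (simp add: L_def)
    ultimately show "X \<in> sigma_sets UNIV (cyl ` L)"
      by (auto intro: sigma_sets.Basic)
  qed
  ultimately have E: "sets borel = sigma_sets UNIV (cyl ` L)" by blast
  show ?thesis
  proof (rule measure_eqI_generator_eq[where E="cyl ` L" and \<Omega>=UNIV and A="\<lambda>_. UNIV"])
    show "Int_stable (cyl ` L)"
    proof (rule Int_stableI)
      fix X Y assume "X \<in> cyl ` L" "Y \<in> cyl ` L"
      then obtain l m where "l \<in> L" "X = cyl l" "m \<in> L" "Y = cyl m" by auto
      then have "X \<inter> Y = cyl (l @ m)" "l @ m \<in> L" by (auto simp: cyl_def L_def)
      then show "X \<inter> Y \<in> cyl ` L" by blast
    qed
    show "emeasure M X = emeasure N X" if "X \<in> cyl ` L" for X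
      using that same_trig_cylinder[OF assms] by (auto simp: cyl_def L_def)
    have "cyl [] = UNIV" "[] \<in> L" by (auto simp: cyl_def L_def)
    then show "range (\<lambda>_::nat. UNIV) \<subseteq> cyl ` L" by blast
  qed (auto simp: sets E M.emeasure_finite)
qed

section \<open>Gaussian measures on Hilbert spaces\<close>

lemma integral_pair_times:
  fixes f :: "'a \<Rightarrow> complex" and g :: "'b \<Rightarrow> complex"
  assumes "prob_space M" "prob_space N" 
    and [measurable]: "f \<in> borel_measurable M" "g \<in> borel_measurable N"
    and b: "\<And>x. norm (f x) \<le> 1" "\<And>y. norm (g y) \<le> 1"
  shows "(\<integral>z. f (fst z) * g (snd z) \<partial>(M \<Otimes>\<^sub>M N)) = (\<integral>x. f x \<partial>M) * (\<integral>y. g y \<partial>N)"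
proof -
  interpret M: prob_space M by fact
  interpret N: prob_space N by fact
  interpret P: pair_prob_space M N ..
  have b': "norm (f x * g y) \<le> 1" for x y
    using mult_mono[OF b(1)[of x] b(2)[of y]] by (simp add: norm_mult)
  have "integrable (M \<Otimes>\<^sub>M N) (\<lambda>z. f (fst z) * g (snd z))"
    by (rule P.integrable_const_bound[of _ 1]) (auto simp: b')
  then have i: "integrable (M \<Otimes>\<^sub>M N) (\<lambda>(x, y). f x * g y)" by (simp add: case_prod_beta')
  show ?thesis
    using P.integral_fst'[OF i] by (simp add: case_prod_beta')
qed

text \<open>Here \<open>s\<close> is half the variance of \<open>e \<bullet> x\<close>. The case
  \<open>e = 0\<close>, to which the definition of nondegeneracy does not speak, has the same form
  with \<open>m = s = 0\<close>, so later computations need no case distinction.\<close>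

lemma nondegenerate_gaussian_char:
  fixes h :: "'a::real_inner measure"
  assumes h: "nondegenerate_gaussian h"
  obtains m s where "\<And>t. (CLINT x|h. iexp (t * (e \<bullet> x))) = exp (\<i> * of_real (t * m) - of_real (t\<^sup>2 * s))"
proof (cases "e = 0")
  case True
  interpret prob_space h using h by (simp add: nondegenerate_gaussian_def)
  show ?thesis by (rule that[of 0 0]) (simp add: True prob_space)
next
  case False
  interpret prob_space h using h by (simp add: nondegenerate_gaussian_def)
  have sets [measurable_cong]: "sets h = sets borel" using h by (simp add: nondegenerate_gaussian_def)
  have "blinfun_inner_right e \<noteq> 0"
    using False by (metis blinfun_inner_right.rep_eq inner_eq_zero_iff zero_blinfun.rep_eq)
  then obtain m s where s: "s > 0" and
    d: "distributed h lborel (blinfun_apply (blinfun_inner_right e)) (\<lambda>x. ennreal (normal_density m s x))"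
    using h unfolding nondegenerate_gaussian_def by blast
  then have d: "distributed h lborel (\<lambda>x. e \<bullet> x) (\<lambda>x. ennreal (normal_density m s x))"
    by (simp add: blinfun_inner_right.rep_eq[abs_def])
  then have "distributed h lborel (\<lambda>x. (e \<bullet> x - m) / s) (\<lambda>x. ennreal (std_normal_density x))"
    using normal_standard_normal_convert[OF s] by blast
  then have dd: "distr h lborel (\<lambda>x. (e \<bullet> x - m) / s) = std_normal_distribution"
    by (rule distributed_distr_eq_density)
  have Z: "(CLINT x|h. iexp (u * ((e \<bullet> x - m) / s))) = complex_of_real (exp (- (u\<^sup>2) / 2))" for u
  proof -
    have "char (distr h lborel (\<lambda>x. (e \<bullet> x - m) / s)) u = complex_of_real (exp (- (u\<^sup>2) / 2))"
      unfolding dd char_std_normal_distribution ..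
    then show ?thesis unfolding char_def
      by (subst (asm) integral_distr) auto
  qed
  have "(CLINT x|h. iexp (t * (e \<bullet> x))) = exp (\<i> * of_real (t * m) - of_real (t\<^sup>2 * (s\<^sup>2 / 2)))" for t
  proof -
    have "iexp (t * (e \<bullet> x)) = iexp (t * m) * iexp (t * s * ((e \<bullet> x - m) / s))" for x
    proof -
      have "t * (e \<bullet> x) = t * m + t * s * ((e \<bullet> x - m) / s)" using s by (simp add: field_simps)
      then show ?thesis by (simp only: of_real_add distrib_left exp_add)
    qed
    then have "(CLINT x|h. iexp (t * (e \<bullet> x))) = iexp (t * m) * (CLINT x|h. iexp (t * s * ((e \<bullet> x - m) / s)))"
      by (simp del: of_real_mult)
    also have "\<dots> = exp (\<i> * of_real (t * m)) * exp (complex_of_real (- ((t * s)\<^sup>2) / 2))"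
      unfolding Z exp_of_real ..
    also have "\<dots> = exp (\<i> * of_real (t * m) - of_real (t\<^sup>2 * (s\<^sup>2 / 2)))"
      unfolding exp_add[symmetric] by (simp add: power_mult_distrib)
    finally show ?thesis .
  qed
  then show ?thesis by (rule that)
qed

lemma same_trigI:
  fixes M N :: "'a::real_inner measure"
  assumes "finite_measure M" "finite_measure N" "sets M = sets borel" "sets N = sets borel"
    and eq: "\<And>e. (CLINT x|M. iexp (e \<bullet> x)) = (CLINT x|N. iexp (e \<bullet> x))"
  shows "same_trig M N"
proof -
  have *: "Re (CLINT x|K. iexp (e \<bullet> x)) = (\<integral>x. cos (e \<bullet> x) \<partial>K)" "Im (CLINT x|K. iexp (e \<bullet> x)) = (\<integral>x. sin (e \<bullet> x) \<partial>K)"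
    if "finite_measure K" and [measurable_cong]: "sets K = sets borel" for e and K :: "'a measure"
  proof -
    interpret finite_measure K by fact
    have "integrable K (\<lambda>x. iexp (e \<bullet> x))"
      by (rule integrable_const_bound[of _ 1]) auto
    then show "Re (CLINT x|K. iexp (e \<bullet> x)) = (\<integral>x. cos (e \<bullet> x) \<partial>K)" "Im (CLINT x|K. iexp (e \<bullet> x)) = (\<integral>x. sin (e \<bullet> x) \<partial>K)"
      by (simp_all add: integral_Re[symmetric] integral_Im[symmetric] Re_exp Im_exp)
  qed
  show ?thesis
    unfolding same_trig_def
    using *(1)[OF assms(1,3)] *(1)[OF assms(2,4)] *(2)[OF assms(1,3)] *(2)[OF assms(2,4)] eq by metis
qed

text \<open>The condition \<open>a + b + c = 1\<close> preserves the mean, so \<open>h\<close> need not be centred.  Two copies would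
  not suffice: \<open>a + b = 1 = a\<^sup>2 + b\<^sup>2\<close> has only trivial solutions.\<close>

theorem gaussian_rotation:
  fixes h :: "'a::{real_inner, second_countable_topology} measure"
  assumes h: "nondegenerate_gaussian h" and abc: "a + b + c = 1" "a\<^sup>2 + b\<^sup>2 + c\<^sup>2 = 1"
  shows "distr (h \<Otimes>\<^sub>M (h \<Otimes>\<^sub>M h)) borel (\<lambda>(x, y, z). a *\<^sub>R x + b *\<^sub>R y + c *\<^sub>R z) = h"
proof -
  interpret prob_space h using h by (simp add: nondegenerate_gaussian_def)
  interpret P: pair_prob_space h h ..
  interpret Q: pair_prob_space h "h \<Otimes>\<^sub>M h" ..
  have sets [measurable_cong]: "sets h = sets borel" using h by (simp add: nondegenerate_gaussian_def)
  let ?T = "\<lambda>(x, y, z). a *\<^sub>R x + b *\<^sub>R y + c *\<^sub>R z"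
  have T [measurable]: "?T \<in> h \<Otimes>\<^sub>M (h \<Otimes>\<^sub>M h) \<rightarrow>\<^sub>M borel" by measurable
  have fin: "finite_measure (distr (h \<Otimes>\<^sub>M (h \<Otimes>\<^sub>M h)) borel ?T)"
    by (rule finite_measure.finite_measure_distr[OF Q.finite_measure_axioms T])
  show ?thesis
  proof (rule measure_eqI_trig[OF fin _ _ sets same_trigI[OF fin _ _ sets]])
    fix e
    obtain m s where ms: "\<And>t. (CLINT x|h. iexp (t * (e \<bullet> x))) = exp (\<i> * of_real (t * m) - of_real (t\<^sup>2 * s))"
      using nondegenerate_gaussian_char[OF h, of e] by blast
    have p: "prob_space h" "prob_space (h \<Otimes>\<^sub>M h)" by unfold_locales
    have "(CLINT x|distr (h \<Otimes>\<^sub>M (h \<Otimes>\<^sub>M h)) borel ?T. iexp (e \<bullet> x)) =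
      (CLINT w|(h \<Otimes>\<^sub>M (h \<Otimes>\<^sub>M h)). iexp (a * (e \<bullet> fst w)) * (iexp (b * (e \<bullet> fst (snd w))) * iexp (c * (e \<bullet> snd (snd w)))))"
      by (subst integral_distr, measurable)
        (simp add: case_prod_beta' inner_add_right exp_add distrib_left mult.assoc)
    also have "\<dots> = (CLINT x|h. iexp (a * (e \<bullet> x))) *
        (CLINT w|(h \<Otimes>\<^sub>M h). iexp (b * (e \<bullet> fst w)) * iexp (c * (e \<bullet> snd w)))"
      by (rule integral_pair_times[OF p]) (auto simp: norm_mult simp del: of_real_mult)
    also have "\<dots> = (CLINT x|h. iexp (a * (e \<bullet> x))) *
        ((CLINT x|h. iexp (b * (e \<bullet> x))) * (CLINT x|h. iexp (c * (e \<bullet> x))))"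
      by (subst integral_pair_times[OF p(1,1), where f="\<lambda>x. iexp (b * (e \<bullet> x))" and g="\<lambda>x. iexp (c * (e \<bullet> x))"])
        (auto simp del: of_real_mult)
    \<comment> \<open>Means are weighted by the coefficients and variances by their squares: this is
      where both constraints on \<open>a\<close>, \<open>b\<close>, \<open>c\<close> enter.\<close>
    also have "\<dots> = exp (\<i> * of_real ((a + b + c) * m) - of_real ((a\<^sup>2 + b\<^sup>2 + c\<^sup>2) * s))"
      unfolding ms by (simp add: exp_add[symmetric] algebra_simps)
    also have "\<dots> = (CLINT x|h. iexp (e \<bullet> x))"
      using ms[of 1] by (simp add: abc)
    finally show "(CLINT x|distr (h \<Otimes>\<^sub>M (h \<Otimes>\<^sub>M h)) borel ?T. iexp (e \<bullet> x)) = (CLINT x|h. iexp (e \<bullet> x))" .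
  qed (simp_all add: finite_measure_axioms)
qed

text \<open>For \<open>-1/3 \<le> t \<le> 1\<close> the equations \<open>a + b = 1 - t\<close> and \<open>a\<^sup>2 + b\<^sup>2 = 1 - t\<^sup>2\<close>
  have real solutions; this is the affine combination that \<open>gaussian_rotation\<close> provides.\<close>

lemma orthogonal_to_affine:
  fixes S :: "'a::{real_inner, complete_space} set"
  assumes S: "closed S" "S \<noteq> {}" "x0 \<notin> S"
    and aff: "\<And>x y t. x \<in> S \<Longrightarrow> y \<in> S \<Longrightarrow> - (1/3) \<le> t \<Longrightarrow> t \<le> 1 \<Longrightarrow> (1 - t) *\<^sub>R x + t *\<^sub>R y \<in> S"
  obtains e p where "e \<noteq> 0" "\<And>x. x \<in> S \<Longrightarrow> e \<bullet> x = e \<bullet> p"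
proof -
  define d where "d = infdist x0 S"
  have d0: "d \<ge> 0" by (simp add: d_def infdist_nonneg)
  have dle: "d \<le> norm (x0 - y)" if "y \<in> S" for y
    using infdist_le[OF that, of x0] by (simp add: d_def dist_norm)
  have "\<exists>y\<in>S. norm (x0 - y) < d + 1 / Suc n" for n :: nat
  proof -
    have "(INF y\<in>S. dist x0 y) < d + 1 / Suc n" using S(2) by (simp add: d_def infdist_notempty)
    then show ?thesis
      using S(2) by (subst (asm) cINF_less_iff) (auto simp: dist_norm intro!: bdd_belowI[of _ 0])
  qed
  then obtain y where y: "\<And>n. y n \<in> S" "\<And>n::nat. norm (x0 - y n) < d + 1 / Suc n" by metis
  \<comment> \<open>The parallelogram identity at the midpoint \<open>t = 1/2\<close>: the midpoint
    lies in \<open>S\<close>, so its distance from \<open>x0\<close> is at least \<open>d\<close>,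
    and a minimising sequence is Cauchy.\<close>
  have key: "(norm (y m - y n))\<^sup>2 \<le> 2 * ((d + 1 / Suc m)\<^sup>2 - d\<^sup>2) + 2 * ((d + 1 / Suc n)\<^sup>2 - d\<^sup>2)" for m n
  proof -
    have "(1 - 1/2) *\<^sub>R y m + (1/2) *\<^sub>R y n \<in> S" by (intro aff y) auto
    from dle[OF this] have 1: "d\<^sup>2 \<le> (norm (x0 - ((1 - 1/2) *\<^sub>R y m + (1/2) *\<^sub>R y n)))\<^sup>2"
      using d0 by (intro power_mono)
    have 2: "(norm (y m - y n))\<^sup>2 + 4 * (norm (x0 - ((1 - 1/2) *\<^sub>R y m + (1/2) *\<^sub>R y n)))\<^sup>2
        = 2 * (norm (x0 - y m))\<^sup>2 + 2 * (norm (x0 - y n))\<^sup>2"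
      unfolding power2_norm_eq_inner
      by (simp add: inner_diff_left inner_diff_right inner_add_left inner_add_right inner_commute algebra_simps)
    have n: "(norm (x0 - y k))\<^sup>2 \<le> (d + 1 / Suc k)\<^sup>2" for k
      using y(2)[of k] by (intro power_mono) auto
    have *: "A \<le> 2 * (R - D) + 2 * (S - D)" if "D \<le> N" "A + 4 * N = 2 * P + 2 * Q" "P \<le> R" "Q \<le> S"
      for A D N P Q R S :: real using that by smt
    show ?thesis by (rule *[OF 1 2 n n])
  qed
  have lim1: "(\<lambda>n. 1 / real (Suc n)) \<longlonglongrightarrow> 0"
    using LIMSEQ_inverse_real_of_nat by (simp add: inverse_eq_divide)
  have lim: "(\<lambda>n. 4 * ((d + 1 / Suc n)\<^sup>2 - d\<^sup>2)) \<longlonglongrightarrow> 0"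
  proof -
    have "(\<lambda>n. 4 * ((d + 1 / Suc n)\<^sup>2 - d\<^sup>2)) \<longlonglongrightarrow> 4 * ((d + 0)\<^sup>2 - d\<^sup>2)"
      by (intro tendsto_intros lim1)
    then show ?thesis by simp
  qed
  have "Cauchy y"
  proof (rule CauchyI)
    fix e :: real assume e: "e > 0"
    obtain N where N: "\<And>n. n \<ge> N \<Longrightarrow> 4 * ((d + 1 / Suc n)\<^sup>2 - d\<^sup>2) < e\<^sup>2"
      using order_tendstoD(2)[OF lim, of "e\<^sup>2"] e by (auto simp: eventually_sequentially)
    show "\<exists>N. \<forall>m\<ge>N. \<forall>n\<ge>N. norm (y m - y n) < e"
    proof (intro exI[of _ N] allI impI)
      fix m n assume "m \<ge> N" "n \<ge> N"
      with key[of m n] N[of m] N[of n] have "(norm (y m - y n))\<^sup>2 < e\<^sup>2" by linarith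
      then show "norm (y m - y n) < e" using e by (simp add: power_less_imp_less_base)
    qed
  qed
  then obtain p where p: "y \<longlonglongrightarrow> p" using Cauchy_convergent[of y] unfolding convergent_def by blast
  have pS: "p \<in> S" using S(1) y(1) p closed_sequentially by blast
  have "(\<lambda>n. norm (x0 - y n)) \<longlonglongrightarrow> norm (x0 - p)" by (intro tendsto_intros p)
  moreover have "(\<lambda>n. d + 1 / Suc n) \<longlonglongrightarrow> d + 0"
    by (intro tendsto_intros lim1)
  ultimately have pd: "norm (x0 - p) \<le> d"
    using y(2) by (intro LIMSEQ_le[of "\<lambda>n. norm (x0 - y n)" _ "\<lambda>n. d + 1 / Suc n"]) (auto intro: less_imp_le)
  let ?e = "x0 - p"
  have min: "(norm ?e)\<^sup>2 \<le> (norm (x0 - z))\<^sup>2" if "z \<in> S" for z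
    using dle[OF that] pd by (intro power_mono) auto
  have "?e \<bullet> x = ?e \<bullet> p" if x: "x \<in> S" for x
  proof -
    define w where "w = x - p"
    define \<beta> where "\<beta> = ?e \<bullet> w"
    define \<alpha> where "\<alpha> = (norm w)\<^sup>2"
    \<comment> \<open>First variation of the distance at the nearest point \<open>p\<close>. As
      \<open>t\<close> may take both signs, the linear term \<beta> must vanish, which gives
      equality and not merely the one-sided inequality for convex sets.\<close>
    have q: "2 * t * \<beta> \<le> t\<^sup>2 * \<alpha>" if t: "-(1/3) \<le> t" "t \<le> 1" for t
    proof -
      have "(norm ?e)\<^sup>2 \<le> (norm (x0 - ((1 - t) *\<^sub>R p + t *\<^sub>R x)))\<^sup>2" by (intro min aff pS x t)
      also have "x0 - ((1 - t) *\<^sub>R p + t *\<^sub>R x) = ?e - t *\<^sub>R w" by (simp add: w_def algebra_simps)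
      also have "(norm (?e - t *\<^sub>R w))\<^sup>2 = (norm ?e)\<^sup>2 - 2 * t * \<beta> + t\<^sup>2 * \<alpha>"
        unfolding power2_norm_eq_inner \<alpha>_def \<beta>_def
        by (simp add: inner_diff_left inner_diff_right inner_commute power2_eq_square algebra_simps)
      finally show ?thesis by simp
    qed
    have a0: "\<alpha> \<ge> 0" by (simp add: \<alpha>_def)
    have "\<beta> = 0"
    proof (rule ccontr)
      assume b: "\<beta> \<noteq> 0"
      \<comment> \<open>Small enough for the negative parameters allowed, and such that
        \<open>u * \<alpha> \<le> \<bar>\<beta>\<bar>\<close>, which contradicts the inequality
        \<open>2 * \<bar>\<beta>\<bar> \<le> u * \<alpha>\<close> obtained from
        \<open>q\<close>.\<close>
      define u where "u = min (1/3) (\<bar>\<beta>\<bar> / (\<alpha> + 1))"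
      have "0 < \<bar>\<beta>\<bar> / (\<alpha> + 1)" using b a0 by simp
      then have u: "0 < u" unfolding u_def by (simp only: min_less_iff_conj) simp
      have u3: "u \<le> 1/3" unfolding u_def by (rule min.cobounded1)
      have 2: "u \<le> \<bar>\<beta>\<bar> / (\<alpha> + 1)" unfolding u_def by (rule min.cobounded2)
      have "2 * (sgn \<beta> * u) * \<beta> \<le> (sgn \<beta> * u)\<^sup>2 * \<alpha>"
        using u u3 by (intro q) (auto simp: sgn_if)
      then have "2 * u * \<bar>\<beta>\<bar> \<le> u\<^sup>2 * \<alpha>" using b by (auto simp: sgn_if split: if_splits)
      then have "u * (2 * \<bar>\<beta>\<bar>) \<le> u * (u * \<alpha>)" by (simp add: power2_eq_square mult_ac)
      then have 1: "2 * \<bar>\<beta>\<bar> \<le> u * \<alpha>" using u by simp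
      have "u * \<alpha> \<le> \<bar>\<beta>\<bar> / (\<alpha> + 1) * (\<alpha> + 1)" using 2 a0 by (intro mult_mono) auto
      then have "u * \<alpha> \<le> \<bar>\<beta>\<bar>" using a0 by simp
      then show False using 1 b by linarith
    qed
    then show ?thesis by (simp add: \<beta>_def w_def inner_diff_right)
  qed
  moreover have "?e \<noteq> 0" using pS S(3) by auto
  ultimately show ?thesis using that by blast
qed

text \<open>If a point were missing, the support would lie in a hyperplane
  \<open>e \<bullet> x = e \<bullet> p\<close>; since it has full measure,
  \<open>e \<bullet> x\<close> would be almost surely constant, although its law has a normal
  density.\<close>

theorem gaussian_full_support:
  fixes h :: "'a::{real_inner, complete_space, second_countable_topology} measure"
  assumes h: "nondegenerate_gaussian h"
  shows "measure_support h = UNIV"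
proof (rule ccontr)
  interpret prob_space h using h by (simp add: nondegenerate_gaussian_def)
  interpret PP: prob_space "h \<Otimes>\<^sub>M h" by (intro prob_space_pair prob_space_axioms)
  interpret P: pair_prob_space h h ..
  interpret Q: pair_prob_space h "h \<Otimes>\<^sub>M h" ..
  have sets [measurable_cong]: "sets h = sets borel" using h by (simp add: nondegenerate_gaussian_def)
  have sp: "space h = UNIV" using sets by (simp add: sets_eq_imp_space_eq)
  let ?S = "measure_support h"
  assume "?S \<noteq> UNIV"
  then obtain x0 where x0: "x0 \<notin> ?S" by blast
  \<comment> \<open>The complement of the support is a union of open null sets, possibly
    uncountable; Lindelof's theorem extracts a countable subcover, so the support has full
    measure.\<close>
  define F where "F = {U. open U \<and> emeasure h U = 0}"
  have compl: "- ?S = \<Union>F" by (auto simp: measure_support_def F_def)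
  have cl: "closed ?S"
    unfolding closed_def compl by (auto simp: F_def)
  obtain F' where F': "F' \<subseteq> F" "countable F'" "\<Union>F' = \<Union>F"
    using Lindelof[of F] by (auto simp: F_def)
  have null: "- ?S \<in> null_sets h"
    unfolding compl F'(3)[symmetric]
    using F'(1,2) by (intro null_sets_UN'[of F' "\<lambda>x. x" h, simplified]) (auto simp: F_def null_sets_def sets)
  have ae: "AE x in h. x \<in> ?S"
    using null by (auto intro!: AE_I'[of "- ?S"])
  have ne: "?S \<noteq> {}"
  proof
    assume "?S = {}"
    then have "emeasure h UNIV = 0" using null by auto
    then show False using emeasure_space_1 sp by simp
  qed
  \<comment> \<open>A product neighbourhood of \<open>(x, y, z)\<close> is mapped into
    \<open>U\<close> and has positive measure, since each factor meets the support; by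
    \<open>gaussian_rotation\<close> its measure bounds that of \<open>U\<close> from below.\<close>
  have rot: "a *\<^sub>R x + b *\<^sub>R y + c *\<^sub>R z \<in> ?S"
    if abc: "a + b + c = 1" "a\<^sup>2 + b\<^sup>2 + c\<^sup>2 = 1" and xyz: "x \<in> ?S" "y \<in> ?S" "z \<in> ?S" for a b c x y z
    unfolding measure_support_def
  proof (intro CollectI allI impI)
    fix U assume U: "open U" "a *\<^sub>R x + b *\<^sub>R y + c *\<^sub>R z \<in> U"
    let ?T = "\<lambda>(x, y, z). a *\<^sub>R x + b *\<^sub>R y + c *\<^sub>R z :: 'a"
    have T: "?T \<in> h \<Otimes>\<^sub>M (h \<Otimes>\<^sub>M h) \<rightarrow>\<^sub>M borel" by measurable
    have "open (?T -` U)"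
      by (rule open_vimage[OF U(1)]) (auto simp: case_prod_beta' intro!: continuous_intros)
    moreover have "(x, (y, z)) \<in> ?T -` U" using U by simp
    ultimately obtain A B where AB': "open A" "open B" "(x, (y, z)) \<in> A \<times> B" "A \<times> B \<subseteq> ?T -` U"
      by (rule open_prod_elim)
    then have AB: "open A" "open B" "x \<in> A" "(y, z) \<in> B" "A \<times> B \<subseteq> ?T -` U" by auto
    obtain C D where CD': "open C" "open D" "(y, z) \<in> C \<times> D" "C \<times> D \<subseteq> B"
      using AB(2,4) by (rule open_prod_elim)
    then have CD: "open C" "open D" "y \<in> C" "z \<in> D" "C \<times> D \<subseteq> B" by auto
    have "0 < emeasure h A * (emeasure h C * emeasure h D)"
      using AB CD xyz by (auto simp: measure_support_def ennreal_zero_less_mult_iff)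
    also have "\<dots> = emeasure (h \<Otimes>\<^sub>M (h \<Otimes>\<^sub>M h)) (A \<times> (C \<times> D))"
      using AB CD by (simp add: PP.emeasure_pair_measure_Times emeasure_pair_measure_Times sets)
    also have "emeasure (h \<Otimes>\<^sub>M (h \<Otimes>\<^sub>M h)) (A \<times> (C \<times> D)) \<le> emeasure (h \<Otimes>\<^sub>M (h \<Otimes>\<^sub>M h)) (?T -` U \<inter> space (h \<Otimes>\<^sub>M (h \<Otimes>\<^sub>M h)))"
    proof (rule emeasure_mono)
      show "?T -` U \<inter> space (h \<Otimes>\<^sub>M (h \<Otimes>\<^sub>M h)) \<in> sets (h \<Otimes>\<^sub>M (h \<Otimes>\<^sub>M h))"
        using U by (intro measurable_sets[OF T]) auto
    qed (use AB CD in \<open>auto simp: space_pair_measure sp\<close>)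
    also have "\<dots> = emeasure (distr (h \<Otimes>\<^sub>M (h \<Otimes>\<^sub>M h)) borel ?T) U"
      using U by (subst emeasure_distr[OF T]) auto
    also have "\<dots> = emeasure h U" by (simp add: gaussian_rotation[OF h abc])
    finally show "0 < emeasure h U" .
  qed
  have aff: "(1 - t) *\<^sub>R x + t *\<^sub>R y \<in> ?S" if "x \<in> ?S" "y \<in> ?S" and t: "-(1/3) \<le> t" "t \<le> 1" for x y t
  proof -
    \<comment> \<open>\<open>a\<close> and \<open>b\<close> are the roots of
      \<open>z^2 - (1 - t) z - t (1 - t)\<close>. The discriminant is
      \<open>(1 - t) (1 + 3 t)\<close>, whence the interval for \<open>t\<close>. Both roots are
      used as coefficients of the same point \<open>x\<close>.\<close>
    define D where "D = sqrt ((1 - t)\<^sup>2 + 4 * (t * (1 - t)))"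
    define a where "a = (1 - t + D) / 2"
    define b where "b = (1 - t - D) / 2"
    have "(1 - t)\<^sup>2 + 4 * (t * (1 - t)) = (1 - t) * (1 + 3 * t)" by (simp add: power2_eq_square algebra_simps)
    also have "\<dots> \<ge> 0" using t by (intro mult_nonneg_nonneg) auto
    finally have D: "D\<^sup>2 = (1 - t)\<^sup>2 + 4 * (t * (1 - t))" by (simp add: D_def)
    have "a + b = 1 - t" by (simp add: a_def b_def field_simps)
    moreover have "a\<^sup>2 + b\<^sup>2 = ((1 - t)\<^sup>2 + D\<^sup>2) / 2"
      by (simp add: a_def b_def power2_eq_square field_simps)
    then have "a\<^sup>2 + b\<^sup>2 + t\<^sup>2 = 1" unfolding D by (simp add: power2_eq_square algebra_simps)
    ultimately have "a *\<^sub>R x + b *\<^sub>R x + t *\<^sub>R y \<in> ?S" using that by (intro rot) auto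
    then show ?thesis using \<open>a + b = 1 - t\<close> by (simp flip: scaleR_add_left)
  qed
  obtain e p where e: "e \<noteq> 0" "\<And>x. x \<in> ?S \<Longrightarrow> e \<bullet> x = e \<bullet> p"
    by (rule orthogonal_to_affine[OF cl ne x0]) (use aff in blast)+
  have "blinfun_inner_right e \<noteq> 0"
    using e(1) by (metis blinfun_inner_right.rep_eq inner_eq_zero_iff zero_blinfun.rep_eq)
  then obtain m s where s: "s > 0" and
    d: "distributed h lborel (blinfun_apply (blinfun_inner_right e)) (\<lambda>x. ennreal (normal_density m s x))"
    using h unfolding nondegenerate_gaussian_def by blast
  then have d: "distributed h lborel (\<lambda>x. e \<bullet> x) (\<lambda>x. ennreal (normal_density m s x))"
    by (simp add: blinfun_inner_right.rep_eq[abs_def])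
  have "AE x in h. e \<bullet> x = e \<bullet> p" using ae by eventually_elim (rule e)
  then have "emeasure h {x. e \<bullet> x = e \<bullet> p} = 1"
    by (intro emeasure_eq_1_AE) (auto simp: sets)
  moreover have "emeasure h {x. e \<bullet> x = e \<bullet> p} = (\<integral>\<^sup>+x. ennreal (normal_density m s x) * indicator {e \<bullet> p} x \<partial>lborel)"
    using distributed_emeasure[OF d, of "{e \<bullet> p}"] by (simp add: vimage_def sp)
  moreover have "\<dots> = 0"
    by (simp add: nn_integral_0_iff_AE)
  ultimately show False by simp
qed

section \<open>The Hilbert space of square integrable maps\<close>

lemma square_integrable_rep: "square_integrable (rep_cube_L2 X)"
  using Quotient3_rep_reflp[OF Quotient3_cube_L2] by (auto simp: L2_rel_def)

lemma abs_rep_cube_L2: "abs_cube_L2 (rep_cube_L2 X) = X"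
  by (rule Quotient3_abs_rep[OF Quotient3_cube_L2])

lemma cube_L2_cases:
  obtains f where "square_integrable f" "X = abs_cube_L2 f"
  using square_integrable_rep abs_rep_cube_L2 by metis

lemma L2_rel_refl: "square_integrable f \<Longrightarrow> L2_rel f f"
  by (simp add: L2_rel_def)

lemma norm_abs_cube_L2:
  "square_integrable f \<Longrightarrow> (norm (abs_cube_L2 f))\<^sup>2 = (\<integral>x. (norm (f x))\<^sup>2 \<partial>cube_measure)"
  by (simp add: power2_norm_eq_inner inner_cube_L2.abs_eq L2_rel_refl)

lemma nn_integral_norm_abs_cube_L2:
  "square_integrable f \<Longrightarrow> (\<integral>\<^sup>+x. ennreal ((norm (f x))\<^sup>2) \<partial>cube_measure) = ennreal ((norm (abs_cube_L2 f))\<^sup>2)"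
  by (subst nn_integral_eq_integral) (auto simp: norm_abs_cube_L2 square_integrable_def)

lemma minus_abs_cube_L2:
  "square_integrable f \<Longrightarrow> square_integrable g \<Longrightarrow> abs_cube_L2 f - abs_cube_L2 g = abs_cube_L2 (\<lambda>x. f x - g x)"
  by (simp add: minus_cube_L2.abs_eq L2_rel_refl)

lemma square_integrableI:
  assumes "f \<in> borel_measurable cube_measure" "(\<integral>\<^sup>+x. ennreal ((norm (f x))\<^sup>2) \<partial>cube_measure) < \<infinity>"
  shows "square_integrable f"
  using assms by (auto simp: square_integrable_def intro!: integrableI_bounded)

text \<open>The Riesz-Fischer argument: a geometric rate makes the increments summable in
  \<open>L^1\<close>, so representatives converge almost everywhere, and Fatou's lemma carries the
  \<open>L^2\<close> rate over to the limit.\<close>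

lemma cube_L2_rapid_Cauchy_convergent:
  fixes X :: "nat \<Rightarrow> 'n::finite cube_L2"
  assumes X: "\<And>m n. n \<le> m \<Longrightarrow> norm (X m - X n) \<le> (1/2) ^ n"
  shows "\<exists>L. X \<longlonglongrightarrow> L"
proof -
  let ?\<mu> = "cube_measure :: (real^'n) measure"
  interpret prob_space ?\<mu> by (rule prob_space_cube_measure)
  define f where "f n = rep_cube_L2 (X n)" for n
  have sq: "square_integrable (f n)" for n by (simp add: f_def square_integrable_rep)
  have [measurable]: "f n \<in> borel_measurable ?\<mu>" for n using sq by (simp add: square_integrable_def)
  have Xf: "X n = abs_cube_L2 (f n)" for n by (simp add: f_def abs_rep_cube_L2)
  have nn: "(\<integral>\<^sup>+x. ennreal ((norm (f m x - f n x))\<^sup>2) \<partial>?\<mu>) \<le> ennreal (((1/2)^n)\<^sup>2)" if "n \<le> m" for m n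
    unfolding nn_integral_norm_abs_cube_L2[OF square_integrable_diff[OF sq sq]]
      minus_abs_cube_L2[OF sq sq, symmetric] Xf[symmetric]
    by (intro ennreal_leI power_mono X that) simp
  have bound: "(\<integral>\<^sup>+x. ennreal (norm (f (Suc n) x - f n x)) \<partial>?\<mu>) \<le> ennreal ((1/2)^n)" for n
  proof -
    define c where "c = (1/2::real)^n"
    have c: "c > 0" by (simp add: c_def)
    \<comment> \<open>Young's inequality with parameter \<open>c\<close>: the bound
      \<open>c\<^sup>2\<close> for the integral of the squared increment becomes the bound
      \<open>c\<close> for the integral of the increment.\<close>
    have "r \<le> (1 / (2 * c)) * r\<^sup>2 + c / 2" for r :: real
    proof -
      have "2 * c * r \<le> r\<^sup>2 + c\<^sup>2" using sum_squares_bound[of r c] by (simp add: algebra_simps)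
      then show ?thesis using c by (simp add: field_simps power2_eq_square)
    qed
    then have "ennreal (norm (f (Suc n) x - f n x)) \<le> ennreal (1 / (2 * c)) * ennreal ((norm (f (Suc n) x - f n x))\<^sup>2) + ennreal (c / 2)" for x
      using c by (simp add: ennreal_mult'[symmetric] ennreal_plus[symmetric] ennreal_leI del: ennreal_plus)
    then have "(\<integral>\<^sup>+x. ennreal (norm (f (Suc n) x - f n x)) \<partial>?\<mu>) \<le>
       (\<integral>\<^sup>+x. ennreal (1 / (2 * c)) * ennreal ((norm (f (Suc n) x - f n x))\<^sup>2) + ennreal (c / 2) \<partial>?\<mu>)"
      by (rule nn_integral_mono)
    also have "\<dots> = ennreal (1 / (2 * c)) * (\<integral>\<^sup>+x. ennreal ((norm (f (Suc n) x - f n x))\<^sup>2) \<partial>?\<mu>) + ennreal (c / 2)"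
      by (subst nn_integral_add) (auto simp: nn_integral_cmult emeasure_space_1)
    also have "\<dots> \<le> ennreal (1 / (2 * c)) * ennreal (c\<^sup>2) + ennreal (c / 2)"
      unfolding c_def by (intro add_mono mult_left_mono nn) auto
    also have "\<dots> = ennreal c"
      using c by (simp add: ennreal_mult'[symmetric] ennreal_plus[symmetric] power2_eq_square del: ennreal_plus)
    finally show ?thesis by (simp add: c_def)
  qed
  have "(\<integral>\<^sup>+x. (\<Sum>n. ennreal (norm (f (Suc n) x - f n x))) \<partial>?\<mu>) = (\<Sum>n. \<integral>\<^sup>+x. ennreal (norm (f (Suc n) x - f n x)) \<partial>?\<mu>)"
    by (rule nn_integral_suminf) measurable
  also have "\<dots> \<le> (\<Sum>n. ennreal ((1/2)^n))"
    by (intro suminf_le bound) auto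
  also have "\<dots> = ennreal (\<Sum>n. (1/2)^n)"
    by (rule suminf_ennreal2) (auto intro!: summable_geometric)
  finally have "(\<integral>\<^sup>+x. (\<Sum>n. ennreal (norm (f (Suc n) x - f n x))) \<partial>?\<mu>) \<noteq> \<infinity>"
    by (auto simp: top_unique)
  then have "AE x in ?\<mu>. (\<Sum>n. ennreal (norm (f (Suc n) x - f n x))) \<noteq> \<infinity>"
    by (intro nn_integral_PInf_AE) auto
  then have conv: "AE x in ?\<mu>. convergent (\<lambda>n. f n x)"
  proof eventually_elim
    case (elim x)
    then have "summable (\<lambda>n. norm (f (Suc n) x - f n x))"
      by (intro summable_suminf_not_top) auto
    then have "summable (\<lambda>n. f (Suc n) x - f n x)" by (rule summable_norm_cancel)
    then have "(\<lambda>n. \<Sum>i<n. f (Suc i) x - f i x) \<longlonglongrightarrow> (\<Sum>i. f (Suc i) x - f i x)" by (rule summable_LIMSEQ)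
    then have "(\<lambda>n. f n x - f 0 x) \<longlonglongrightarrow> (\<Sum>i. f (Suc i) x - f i x)" by (simp add: sum_lessThan_telescope[of "\<lambda>i. f i x"])
    then have "(\<lambda>n. (f n x - f 0 x) + f 0 x) \<longlonglongrightarrow> (\<Sum>i. f (Suc i) x - f i x) + f 0 x" by (intro tendsto_intros)
    then show ?case by (auto simp: convergent_def)
  qed
  define F where "F x = lim (\<lambda>n. f n x)" for x
  have [measurable]: "F \<in> borel_measurable ?\<mu>" unfolding F_def by measurable
  have lim: "AE x in ?\<mu>. (\<lambda>n. f n x) \<longlonglongrightarrow> F x"
    using conv by eventually_elim (simp add: F_def convergent_LIMSEQ_iff)
  have fatou: "(\<integral>\<^sup>+x. ennreal ((norm (F x - f n x))\<^sup>2) \<partial>?\<mu>) \<le> ennreal (((1/2)^n)\<^sup>2)" for n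
  proof -
    have "AE x in ?\<mu>. ennreal ((norm (F x - f n x))\<^sup>2) = liminf (\<lambda>m. ennreal ((norm (f m x - f n x))\<^sup>2))"
      using lim
    proof eventually_elim
      case (elim x)
      then have "(\<lambda>m. ennreal ((norm (f m x - f n x))\<^sup>2)) \<longlonglongrightarrow> ennreal ((norm (F x - f n x))\<^sup>2)"
        by (intro tendsto_intros)
      from lim_imp_Liminf[OF _ this] show ?case by simp
    qed
    then have "(\<integral>\<^sup>+x. ennreal ((norm (F x - f n x))\<^sup>2) \<partial>?\<mu>) = (\<integral>\<^sup>+x. liminf (\<lambda>m. ennreal ((norm (f m x - f n x))\<^sup>2)) \<partial>?\<mu>)"
      by (rule nn_integral_cong_AE)
    also have "\<dots> \<le> liminf (\<lambda>m. \<integral>\<^sup>+x. ennreal ((norm (f m x - f n x))\<^sup>2) \<partial>?\<mu>)"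
      by (rule nn_integral_liminf) measurable
    also have "\<dots> \<le> liminf (\<lambda>m. ennreal (((1/2)^n)\<^sup>2))"
      by (intro Liminf_mono) (auto simp: eventually_sequentially intro!: exI[of _ n] nn)
    finally show ?thesis by (simp add: Liminf_const)
  qed
  have "square_integrable (\<lambda>x. F x - f 0 x)"
    by (rule square_integrableI) (auto intro: le_less_trans[OF fatou])
  from square_integrable_add[OF this sq[of 0]] have sqF: "square_integrable F" by simp
  have le: "norm (abs_cube_L2 F - X n) \<le> (1/2)^n" for n
  proof -
    have "ennreal ((norm (abs_cube_L2 F - X n))\<^sup>2) \<le> ennreal (((1/2)^n)\<^sup>2)"
      unfolding Xf minus_abs_cube_L2[OF sqF sq] nn_integral_norm_abs_cube_L2[OF square_integrable_diff[OF sqF sq], symmetric]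
      by (rule fatou)
    then show ?thesis by (auto simp: ennreal_le_iff intro: power2_le_imp_le)
  qed
  have "(\<lambda>n. X n - abs_cube_L2 F) \<longlonglongrightarrow> 0"
    by (rule Lim_null_comparison[of _ "\<lambda>n. (1/2)^n"])
      (auto intro!: always_eventually LIMSEQ_power_zero simp: norm_minus_commute[of "X _"] le)
  then have "X \<longlonglongrightarrow> abs_cube_L2 F" by (rule LIM_zero_cancel)
  then show ?thesis ..
qed

instance cube_L2 :: (finite) complete_space
proof
  fix X :: "nat \<Rightarrow> 'a cube_L2"
  assume C: "Cauchy X"
  have "\<exists>N. \<forall>m\<ge>N. \<forall>k\<ge>N. norm (X m - X k) < (1/2) ^ n" for n :: nat
    using C by (intro CauchyD) auto
  then obtain N where N: "\<And>n m k. m \<ge> N n \<Longrightarrow> k \<ge> N n \<Longrightarrow> norm (X m - X k) < (1/2) ^ n" by metis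
  \<comment> \<open>Running maxima make the indices monotone, so that from index \<open>n\<close> on
    the subsequence stays within the range where \<open>N n\<close> controls all distances.\<close>
  define r where "r n = Max (N ` {..n})" for n
  have rN: "r n \<ge> N n" for n by (auto simp: r_def)
  have rmono: "n \<le> m \<Longrightarrow> r n \<le> r m" for n m by (auto simp: r_def intro!: Max_mono)
  have "\<exists>L. (\<lambda>n. X (r n)) \<longlonglongrightarrow> L"
    by (rule cube_L2_rapid_Cauchy_convergent) (meson N rN rmono less_imp_le order_trans)
  then obtain L where L: "(\<lambda>n. X (r n)) \<longlonglongrightarrow> L" ..
  have "X \<longlonglongrightarrow> L"
  proof (rule LIMSEQ_I)
    fix e :: real assume e: "e > 0"
    obtain n1 where n1: "\<And>n. n \<ge> n1 \<Longrightarrow> norm (X (r n) - L) < e / 2"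
      using LIMSEQ_D[OF L, of "e/2"] e by auto
    obtain n2 where n2: "(1/2::real) ^ n2 < e / 2"
      using real_arch_pow_inv[of "e/2" "1/2"] e by auto
    define n where "n = max n1 n2"
    have pw: "(1/2::real) ^ n < e / 2"
      using n2 power_decreasing[of n2 n "1/2::real"] unfolding n_def by linarith
    show "\<exists>no. \<forall>m\<ge>no. norm (X m - L) < e"
    proof (intro exI[of _ "N n"] allI impI)
      fix m assume "m \<ge> N n"
      then have "norm (X m - X (r n)) < e / 2" using N[of n m "r n"] rN[of n] pw by auto
      moreover have "norm (X (r n) - L) < e / 2" by (rule n1) (simp add: n_def)
      ultimately show "norm (X m - L) < e" using norm_triangle_lt[of "X m - X (r n)" "X (r n) - L" e] by simp
    qed
  qed
  then show "convergent X" by (auto simp: convergent_def)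
qed

text \<open>Only rational multiples are asked for, so that countable rational spans are covered too.
  Rational approximation of \<open>t\<close> makes the closure affine; a normal vector from
  \<open>orthogonal_to_affine\<close> is constant on it, and equals 0 there because of
  \<open>D0\<close>.\<close>

lemma closure_UNIV_of_orthogonal:
  fixes D :: "'a::{real_inner, complete_space} set"
  assumes D0: "0 \<in> D" and add: "\<And>x y. x \<in> D \<Longrightarrow> y \<in> D \<Longrightarrow> x + y \<in> D"
    and scale: "\<And>x q. x \<in> D \<Longrightarrow> of_rat q *\<^sub>R x \<in> D"
    and orth: "\<And>e. (\<And>x. x \<in> D \<Longrightarrow> e \<bullet> x = 0) \<Longrightarrow> e = 0"
  shows "closure D = UNIV"
proof (rule ccontr)
  assume "closure D \<noteq> UNIV"
  then obtain x0 where x0: "x0 \<notin> closure D" by blast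
  have sub: "D \<subseteq> closure D" by (rule closure_subset)
  have aff: "(1 - t) *\<^sub>R x + t *\<^sub>R y \<in> closure D" if xy: "x \<in> closure D" "y \<in> closure D" for x y t
  proof -
    from xy obtain X Y where X: "\<And>n. X n \<in> D" "X \<longlonglongrightarrow> x" and Y: "\<And>n. Y n \<in> D" "Y \<longlonglongrightarrow> y"
      unfolding closure_sequential by blast
    have "\<exists>q::rat. t < of_rat q \<and> of_rat q < t + 1 / Suc n" for n :: nat
      by (rule of_rat_dense) simp
    then obtain q :: "nat \<Rightarrow> rat" where q: "\<And>n. t < of_rat (q n)" "\<And>n. of_rat (q n) < t + 1 / Suc n" by metis
    have "(\<lambda>n. 1 / real (Suc n)) \<longlonglongrightarrow> 0"
      using LIMSEQ_inverse_real_of_nat by (simp add: inverse_eq_divide)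
    then have t_lim: "(\<lambda>n. t + 1 / real (Suc n)) \<longlonglongrightarrow> t"
      using tendsto_add[OF tendsto_const[of t]] by fastforce
    have q_lim: "(\<lambda>n. of_rat (q n) :: real) \<longlonglongrightarrow> t"
      by (intro real_tendsto_sandwich[OF always_eventually always_eventually tendsto_const[of t] t_lim] allI)
        (rule less_imp_le[OF q(1)], rule less_imp_le[OF q(2)])
    have "(\<lambda>n. (1 - of_rat (q n)) *\<^sub>R X n + of_rat (q n) *\<^sub>R Y n) \<longlonglongrightarrow> (1 - t) *\<^sub>R x + t *\<^sub>R y"
      by (intro tendsto_intros q_lim X Y)
    moreover have "(1 - of_rat (q n)) *\<^sub>R X n + of_rat (q n) *\<^sub>R Y n \<in> D" for n
      using add[OF scale[OF X(1), of "1 - q n"] scale[OF Y(1), of "q n"]] by (simp add: of_rat_diff)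
    ultimately show ?thesis unfolding closure_sequential
      by (intro exI[of _ "\<lambda>n. (1 - of_rat (q n)) *\<^sub>R X n + of_rat (q n) *\<^sub>R Y n"]) simp
  qed
  obtain e p where e: "e \<noteq> 0" "\<And>x. x \<in> closure D \<Longrightarrow> e \<bullet> x = e \<bullet> p"
    by (rule orthogonal_to_affine[OF closed_closure _ x0]) (use aff D0 sub in blast)+
  have "e \<bullet> x = 0" if "x \<in> D" for x
    using e(2)[of x] e(2)[of 0] that D0 subsetD[OF sub] by auto
  with orth e(1) show False by blast
qed

text \<open>The dense set consists of the finite rational combinations, coded by lists: lists of
  pairs are countable, and addition is concatenation.\<close>

lemma countable_dense_of_total:
  fixes G :: "nat \<Rightarrow> 'a::{real_inner, complete_space}"
  assumes "\<And>e. (\<And>i. e \<bullet> G i = 0) \<Longrightarrow> e = 0"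
  shows "\<exists>D::'a set. countable D \<and> closure D = UNIV"
proof -
  define f where "f qs = (\<Sum>(q, i)\<leftarrow>qs. of_rat q *\<^sub>R G i)" for qs :: "(rat \<times> nat) list"
  have "closure (range f) = UNIV"
  proof (rule closure_UNIV_of_orthogonal)
    show "0 \<in> range f" by (rule range_eqI[of _ _ "[]"]) (simp add: f_def)
    show "x + y \<in> range f" if xy: "x \<in> range f" "y \<in> range f" for x y
    proof -
      from xy obtain p q where "x = f p" "y = f q" by blast
      then have "x + y = f (p @ q)" by (simp add: f_def)
      then show ?thesis by blast
    qed
    show "of_rat r *\<^sub>R x \<in> range f" if x: "x \<in> range f" for x r
    proof -
      from x obtain p where "x = f p" by blast
      moreover have "of_rat r *\<^sub>R f p = f (map (\<lambda>(q, i). (r * q, i)) p)" for p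
        by (induction p) (auto simp: f_def scaleR_add_right of_rat_mult)
      ultimately show ?thesis by blast
    qed
    show "e = 0" if "\<And>x. x \<in> range f \<Longrightarrow> e \<bullet> x = 0" for e
    proof (rule assms)
      fix i
      have "G i = f [(1, i)]" by (simp add: f_def)
      then show "e \<bullet> G i = 0" using that by blast
    qed
  qed
  then show ?thesis by (intro exI[of _ "range f"]) auto
qed

lemma second_countable_of_dense:
  fixes D :: "'a::metric_space set"
  assumes D: "countable D" "closure D = UNIV"
  shows "\<exists>B::'a set set. countable B \<and> open = generate_topology B"
proof -
  define B where "B = (\<lambda>(d, q). ball d q) ` (D \<times> \<rat>)"
  have "topological_basis B"
  proof (rule topological_basisI)
    fix U :: "'a set" and x assume "open U" "x \<in> U"
    then obtain e where e: "e > 0" "ball x e \<subseteq> U" by (meson openE)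
    obtain q where q: "q \<in> \<rat>" "0 < q" "q < e / 2"
      using Rats_dense_in_real[of 0 "e/2"] e by auto
    obtain d where d: "d \<in> D" "dist d x < q"
      using D(2) q(2) by (metis UNIV_I closure_approachable)
    have "ball d q \<subseteq> ball x e"
    proof
      fix y assume "y \<in> ball d q"
      then show "y \<in> ball x e"
        using dist_triangle[of x y d] d q by (simp add: dist_commute)
    qed
    with d q e show "\<exists>B'\<in>B. x \<in> B' \<and> B' \<subseteq> U"
      unfolding B_def by (intro bexI[of _ "ball d q"]) auto
  qed (auto simp: B_def)
  then have "open = generate_topology B" by (rule topological_basis_imp_subbasis)
  moreover have "countable B" unfolding B_def by (intro countable_image countable_SIGMA D countable_rat)
  ultimately show ?thesis by blast
qed

section \<open>Trigonometric waves, separability of \<open>L^2\<close> and density of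
  \<open>C^1\<close> in it\<close>

definition cube_C1_of :: "(real^'n \<Rightarrow> real^'n) \<Rightarrow> 'n::finite cube_C1" where
  "cube_C1_of f = Abs_cube_C1 (\<lambda>x. if x \<in> cbox 0 1 then f x else 0)"

lemma cbox_neighbourhood_eq:
  assumes "x \<in> box 0 (1::real^'n)"
  shows "\<forall>\<^sub>F y in nhds x. (if y \<in> cbox 0 1 then f y else 0) = f y"
proof -
  have "\<forall>\<^sub>F y in nhds x. y \<in> box 0 1" using assms by (intro eventually_nhds_in_open) auto
  then show ?thesis
    by eventually_elim (use box_subset_cbox[of 0 "1::real^'n"] in auto)
qed

lemma cube_C1_of_rep:
  fixes f :: "real^'n::finite \<Rightarrow> real^'n"
  assumes f: "\<And>x. (f has_derivative blinfun_apply (f' x)) (at x)" and f': "continuous_on UNIV f'"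
  shows "Rep_cube_C1 (cube_C1_of f) = (\<lambda>x. if x \<in> cbox 0 1 then f x else 0)"
  unfolding cube_C1_of_def
proof (rule Abs_cube_C1_inverse, safe)
  let ?F = "\<lambda>x. if x \<in> cbox 0 1 then f x else 0"
  have "continuous_on (cbox 0 1) f"
    using f has_derivative_continuous continuous_at_imp_continuous_on by metis
  then have "continuous_on (cbox 0 1) ?F"
    by (rule continuous_on_eq) auto
  moreover have "(?F has_derivative blinfun_apply (f' x)) (at x)" if "x \<in> box 0 1" for x
    using f[of x]
    by (rule has_derivative_transform_eventually)
      (use that cbox_neighbourhood_eq[OF that, of f] box_subset_cbox[of 0 "1::real^'n"]
       in \<open>auto simp: eventually_nhds_conv_at elim!: eventually_mono\<close>)
  ultimately show "C1_on_cube ?F"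
    unfolding C1_on_cube_def using f' continuous_on_subset by blast
qed auto

lemma C1_to_L2_eq: "C1_to_L2 X = abs_cube_L2 (Rep_cube_C1 X)"
  by (simp add: C1_to_L2_def)

lemma square_integrable_C1: "square_integrable (Rep_cube_C1 X)"
  using C1_to_L2.rsp[unfolded rel_fun_def] Rep_cube_C1[of X]
  by (auto simp: L2_rel_def eq_onp_def)

text \<open>The phases \<open>c = 0\<close> and \<open>c = pi/2\<close> give cosine and sine in one
  family. The waves are continuously differentiable, so they serve both for separability of
  \<open>L^2\<close> and for the density of \<open>C^1\<close> in it.\<close>

definition wave :: "real^'n \<Rightarrow> real \<Rightarrow> 'n \<Rightarrow> real^'n \<Rightarrow> real^'n" where
  "wave t c i x = cos (t \<bullet> x - c) *\<^sub>R axis i 1"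

lemma wave_rep:
  "Rep_cube_C1 (cube_C1_of (wave t c i)) = (\<lambda>x. if x \<in> cbox 0 1 then wave t c i x else 0)"
proof (rule cube_C1_of_rep)
  fix x :: "real^'a"
  let ?f' = "\<lambda>x. (- sin (t \<bullet> x - c)) *\<^sub>R blinfun_scaleR_left (axis i 1) o\<^sub>L blinfun_inner_right t"
  show "(wave t c i has_derivative blinfun_apply (?f' x)) (at x)"
    unfolding wave_def[abs_def]
    by (auto intro!: derivative_eq_intros simp: blinfun.bilinear_simps blinfun_inner_right.rep_eq)
  show "continuous_on UNIV ?f'"
    by (intro continuous_intros)
qed

text \<open>Each component of a representative is the density of a signed measure whose Fourier
  transform vanishes, first on \<open>T\<close> and then everywhere by dominated convergence. By
  \<open>measure_eqI_trig\<close> its positive and negative parts coincide, hence both are 0. A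
  countable dense \<open>T\<close> leaves a countable total family.\<close>

lemma orthogonal_waves_imp_0:
  fixes Y :: "'n::finite cube_L2"
  assumes T: "closure T = UNIV"
    and orth: "\<And>t c i. t \<in> T \<Longrightarrow> c \<in> {0, pi/2} \<Longrightarrow> Y \<bullet> C1_to_L2 (cube_C1_of (wave t c i)) = 0"
  shows "Y = 0"
proof -
  let ?\<mu> = "cube_measure :: (real^'n) measure"
  interpret prob_space ?\<mu> by (rule prob_space_cube_measure)
  obtain y where y: "square_integrable y" "Y = abs_cube_L2 y" by (rule cube_L2_cases)
  have ym [measurable]: "y \<in> borel_measurable ?\<mu>" using y by (simp add: square_integrable_def)
  have id [measurable]: "(\<lambda>x. x) \<in> ?\<mu> \<rightarrow>\<^sub>M borel"
    by (simp add: cube_measure_def measurable_restrict_space1)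
  have yi: "integrable ?\<mu> (\<lambda>x. y x $ i)" for i
  proof -
    have "square_integrable (\<lambda>_. axis i 1 :: real^'n)" by (simp add: square_integrable_def)
    from square_integrable_inner[OF y(1) this] show ?thesis
      by (simp add: inner_axis)
  qed
  have [measurable]: "(\<lambda>x. y x $ i) \<in> borel_measurable ?\<mu>" for i
    by (rule borel_measurable_integrable[OF yi])
  have bi: "integrable ?\<mu> (\<lambda>x. w x * y x $ i)" if "w \<in> borel_measurable ?\<mu>" "\<And>x. \<bar>w x\<bar> \<le> 1" for w i
    using that by (intro Bochner_Integration.integrable_bound[OF yi[of i]]) (auto simp: abs_mult intro!: mult_left_le_one_le)
  have wave: "(\<integral>x. cos (t \<bullet> x - c) * y x $ i \<partial>?\<mu>) = Y \<bullet> C1_to_L2 (cube_C1_of (wave t c i))" for t c i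
  proof -
    have "Y \<bullet> C1_to_L2 (cube_C1_of (wave t c i)) = (\<integral>x. y x \<bullet> Rep_cube_C1 (cube_C1_of (wave t c i)) x \<partial>?\<mu>)"
      unfolding C1_to_L2_eq y(2) by (intro inner_cube_L2.abs_eq L2_rel_refl y square_integrable_C1)
    also have "\<dots> = (\<integral>x. cos (t \<bullet> x - c) * y x $ i \<partial>?\<mu>)"
      using box_subset_cbox[of 0 "1::real^'n"]
      by (intro Bochner_Integration.integral_cong refl) (auto simp: wave_rep wave_def inner_axis space_cube_measure)
    finally show ?thesis ..
  qed
  have zero: "(\<integral>x. cos (t \<bullet> x - c) * y x $ i \<partial>?\<mu>) = 0" if c: "c \<in> {0, pi/2}" for t c i
  proof -
    have "t \<in> closure T" using T by simp
    then obtain s where s: "\<And>n. s n \<in> T" "s \<longlonglongrightarrow> t" unfolding closure_sequential by blast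
    have "(\<lambda>n. \<integral>x. cos (s n \<bullet> x - c) * y x $ i \<partial>?\<mu>) \<longlonglongrightarrow> (\<integral>x. cos (t \<bullet> x - c) * y x $ i \<partial>?\<mu>)"
    proof (rule integral_dominated_convergence[where w="\<lambda>x. \<bar>y x $ i\<bar>"])
      show "AE x in ?\<mu>. (\<lambda>n. cos (s n \<bullet> x - c) * y x $ i) \<longlonglongrightarrow> cos (t \<bullet> x - c) * y x $ i"
        by (intro AE_I2 tendsto_intros s)
      show "AE x in ?\<mu>. norm (cos (s n \<bullet> x - c) * y x $ i) \<le> \<bar>y x $ i\<bar>" for n
        by (intro AE_I2) (auto simp: abs_mult intro!: mult_left_le_one_le)
      show "integrable ?\<mu> (\<lambda>x. \<bar>y x $ i\<bar>)" using yi by simp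
    qed measurable
    then show ?thesis using orth[OF s(1) c] by (simp add: wave LIMSEQ_const_iff)
  qed
  have cos0: "(\<integral>x. cos (t \<bullet> x) * y x $ i \<partial>?\<mu>) = 0" for t i using zero[of 0 t i] by simp
  have sin0: "(\<integral>x. sin (t \<bullet> x) * y x $ i \<partial>?\<mu>) = 0" for t i
    using zero[of "pi/2" t i] by (simp add: cos_diff)
  have "AE x in ?\<mu>. y x $ i = 0" for i
  proof -
    \<comment> \<open>\<open>ennreal\<close> sends negative numbers to 0, so \<open>P 1\<close> and
      \<open>P (-1)\<close> are the positive and the negative part of the signed measure with
      density \<open>y x $ i\<close>.\<close>
    define P where "P s = distr (density ?\<mu> (\<lambda>x. ennreal (s * y x $ i))) borel (\<lambda>x. x)" for s :: real
    have emP: "emeasure (P s) A = (\<integral>\<^sup>+x. ennreal (s * y x $ i) * indicator A x \<partial>?\<mu>)" if [measurable]: "A \<in> sets borel" for s A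
    proof -
      have [measurable]: "A \<inter> box 0 1 \<in> sets ?\<mu>" by (simp add: cube_measure_def sets_restrict_space_iff)
      have "emeasure (P s) A = emeasure (density ?\<mu> (\<lambda>x. ennreal (s * y x $ i))) (A \<inter> box 0 1)"
        unfolding P_def by (subst emeasure_distr) (auto simp: space_cube_measure)
      also have "\<dots> = (\<integral>\<^sup>+x. ennreal (s * y x $ i) * indicator (A \<inter> box 0 1) x \<partial>?\<mu>)"
        by (subst emeasure_density) auto
      also have "\<dots> = (\<integral>\<^sup>+x. ennreal (s * y x $ i) * indicator A x \<partial>?\<mu>)"
        by (intro nn_integral_cong) (auto simp: space_cube_measure indicator_def)
      finally show ?thesis .
    qed
    have fin: "finite_measure (P s)" for s
    proof (rule finite_measureI)
      have "emeasure (P s) (space (P s)) = (\<integral>\<^sup>+x. ennreal (s * y x $ i) \<partial>?\<mu>)"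
        using emP[of UNIV s] by (simp add: P_def)
      also have "\<dots> \<le> (\<integral>\<^sup>+x. ennreal (norm (s * y x $ i)) \<partial>?\<mu>)" by (intro nn_integral_mono ennreal_leI) auto
      also have "\<dots> < \<infinity>"
        using integrable_mult_right[of s, OF yi[of i]] unfolding integrable_iff_bounded by blast
      finally show "emeasure (P s) (space (P s)) \<noteq> \<infinity>" by simp
    qed
    have int: "(\<integral>x. F (e \<bullet> x) \<partial>P s) = (\<integral>x. F (e \<bullet> x) * max 0 (s * y x $ i) \<partial>?\<mu>)"
      if [measurable]: "F \<in> borel_measurable borel" for F :: "real \<Rightarrow> real" and e s
    proof -
      have d: "density ?\<mu> (\<lambda>x. ennreal (s * y x $ i)) = density ?\<mu> (\<lambda>x. ennreal (max 0 (s * y x $ i)))"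
        by (intro density_cong) (auto simp: max_def ennreal_neg)
      show ?thesis unfolding P_def
        by (subst integral_distr, measurable) (simp add: d integral_density mult.commute del: ennreal_max_0)
    qed
    have diff: "(\<integral>x. F (e \<bullet> x) \<partial>P 1) - (\<integral>x. F (e \<bullet> x) \<partial>P (-1)) = (\<integral>x. F (e \<bullet> x) * y x $ i \<partial>?\<mu>)"
      if F: "F \<in> {cos, sin}" for F :: "real \<Rightarrow> real" and e
    proof -
      have [measurable]: "F \<in> borel_measurable borel" using F by auto
      have b: "\<bar>F z\<bar> \<le> 1" for z using F by auto
      have i: "integrable ?\<mu> (\<lambda>x. F (e \<bullet> x) * max 0 (s * y x $ i))" if "\<bar>s\<bar> \<le> 1" for s
      proof (rule Bochner_Integration.integrable_bound[OF yi[of i]])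
        have "\<bar>F (e \<bullet> x)\<bar> * max 0 (s * y x $ i) \<le> 1 * \<bar>y x $ i\<bar>" for x
        proof (rule mult_mono)
          have "\<bar>s * y x $ i\<bar> \<le> 1 * \<bar>y x $ i\<bar>" unfolding abs_mult by (intro mult_right_mono that) auto
          then show "max 0 (s * y x $ i) \<le> \<bar>y x $ i\<bar>" by (auto simp: max_def)
        qed (auto simp: b)
        then show "AE x in ?\<mu>. norm (F (e \<bullet> x) * max 0 (s * y x $ i)) \<le> norm (y x $ i)"
          by (auto simp: abs_mult)
      qed measurable
      show ?thesis
        unfolding int[OF \<open>F \<in> borel_measurable borel\<close>]
        by (subst Bochner_Integration.integral_diff[symmetric, OF i i])
          (auto simp: right_diff_distrib[symmetric] max_def intro!: Bochner_Integration.integral_cong)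
    qed
    have "P 1 = P (-1)"
    proof (rule measure_eqI_trig)
      show "same_trig (P 1) (P (-1))"
        unfolding same_trig_def using diff[of cos] diff[of sin] cos0 sin0 by auto
    qed (auto simp: fin, auto simp: P_def)
    \<comment> \<open>\<open>P s\<close> and \<open>P (-s)\<close> agree but live on disjoint sets;
      evaluating both on \<open>?A\<close>, where \<open>s * y x $ i\<close> is positive, leaves
      0.\<close>
    have pos: "AE x in ?\<mu>. s * y x $ i \<le> 0" if s: "s = 1 \<or> s = -1" for s
    proof -
      let ?A = "{x \<in> box 0 1. s * y x $ i > 0}"
      have "{x \<in> space ?\<mu>. s * y x $ i > 0} \<in> sets ?\<mu>" by measurable
      then have A: "?A \<in> sets borel"
        by (auto simp: space_cube_measure cube_measure_def sets_restrict_space_iff)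
      have "(\<integral>\<^sup>+x. ennreal (s * y x $ i) \<partial>?\<mu>) = (\<integral>\<^sup>+x. ennreal (s * y x $ i) * indicator ?A x \<partial>?\<mu>)"
        by (intro nn_integral_cong) (auto simp: indicator_def space_cube_measure ennreal_neg)
      also have "\<dots> = emeasure (P s) ?A" using emP[OF A] by simp
      also have "P s = P (- s)" using s \<open>P 1 = P (-1)\<close> by auto
      also have "emeasure (P (-s)) ?A = (\<integral>\<^sup>+x. ennreal (- s * y x $ i) * indicator ?A x \<partial>?\<mu>)" by (rule emP[OF A])
      also have "\<dots> = (\<integral>\<^sup>+x. 0 \<partial>?\<mu>)"
        by (intro nn_integral_cong) (auto simp: indicator_def ennreal_neg)
      finally have "(\<integral>\<^sup>+x. ennreal (s * y x $ i) \<partial>?\<mu>) = 0" by simp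
      then have "AE x in ?\<mu>. ennreal (s * y x $ i) = 0" by (subst (asm) nn_integral_0_iff_AE) auto
      then show ?thesis by eventually_elim (auto simp: ennreal_eq_0_iff)
    qed
    show ?thesis using pos[of 1, simplified] pos[of "-1", simplified] by eventually_elim auto
  qed
  then have "AE x in ?\<mu>. \<forall>i. y x $ i = 0" by (simp add: AE_all_countable)
  then have "AE x in ?\<mu>. y x = 0" by eventually_elim (simp add: vec_eq_iff)
  then have "L2_rel y (\<lambda>_. 0)" using y by (simp add: L2_rel_def square_integrable_0)
  then show ?thesis unfolding y(2) zero_cube_L2_def
    using Quotient3_rel[OF Quotient3_cube_L2, of y "\<lambda>_. 0"] y(1) square_integrable_0 by (auto simp: L2_rel_def)
qed

instance cube_L2 :: (finite) second_countable_topology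
proof
  obtain T :: "(real^'a) set" where T: "countable T" "\<And>U. open U \<Longrightarrow> U \<noteq> {} \<Longrightarrow> \<exists>d\<in>T. d \<in> U"
    by (rule countable_dense_setE) blast
  have cT: "closure T = UNIV"
    using T(2)[of "- closure T"] closure_subset[of T] by auto
  let ?I = "T \<times> {0, pi/2} \<times> (UNIV :: 'a set)"
  have I: "countable ?I" "?I \<noteq> {}" using T(1) T(2)[of UNIV] by (auto intro!: countable_SIGMA)
  define G where "G n = (case from_nat_into ?I n of (t, c, i) \<Rightarrow> C1_to_L2 (cube_C1_of (wave t c i)))" for n
  have "\<exists>D::'a cube_L2 set. countable D \<and> closure D = UNIV"
  proof (rule countable_dense_of_total[of G])
    fix Y :: "'a cube_L2" assume Y: "\<And>n. Y \<bullet> G n = 0"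
    show "Y = 0"
    proof (rule orthogonal_waves_imp_0[OF cT])
      fix t c and i :: 'a assume "t \<in> T" "c \<in> {0, pi/2}"
      then have "(t, c, i) \<in> ?I" by auto
      then obtain n where "from_nat_into ?I n = (t, c, i)" using from_nat_into_surj[OF I(1)] by blast
      then show "Y \<bullet> C1_to_L2 (cube_C1_of (wave t c i)) = 0" using Y[of n] by (simp add: G_def)
    qed
  qed
  then show "\<exists>B::'a cube_L2 set set. countable B \<and> open = generate_topology B"
    using second_countable_of_dense by blast
qed

lemma C1_to_L2_add: "C1_to_L2 (X + Y) = C1_to_L2 X + C1_to_L2 Y"
  unfolding C1_to_L2_eq plus_cube_C1.rep_eq
  by (rule plus_cube_L2.abs_eq[symmetric]) (intro L2_rel_refl square_integrable_C1)+

lemma C1_to_L2_scaleR: "C1_to_L2 (c *\<^sub>R X) = c *\<^sub>R C1_to_L2 X"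
  unfolding C1_to_L2_eq scaleR_cube_C1.rep_eq
  by (rule scaleR_cube_L2.abs_eq[of "Rep_cube_C1 X" c, symmetric]) (intro L2_rel_refl square_integrable_C1)

text \<open>Density ensures that a nonzero functional on \<open>L^2\<close> stays nonzero on
  \<open>C^1\<close>, so the image of the Gaussian measure in \<open>L^2\<close> is
  nondegenerate.\<close>

lemma closure_range_C1_to_L2: "closure (range C1_to_L2) = (UNIV :: 'n::finite cube_L2 set)"
proof (rule closure_UNIV_of_orthogonal)
  have "C1_to_L2 (0 *\<^sub>R 0) = 0" unfolding C1_to_L2_scaleR by simp
  then show "0 \<in> range C1_to_L2" by (metis rangeI)
  show "x + y \<in> range C1_to_L2" if "x \<in> range C1_to_L2" "y \<in> range C1_to_L2" for x y
    using that by (auto simp flip: C1_to_L2_add)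
  show "of_rat q *\<^sub>R x \<in> range C1_to_L2" if "x \<in> range C1_to_L2" for q x
    using that by (auto simp flip: C1_to_L2_scaleR)
  show "e = 0" if "\<And>x. x \<in> range C1_to_L2 \<Longrightarrow> e \<bullet> x = 0" for e :: "'n cube_L2"
    by (rule orthogonal_waves_imp_0[of UNIV]) (auto intro: that)
qed

section \<open>The Wasserstein space\<close>

lemma P2_props:
  shows sets_P2 [measurable_cong]: "sets (measure_of_P2 \<mu>) = sets borel"
    and prob_space_P2: "prob_space (measure_of_P2 \<mu>)"
    and integrable_P2: "integrable (measure_of_P2 \<mu>) (\<lambda>x. (norm x)\<^sup>2)"
  using measure_of_P2[of \<mu>] by auto

section \<open>Couplings and the Wasserstein cost\<close>

lemma measurable_couplings:
  fixes \<gamma> :: "('a::euclidean_space \<times> 'a) measure"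
  assumes "sets \<gamma> = sets borel"
  shows "fst \<in> \<gamma> \<rightarrow>\<^sub>M borel" "snd \<in> \<gamma> \<rightarrow>\<^sub>M borel"
  unfolding measurable_cong_sets[OF assms refl]
  by (intro borel_measurable_continuous_onI continuous_intros)+

text \<open>Finiteness matters because \<open>enn2real\<close> in \<open>W2\<close> would turn an
  infinite infimum into 0; it is what allows a bound on \<open>W2\<close> to be read back as a bound
  on the infimum.\<close>

lemma couplings_finite_cost:
  assumes \<gamma>: "\<gamma> \<in> couplings (measure_of_P2 \<mu>) (measure_of_P2 \<nu>)"
  shows "(\<integral>\<^sup>+ z. ennreal ((dist (fst z) (snd z))\<^sup>2) \<partial>\<gamma>) < \<infinity>"
proof -
  have [measurable_cong]: "sets \<gamma> = sets (borel :: ('a \<times> 'a) measure)"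
    and m: "distr \<gamma> borel fst = measure_of_P2 \<mu>" "distr \<gamma> borel snd = measure_of_P2 \<nu>"
    using \<gamma> by (auto simp: couplings_def)
  note [measurable] = measurable_couplings[OF this(1)]
  have fin: "(\<integral>\<^sup>+ x. ennreal ((norm x)\<^sup>2) \<partial>measure_of_P2 \<mu>) < \<infinity>" for \<mu> :: "'a P2"
    using integrable_P2[of \<mu>] unfolding integrable_iff_bounded by simp
  have sq: "(dist x y)\<^sup>2 \<le> 2 * (norm x)\<^sup>2 + 2 * (norm y)\<^sup>2" for x y :: 'a
  proof -
    have "dist x y \<le> norm x + norm y" unfolding dist_norm by (rule norm_triangle_ineq4)
    then have "(dist x y)\<^sup>2 \<le> (norm x + norm y)\<^sup>2" by (intro power_mono) auto
    also have "\<dots> \<le> 2 * (norm x)\<^sup>2 + 2 * (norm y)\<^sup>2"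
      using sum_squares_bound[of "norm x" "norm y"] by (simp add: power2_sum)
    finally show ?thesis .
  qed
  have "(\<integral>\<^sup>+ z. ennreal ((dist (fst z) (snd z))\<^sup>2) \<partial>\<gamma>) \<le>
      (\<integral>\<^sup>+ z. 2 * ennreal ((norm (fst z))\<^sup>2) + 2 * ennreal ((norm (snd z))\<^sup>2) \<partial>\<gamma>)"
  proof (rule nn_integral_mono)
    fix z :: "'a \<times> 'a"
    have "ennreal ((dist (fst z) (snd z))\<^sup>2) \<le> ennreal (2 * (norm (fst z))\<^sup>2 + 2 * (norm (snd z))\<^sup>2)"
      by (intro ennreal_leI sq)
    then show "ennreal ((dist (fst z) (snd z))\<^sup>2) \<le> 2 * ennreal ((norm (fst z))\<^sup>2) + 2 * ennreal ((norm (snd z))\<^sup>2)"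
      by (simp add: ennreal_plus ennreal_mult')
  qed
  also have "\<dots> = 2 * (\<integral>\<^sup>+ z. ennreal ((norm (fst z))\<^sup>2) \<partial>\<gamma>) + 2 * (\<integral>\<^sup>+ z. ennreal ((norm (snd z))\<^sup>2) \<partial>\<gamma>)"
    by (subst nn_integral_add) (auto simp: nn_integral_cmult)
  also have "(\<integral>\<^sup>+ z. ennreal ((norm (fst z))\<^sup>2) \<partial>\<gamma>) = (\<integral>\<^sup>+ x. ennreal ((norm x)\<^sup>2) \<partial>measure_of_P2 \<mu>)"
    unfolding m(1)[symmetric] by (subst nn_integral_distr) auto
  also have "(\<integral>\<^sup>+ z. ennreal ((norm (snd z))\<^sup>2) \<partial>\<gamma>) = (\<integral>\<^sup>+ x. ennreal ((norm x)\<^sup>2) \<partial>measure_of_P2 \<nu>)"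
    unfolding m(2)[symmetric] by (subst nn_integral_distr) auto
  finally show ?thesis using fin[of \<mu>] fin[of \<nu>] by (auto simp: ennreal_mult_less_top elim!: le_less_trans)
qed

lemma couplings_nonempty: "couplings (measure_of_P2 \<mu>) (measure_of_P2 \<nu>) \<noteq> {}"
proof -
  interpret M: prob_space "measure_of_P2 \<mu>" by (rule prob_space_P2)
  interpret N: prob_space "measure_of_P2 \<nu>" by (rule prob_space_P2)
  interpret P: pair_prob_space "measure_of_P2 \<mu>" "measure_of_P2 \<nu>" ..
  let ?P = "measure_of_P2 \<mu> \<Otimes>\<^sub>M measure_of_P2 \<nu>"
  have sp: "space (measure_of_P2 \<mu>) = UNIV" for \<mu> :: "'a P2"
    using sets_P2 by (metis sets_eq_imp_space_eq space_borel)
  have "sets ?P = sets (borel \<Otimes>\<^sub>M borel)" by (intro sets_pair_measure_cong sets_P2)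
  also have "\<dots> = sets borel" unfolding borel_prod ..
  finally have s: "sets ?P = sets borel" .
  have "distr ?P borel fst = measure_of_P2 \<mu>"
  proof (rule measure_eqI)
    fix A assume "A \<in> sets (distr ?P borel fst)"
    then have A [measurable]: "A \<in> sets borel" by simp
    have "emeasure (distr ?P borel fst) A = emeasure ?P (A \<times> UNIV)"
      by (subst emeasure_distr) (auto simp: space_pair_measure sp intro!: arg_cong2[where f=emeasure])
    also have "\<dots> = emeasure (measure_of_P2 \<mu>) A"
      using N.emeasure_space_1 by (subst N.emeasure_pair_measure_Times) (auto simp: sets_P2 sp)
    finally show "emeasure (distr ?P borel fst) A = emeasure (measure_of_P2 \<mu>) A" .
  qed (simp add: sets_P2)
  moreover have "distr ?P borel snd = measure_of_P2 \<nu>"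
  proof (rule measure_eqI)
    fix A assume "A \<in> sets (distr ?P borel snd)"
    then have A [measurable]: "A \<in> sets borel" by simp
    have "emeasure (distr ?P borel snd) A = emeasure ?P (UNIV \<times> A)"
      by (subst emeasure_distr) (auto simp: space_pair_measure sp intro!: arg_cong2[where f=emeasure])
    also have "\<dots> = emeasure (measure_of_P2 \<nu>) A"
      using M.emeasure_space_1 by (subst N.emeasure_pair_measure_Times) (auto simp: sets_P2 sp)
    finally show "emeasure (distr ?P borel snd) A = emeasure (measure_of_P2 \<nu>) A" .
  qed (simp add: sets_P2)
  ultimately have "?P \<in> couplings (measure_of_P2 \<mu>) (measure_of_P2 \<nu>)"
    using s by (simp add: couplings_def)
  then show ?thesis by blast
qed

lemma W2_less_coupling:
  assumes "W2 \<mu> \<nu> < r"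
  obtains \<gamma> where "\<gamma> \<in> couplings (measure_of_P2 \<mu>) (measure_of_P2 \<nu>)"
    "(\<integral>\<^sup>+ z. ennreal ((dist (fst z) (snd z))\<^sup>2) \<partial>\<gamma>) < ennreal (r\<^sup>2)"
proof -
  define I where "I = (INF \<gamma>\<in>couplings (measure_of_P2 \<mu>) (measure_of_P2 \<nu>).
      \<integral>\<^sup>+ z. ennreal ((dist (fst z) (snd z))\<^sup>2) \<partial>\<gamma>)"
  obtain \<gamma>0 where "\<gamma>0 \<in> couplings (measure_of_P2 \<mu>) (measure_of_P2 \<nu>)"
    using couplings_nonempty by blast
  then have "I < \<infinity>"
    unfolding I_def using couplings_finite_cost[of \<gamma>0] by (intro le_less_trans[OF INF_lower[of \<gamma>0]])
  moreover have "sqrt (enn2real I) < r" using assms by (simp add: W2_def I_def)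
  then have "enn2real I < r\<^sup>2"
    by (metis enn2real_nonneg real_sqrt_ge_zero real_sqrt_pow2 power_strict_mono zero_less_numeral)
  ultimately have "I < ennreal (r\<^sup>2)"
    by (metis ennreal_enn2real ennreal_lessI enn2real_nonneg infinity_ennreal_def le_less_trans)
  then show ?thesis using that unfolding I_def INF_less_iff by blast
qed

lemma W2_le:
  assumes "\<gamma> \<in> couplings (measure_of_P2 \<mu>) (measure_of_P2 \<nu>)"
    and "(\<integral>\<^sup>+ z. ennreal ((dist (fst z) (snd z))\<^sup>2) \<partial>\<gamma>) \<le> ennreal (r\<^sup>2)" "0 \<le> r"
  shows "W2 \<mu> \<nu> \<le> r"
proof -
  have "(INF \<gamma>\<in>couplings (measure_of_P2 \<mu>) (measure_of_P2 \<nu>).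
      \<integral>\<^sup>+ z. ennreal ((dist (fst z) (snd z))\<^sup>2) \<partial>\<gamma>) \<le> ennreal (r\<^sup>2)"
    by (rule INF_lower2[where i=\<gamma>]) (use assms in auto)
  then have "enn2real (INF \<gamma>\<in>couplings (measure_of_P2 \<mu>) (measure_of_P2 \<nu>).
      \<integral>\<^sup>+ z. ennreal ((dist (fst z) (snd z))\<^sup>2) \<partial>\<gamma>) \<le> r\<^sup>2"
    by (intro enn2real_leI) auto
  then have "W2 \<mu> \<nu> \<le> sqrt (r\<^sup>2)" unfolding W2_def by (rule real_sqrt_le_mono)
  then show ?thesis using assms(3) by simp
qed

text \<open>Some \<open>K n\<close>, the points at distance at least \<open>\<delta>\<close> from
  the complement of \<open>U\<close>, already carries mass above \<epsilon>, with excess \<eta>. A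
  coupling of cost below \<open>e\<^sup>2 = \<delta>\<^sup>2 * \<eta>\<close> moves less than \<eta>
  of the mass by \<delta> or more (Chebyshev), and whatever of \<open>K n\<close> moves less stays
  in \<open>U\<close>.\<close>

lemma open_P2_measure_gt:
  fixes U :: "'a::euclidean_space set"
  assumes U: "open U"
  shows "open {\<mu>. \<epsilon> < measure (measure_of_P2 \<mu>) U}"
  unfolding open_P2_def
proof
  fix \<mu> :: "'a P2" assume "\<mu> \<in> {\<mu>. \<epsilon> < measure (measure_of_P2 \<mu>) U}"
  then have gt: "\<epsilon> < measure (measure_of_P2 \<mu>) U" by simp
  interpret M: prob_space "measure_of_P2 \<mu>" by (rule prob_space_P2)
  define K where "K n = {x. \<forall>y\<in>-U. 1 / real (Suc n) \<le> dist x y}" for n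
  have K_closed: "closed (K n)" for n
  proof -
    have "K n = (\<Inter>y\<in>-U. {x. 1 / real (Suc n) \<le> dist x y})" by (auto simp: K_def)
    then show ?thesis by (auto intro!: closed_INT closed_Collect_le continuous_intros)
  qed
  have [measurable]: "K n \<in> sets borel" for n using K_closed by auto
  have "incseq K"
  proof (rule incseq_SucI, rule subsetI)
    fix n x assume "x \<in> K n"
    moreover have "1 / real (Suc (Suc n)) \<le> 1 / real (Suc n)" by (intro divide_left_mono) auto
    ultimately show "x \<in> K (Suc n)" unfolding K_def by force
  qed
  then have "(\<lambda>n. measure (measure_of_P2 \<mu>) (K n)) \<longlonglongrightarrow> measure (measure_of_P2 \<mu>) (\<Union>n. K n)"
    by (intro M.finite_Lim_measure_incseq) (auto simp: sets_P2)
  moreover have "(\<Union>n. K n) = U"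
  proof safe
    fix n x assume x: "x \<in> K n"
    show "x \<in> U"
    proof (rule ccontr)
      assume "x \<notin> U"
      then have "1 / real (Suc n) \<le> dist x x" using x unfolding K_def by blast
      then show False by simp
    qed
  next
    fix x assume "x \<in> U"
    then obtain e where e: "e > 0" "ball x e \<subseteq> U" using U openE by blast
    obtain n where n: "inverse (real (Suc n)) < e" using reals_Archimedean[OF e(1)] by blast
    have "x \<in> K n"
      unfolding K_def
    proof safe
      fix y assume "y \<notin> U"
      then have "\<not> dist x y < e" using e(2) by auto
      then show "1 / real (Suc n) \<le> dist x y" using n by (simp add: inverse_eq_divide)
    qed
    then show "x \<in> (\<Union>n. K n)" by blast
  qed
  ultimately have "\<forall>\<^sub>F n in sequentially. \<epsilon> < measure (measure_of_P2 \<mu>) (K n)"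
    using gt by (intro order_tendstoD) auto
  then obtain n where n: "\<epsilon> < measure (measure_of_P2 \<mu>) (K n)"
    by (auto simp: eventually_sequentially)
  define \<delta> where "\<delta> = 1 / real (Suc n)"
  have \<delta>: "\<delta> > 0" by (simp add: \<delta>_def)
  define \<eta> where "\<eta> = measure (measure_of_P2 \<mu>) (K n) - \<epsilon>"
  have \<eta>: "\<eta> > 0" using n by (simp add: \<eta>_def)
  define e where "e = \<delta> * sqrt \<eta>"
  have e: "e > 0" using \<delta> \<eta> by (simp add: e_def)
  have e2: "e\<^sup>2 = \<delta>\<^sup>2 * \<eta>" using \<eta> by (simp add: e_def power_mult_distrib)
  show "\<exists>e>0. \<forall>\<nu>. W2 \<nu> \<mu> < e \<longrightarrow> \<nu> \<in> {\<mu>. \<epsilon> < measure (measure_of_P2 \<mu>) U}"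
  proof (intro exI[of _ e] conjI allI impI e)
    fix \<nu> assume "W2 \<nu> \<mu> < e"
    then obtain \<gamma> where \<gamma>: "\<gamma> \<in> couplings (measure_of_P2 \<nu>) (measure_of_P2 \<mu>)"
      and cost: "(\<integral>\<^sup>+ z. ennreal ((dist (fst z) (snd z))\<^sup>2) \<partial>\<gamma>) < ennreal (e\<^sup>2)"
      by (rule W2_less_coupling)
    interpret N: prob_space "measure_of_P2 \<nu>" by (rule prob_space_P2)
    have s [measurable_cong]: "sets \<gamma> = sets (borel :: ('a \<times> 'a) measure)"
      and m: "distr \<gamma> borel fst = measure_of_P2 \<nu>" "distr \<gamma> borel snd = measure_of_P2 \<mu>"
      using \<gamma> by (auto simp: couplings_def)
    note [measurable] = measurable_couplings[OF s]
    have sp: "space \<gamma> = UNIV" using s by (metis sets_eq_imp_space_eq space_borel)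
    have Ub [measurable]: "U \<in> sets borel" using U by simp
    have [measurable]: "{z. \<delta> \<le> dist (fst z) (snd z)} \<in> sets \<gamma>" "{z. fst z \<in> U} \<in> sets \<gamma>" "{z. snd z \<in> K n} \<in> sets \<gamma>"
      using measurable_sets[OF measurable_couplings(1)[OF s] Ub]
        measurable_sets[OF measurable_couplings(2)[OF s], of "K n"]
      by (auto simp: s sp vimage_def intro!: borel_closed closed_Collect_le continuous_intros)
    have "emeasure \<gamma> {z. \<delta> \<le> dist (fst z) (snd z)} = (\<integral>\<^sup>+ z. indicator {z. \<delta> \<le> dist (fst z) (snd z)} z \<partial>\<gamma>)"
      by simp
    also have "\<dots> \<le> (\<integral>\<^sup>+ z. ennreal (1 / \<delta>\<^sup>2) * ennreal ((dist (fst z) (snd z))\<^sup>2) \<partial>\<gamma>)"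
    proof (rule nn_integral_mono)
      fix z :: "'a \<times> 'a"
      show "indicator {z. \<delta> \<le> dist (fst z) (snd z)} z \<le> ennreal (1 / \<delta>\<^sup>2) * ennreal ((dist (fst z) (snd z))\<^sup>2)"
      proof (cases "\<delta> \<le> dist (fst z) (snd z)")
        case True
        then have "\<delta>\<^sup>2 \<le> (dist (fst z) (snd z))\<^sup>2" using \<delta> by (intro power_mono) auto
        then have "1 \<le> 1 / \<delta>\<^sup>2 * (dist (fst z) (snd z))\<^sup>2" using \<delta> by (simp add: field_simps)
        then have "ennreal 1 \<le> ennreal (1 / \<delta>\<^sup>2 * (dist (fst z) (snd z))\<^sup>2)" by (rule ennreal_leI)
        also have "\<dots> = ennreal (1 / \<delta>\<^sup>2) * ennreal ((dist (fst z) (snd z))\<^sup>2)"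
          by (rule ennreal_mult') simp
        finally show ?thesis using True by simp
      qed simp
    qed
    also have "\<dots> = ennreal (1 / \<delta>\<^sup>2) * (\<integral>\<^sup>+ z. ennreal ((dist (fst z) (snd z))\<^sup>2) \<partial>\<gamma>)"
      by (rule nn_integral_cmult) measurable
    also have "\<dots> < ennreal (1 / \<delta>\<^sup>2) * ennreal (e\<^sup>2)"
      using \<delta> by (intro ennreal_mult_strict_left_mono cost) (auto simp: less_top[symmetric])
    also have "\<dots> = ennreal \<eta>" using \<delta> by (simp add: e2 ennreal_mult'[symmetric])
    finally have far: "emeasure \<gamma> {z. \<delta> \<le> dist (fst z) (snd z)} < ennreal \<eta>" .
    have "emeasure (measure_of_P2 \<mu>) (K n) = emeasure \<gamma> {z. snd z \<in> K n}"
      unfolding m(2)[symmetric] by (subst emeasure_distr) (auto simp: sp vimage_def)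
    then have "ennreal (measure (measure_of_P2 \<mu>) (K n)) = emeasure \<gamma> {z. snd z \<in> K n}"
      by (simp add: M.emeasure_eq_measure)
    also have "\<dots> \<le> emeasure \<gamma> ({z. fst z \<in> U} \<union> {z. \<delta> \<le> dist (fst z) (snd z)})"
      by (intro emeasure_mono) (auto simp: K_def \<delta>_def dist_commute)
    also have "\<dots> \<le> emeasure \<gamma> {z. fst z \<in> U} + emeasure \<gamma> {z. \<delta> \<le> dist (fst z) (snd z)}"
      by (intro emeasure_subadditive) measurable
    also have "emeasure \<gamma> {z. fst z \<in> U} = emeasure (measure_of_P2 \<nu>) U"
      unfolding m(1)[symmetric] by (subst emeasure_distr) (auto simp: sp vimage_def)
    also have "emeasure (measure_of_P2 \<nu>) U = ennreal (measure (measure_of_P2 \<nu>) U)"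
      by (rule N.emeasure_eq_measure)
    also have "ennreal (measure (measure_of_P2 \<nu>) U) + emeasure \<gamma> {z. \<delta> \<le> dist (fst z) (snd z)}
        < ennreal (measure (measure_of_P2 \<nu>) U) + ennreal \<eta>"
      by (rule ennreal_add_left_cancel_less[THEN iffD2]) (use far in simp)
    finally have "measure (measure_of_P2 \<mu>) (K n) < measure (measure_of_P2 \<nu>) U + \<eta>"
      using \<eta> by (simp add: ennreal_plus[symmetric] ennreal_less_iff del: ennreal_plus)
    then show "\<nu> \<in> {\<mu>. \<epsilon> < measure (measure_of_P2 \<mu>) U}" by (simp add: \<eta>_def)
  qed
qed

text \<open>A Borel set of measures that are absolutely continuous with respect to Lebesgue measure; it
  stands in for \<open>P2_regular\<close>, whose measurability is not clear.\<close>

definition P2_ac :: "'a::euclidean_space P2 set" where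
  "P2_ac = {\<mu>. \<forall>k::nat. \<exists>m::nat. \<forall>U. open U \<longrightarrow> emeasure lborel U < ennreal (1 / Suc m) \<longrightarrow>
     measure (measure_of_P2 \<mu>) U \<le> 1 / Suc k}"

text \<open>The quantifiers over \<open>k\<close> and \<open>m\<close> are countable. The
  uncountable one over \<open>U\<close> intersects sets that are closed by
  \<open>open_P2_measure_gt\<close>; this is why the definition tests open sets with a non-strict
  bound.\<close>

lemma P2_ac_borel: "P2_ac \<in> sets (borel :: 'a::euclidean_space P2 measure)"
proof -
  have eq: "P2_ac = (\<Inter>k::nat. \<Union>m::nat. \<Inter>U\<in>{U. open U \<and> emeasure lborel U < ennreal (1 / Suc m)}.
      - {\<mu> :: 'a P2. 1 / Suc k < measure (measure_of_P2 \<mu>) U})"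
    by (auto simp: P2_ac_def not_less imp_conjL)
  have "closed (\<Inter>U\<in>{U. open U \<and> emeasure lborel U < ennreal (1 / Suc m)}.
      - {\<mu> :: 'a P2. 1 / Suc k < measure (measure_of_P2 \<mu>) U})" for k m :: nat
    by (intro closed_INT ballI closed_Compl open_P2_measure_gt) auto
  then show ?thesis unfolding eq by (intro sets.countable_INT'' sets.countable_UN' borel_closed) auto
qed

text \<open>By outer regularity a Lebesgue null set lies in open sets of arbitrarily small Lebesgue
  measure, on which the definition bounds \<mu>.\<close>

lemma P2_ac_null:
  assumes \<mu>: "\<mu> \<in> P2_ac" and N: "N \<in> null_sets lborel"
  shows "N \<in> null_sets (measure_of_P2 \<mu>)"
proof -
  interpret prob_space "measure_of_P2 \<mu>" by (rule prob_space_P2)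
  have le: "measure (measure_of_P2 \<mu>) N \<le> 1 / Suc k" for k :: nat
  proof -
    obtain m :: nat where m: "\<And>U. open U \<Longrightarrow> emeasure lborel U < ennreal (1 / Suc m) \<Longrightarrow>
        measure (measure_of_P2 \<mu>) U \<le> 1 / Suc k"
      using \<mu> unfolding P2_ac_def by blast
    have Nl: "N \<in> null_sets lebesgue" using N by (simp add: null_sets_completionI)
    obtain T where T: "open T" "N \<subseteq> T" "emeasure lebesgue (T - N) < ennreal (1 / Suc m)"
      using sets_lebesgue_outer_open[of N "1 / Suc m"] Nl by (metis null_setsD2 of_nat_0_less_iff zero_less_Suc zero_less_divide_1_iff)
    have "emeasure lborel T = emeasure lebesgue T" using T by simp
    also have "\<dots> = emeasure lebesgue (T - N)"
      using Nl T by (intro emeasure_Diff_null_set[symmetric]) auto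
    finally have "measure (measure_of_P2 \<mu>) T \<le> 1 / Suc k" using T by (intro m) auto
    moreover have "measure (measure_of_P2 \<mu>) N \<le> measure (measure_of_P2 \<mu>) T"
      using T by (intro finite_measure_mono) (auto simp: sets_P2)
    ultimately show ?thesis by simp
  qed
  have "measure (measure_of_P2 \<mu>) N \<le> 0"
  proof (rule LIMSEQ_le_const)
    show "(\<lambda>k. 1 / real (Suc k)) \<longlonglongrightarrow> 0"
      using LIMSEQ_inverse_real_of_nat by (simp add: inverse_eq_divide)
  qed (use le in auto)
  then have "emeasure (measure_of_P2 \<mu>) N = 0" by (simp add: emeasure_eq_measure measure_le_0_iff)
  then show ?thesis using N by (auto simp: null_sets_def sets_P2)
qed

text \<open>Borel-Cantelli: otherwise there are open sets of Lebesgue measure at most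
  \<open>(1/2)^n\<close> whose \<mu>-mass stays above \<open>1 / Suc k\<close>. Their limit superior
  is Lebesgue null but has \<mu>-mass at least \<open>1 / Suc k\<close>.\<close>

lemma P2_acI:
  assumes ac: "\<And>N. N \<in> null_sets lborel \<Longrightarrow> emeasure (measure_of_P2 \<mu>) N = 0"
  shows "\<mu> \<in> P2_ac"
proof (rule ccontr)
  interpret prob_space "measure_of_P2 \<mu>" by (rule prob_space_P2)
  assume "\<mu> \<notin> P2_ac"
  then obtain k :: nat where k: "\<And>m::nat. \<exists>U. open U \<and> emeasure lborel U < ennreal (1 / Suc m) \<and>
      1 / Suc k < measure (measure_of_P2 \<mu>) U"
    unfolding P2_ac_def by (auto simp: not_le)
  have "\<exists>U. open U \<and> emeasure lborel U \<le> ennreal ((1/2)^n) \<and> 1 / Suc k < measure (measure_of_P2 \<mu>) U" for n :: nat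
  proof -
    obtain m where m: "inverse (real (Suc m)) < (1/2)^n" using reals_Archimedean[of "(1/2::real)^n"] by auto
    obtain U where U: "open U" "emeasure lborel U < ennreal (1 / Suc m)" "1 / Suc k < measure (measure_of_P2 \<mu>) U"
      using k[of m] by blast
    have "ennreal (1 / Suc m) \<le> ennreal ((1/2)^n)" using m by (intro ennreal_leI) (simp add: inverse_eq_divide)
    with U show ?thesis by (meson less_imp_le order_trans)
  qed
  then obtain U where U: "\<And>n. open (U n)" "\<And>n. emeasure lborel (U n) \<le> ennreal ((1/2)^n)"
      "\<And>n::nat. 1 / Suc k < measure (measure_of_P2 \<mu>) (U n)" by metis
  have [measurable]: "U n \<in> sets borel" for n using U(1) by simp
  have fin: "emeasure lborel (U n) < \<infinity>" for n by (rule le_less_trans[OF U(2)]) simp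
  have "limsup U \<in> null_sets lborel"
  proof (rule borel_cantelli_limsup1)
    have "measure lborel (U n) \<le> (1/2)^n" for n
      using enn2real_mono[OF U(2)[of n]] by (simp add: measure_def)
    then show "summable (\<lambda>n. measure lborel (U n))"
      by (intro summable_comparison_test'[OF summable_geometric[of "1/2"], of 0]) auto
  qed (use fin in auto)
  then have "emeasure (measure_of_P2 \<mu>) (limsup U) = 0" by (rule ac)
  moreover have "limsup U = (\<Inter>n. \<Union>m\<in>{n..}. U m)" by (simp add: limsup_INF_SUP)
  moreover have "(\<lambda>n. measure (measure_of_P2 \<mu>) (\<Union>m\<in>{n..}. U m)) \<longlonglongrightarrow> measure (measure_of_P2 \<mu>) (\<Inter>n. \<Union>m\<in>{n..}. U m)"
  proof (rule finite_Lim_measure_decseq)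
    show "decseq (\<lambda>n. \<Union>m\<in>{n..}. U m)" by (intro decseq_SucI UN_mono) auto
  qed (auto simp: sets_P2 intro!: sets.countable_UN')
  moreover have "1 / Suc k \<le> measure (measure_of_P2 \<mu>) (\<Union>m\<in>{n..}. U m)" for n
  proof -
    have "1 / Suc k \<le> measure (measure_of_P2 \<mu>) (U n)" using U(3)[of n] by simp
    also have "\<dots> \<le> measure (measure_of_P2 \<mu>) (\<Union>m\<in>{n..}. U m)"
      by (intro finite_measure_mono) (auto simp: sets_P2 intro!: sets.countable_UN')
    finally show ?thesis .
  qed
  ultimately have "1 / real (Suc k) \<le> 0"
    by (intro LIMSEQ_le_const[of "\<lambda>n. measure (measure_of_P2 \<mu>) (\<Union>m\<in>{n..}. U m)"]) (auto simp: measure_def)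
  then show False by simp
qed

text \<open>The Lipschitz image of a hyperplane is negligible for the completed measure. With
  \<open>p\<close> the orthogonal projection along \<open>v\<close>, the set is also the solution
  set of an equation between continuous functions, hence closed, and thus null for
  \<open>lborel\<close> itself.\<close>

lemma dc_hypersurface_null:
  fixes S :: "'a::euclidean_space set"
  assumes "dc_hypersurface S"
  shows "S \<in> null_sets lborel"
proof -
  obtain v :: 'a and f g Lf Lg where v: "v \<noteq> 0"
    and f: "Lf-lipschitz_on {x. x \<bullet> v = 0} f" and g: "Lg-lipschitz_on {x. x \<bullet> v = 0} g"
    and S: "S = {x + (f x - g x) *\<^sub>R v |x. x \<bullet> v = 0}"
    using assms unfolding dc_hypersurface_def by blast
  define h where "h x = f x - g x" for x
  have h: "(Lf + Lg)-lipschitz_on {x. x \<bullet> v = 0} h"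
    unfolding h_def by (intro lipschitz_intros f g)
  have vv: "v \<bullet> v \<noteq> 0" using v by simp
  define p where "p y = y - ((y \<bullet> v) / (v \<bullet> v)) *\<^sub>R v" for y
  have p0: "p y \<bullet> v = 0" for y using vv by (simp add: p_def inner_diff_left)
  have cont: "continuous_on UNIV (\<lambda>y. h (p y))"
  proof (rule continuous_on_compose2[OF lipschitz_on_continuous_on[OF h]])
    show "continuous_on UNIV p" unfolding p_def using vv by (intro continuous_intros) auto
  qed (auto simp: p0)
  have S_eq: "S = {y. (y \<bullet> v) / (v \<bullet> v) = h (p y)}"
  proof safe
    fix y assume "y \<in> S"
    then obtain x where x: "x \<bullet> v = 0" "y = x + h x *\<^sub>R v" unfolding S h_def by blast
    have "(y \<bullet> v) / (v \<bullet> v) = h x" using x vv by (simp add: inner_add_left)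
    moreover from this have "p y = x" by (simp add: p_def x(2))
    ultimately show "(y \<bullet> v) / (v \<bullet> v) = h (p y)" by simp
  next
    fix y assume "(y \<bullet> v) / (v \<bullet> v) = h (p y)"
    then have "y = p y + h (p y) *\<^sub>R v" by (simp add: p_def)
    then show "y \<in> S" unfolding S h_def using p0 by blast
  qed
  have "closed S" unfolding S_eq using vv
    by (intro closed_Collect_eq cont continuous_intros) auto
  moreover have "negligible S"
  proof -
    have "S = (\<lambda>x. x + h x *\<^sub>R v) ` {x. x \<bullet> v = 0}" by (auto simp: S h_def)
    moreover have "negligible ((\<lambda>x. x + h x *\<^sub>R v) ` {x. x \<bullet> v = 0})"
    proof (rule negligible_locally_Lipschitz_image)
      show "negligible {x. x \<bullet> v = 0}" using negligible_hyperplane[of v 0] v by (simp add: inner_commute)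
      fix x assume x: "x \<in> {x. x \<bullet> v = 0}"
      show "\<exists>T B. open T \<and> x \<in> T \<and> (\<forall>y\<in>{x. x \<bullet> v = 0} \<inter> T.
          norm (y + h y *\<^sub>R v - (x + h x *\<^sub>R v)) \<le> B * norm (y - x))"
      proof (intro exI[of _ UNIV] exI[of _ "1 + (Lf + Lg) * norm v"] conjI ballI)
        fix y assume y: "y \<in> {x. x \<bullet> v = 0} \<inter> UNIV"
        have "norm (y + h y *\<^sub>R v - (x + h x *\<^sub>R v)) = norm ((y - x) + (h y - h x) *\<^sub>R v)"
          by (simp add: algebra_simps)
        also have "\<dots> \<le> norm (y - x) + \<bar>h y - h x\<bar> * norm v"
          by (rule order_trans[OF norm_triangle_ineq]) simp
        also have "\<dots> \<le> norm (y - x) + ((Lf + Lg) * norm (y - x)) * norm v"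
          using lipschitz_onD[OF h, of y x] x y by (intro add_left_mono mult_right_mono) (auto simp: dist_norm)
        also have "\<dots> = (1 + (Lf + Lg) * norm v) * norm (y - x)" by (simp add: algebra_simps)
        finally show "norm (y + h y *\<^sub>R v - (x + h x *\<^sub>R v)) \<le> (1 + (Lf + Lg) * norm v) * norm (y - x)" .
      qed auto
    qed simp
    ultimately show ?thesis by simp
  qed
  ultimately show ?thesis
    using negligible_iff_null_sets[of S] null_sets_completion_iff[of S lborel] by auto
qed

lemma P2_ac_subset_regular: "P2_ac \<subseteq> P2_regular"
  unfolding P2_regular_def using P2_ac_null dc_hypersurface_null by blast

text \<open>No measurability of \<open>f\<close> is assumed: for \<open>f = W2\<close> it would require the triangle inequality,
  that is, gluing of couplings.\<close>

lemma nn_integral_distr_le: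
  assumes T: "T \<in> M \<rightarrow>\<^sub>M N"
  shows "(\<integral>\<^sup>+x. f x \<partial>distr M N T) \<le> (\<integral>\<^sup>+x. f (T x) \<partial>M)"
proof -
  have "integral\<^sup>S (distr M N T) g \<le> (\<integral>\<^sup>+x. f (T x) \<partial>M)"
    if g: "simple_function (distr M N T) g" "g \<le> f" for g
  proof -
    have [measurable]: "g \<in> borel_measurable N"
      using borel_measurable_simple_function[OF g(1)] by simp
    have "integral\<^sup>S (distr M N T) g = (\<integral>\<^sup>+x. g x \<partial>distr M N T)"
      using g(1) by (rule nn_integral_eq_simple_integral[symmetric])
    also have "\<dots> = (\<integral>\<^sup>+x. g (T x) \<partial>M)" by (rule nn_integral_distr[OF T]) simp
    also have "\<dots> \<le> (\<integral>\<^sup>+x. f (T x) \<partial>M)" using g(2) by (intro nn_integral_mono) (auto simp: le_fun_def)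
    finally show ?thesis .
  qed
  then show ?thesis unfolding nn_integral_def[of "distr M N T"] by (intro SUP_least) auto
qed

section \<open>Continuity of the passage from maps to laws\<close>

lemma measure_of_iota:
  "square_integrable f \<Longrightarrow> measure_of_P2 (iota (abs_cube_L2 f)) = distr cube_measure borel f"
proof -
  assume f: "square_integrable f"
  then have [measurable]: "f \<in> borel_measurable cube_measure" by (simp add: square_integrable_def)
  have "distr cube_measure borel f \<in> {\<mu>. sets \<mu> = sets borel \<and> prob_space \<mu> \<and> integrable \<mu> (\<lambda>x. (norm x)\<^sup>2)}"
    using f by (auto simp: integrable_distr_eq square_integrable_def
        intro!: prob_space.prob_space_distr[OF prob_space_cube_measure])
  then show ?thesis by (simp add: iota.abs_eq[OF L2_rel_refl[OF f]] Abs_P2_inverse)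
qed

text \<open>The joint law of two representatives on the cube is a coupling whose cost is the squared
  \<open>L^2\<close> distance.\<close>

lemma W2_iota_le: "W2 (iota X) (iota Y) \<le> norm (X - Y)"
proof -
  obtain f where f: "square_integrable f" "X = abs_cube_L2 f" by (rule cube_L2_cases)
  obtain g where g: "square_integrable g" "Y = abs_cube_L2 g" by (rule cube_L2_cases)
  have [measurable]: "f \<in> borel_measurable cube_measure" "g \<in> borel_measurable cube_measure"
    using f g by (auto simp: square_integrable_def)
  let ?\<gamma> = "distr cube_measure borel (\<lambda>x. (f x, g x))"
  note [measurable] = measurable_couplings[OF refl]
  have p [measurable]: "(\<lambda>x. (f x, g x)) \<in> borel_measurable cube_measure" by simp
  have "?\<gamma> \<in> couplings (measure_of_P2 (iota X)) (measure_of_P2 (iota Y))"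
    unfolding couplings_def f(2) g(2) measure_of_iota[OF f(1)] measure_of_iota[OF g(1)]
    by (simp add: distr_distr[OF measurable_couplings(1)[OF refl] p] distr_distr[OF measurable_couplings(2)[OF refl] p] o_def)
  moreover have "(\<integral>\<^sup>+ z. ennreal ((dist (fst z) (snd z))\<^sup>2) \<partial>?\<gamma>) = ennreal ((norm (X - Y))\<^sup>2)"
    unfolding f(2) g(2) minus_abs_cube_L2[OF f(1) g(1)]
      nn_integral_norm_abs_cube_L2[OF square_integrable_diff[OF f(1) g(1)], symmetric]
    by (subst nn_integral_distr[OF p]) (simp_all add: dist_norm)
  ultimately show ?thesis by (intro W2_le) auto
qed

lemma open_iota_vimage:
  assumes "open U"
  shows "open (iota -` U)"
  unfolding open_dist
proof
  fix X assume "X \<in> iota -` U"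
  then obtain e where e: "e > 0" "\<And>\<nu>. W2 \<nu> (iota X) < e \<Longrightarrow> \<nu> \<in> U"
    using assms unfolding open_P2_def by auto
  show "\<exists>e>0. \<forall>y. dist y X < e \<longrightarrow> y \<in> iota -` U"
    using e W2_iota_le by (intro exI[of _ e]) (auto simp: dist_norm intro: le_less_trans)
qed

lemma iota_measurable [measurable]: "iota \<in> borel \<rightarrow>\<^sub>M borel"
  by (rule borel_measurableI) (auto intro: borel_open open_iota_vimage)

section \<open>Evaluation and Jacobian of continuously differentiable maps\<close>

lemma norm_Rep_cube_C1_le: "norm (Rep_cube_C1 X x) \<le> norm X"
proof (cases "x \<in> cbox 0 1")
  case True
  have C: "C1_on_cube (Rep_cube_C1 X)" using Rep_cube_C1[of X] by simp
  have "norm (Rep_cube_C1 X x) \<le> (SUP x\<in>cbox 0 1. norm (Rep_cube_C1 X x))"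
    by (rule cSUP_upper[OF True C1_bdd_above(1)[OF C]])
  then show ?thesis using C1_norm_parts[OF C] by (simp add: norm_cube_C1.rep_eq C1_norm_def)
next
  case False
  then have "Rep_cube_C1 X x = 0" using Rep_cube_C1[of X] by simp
  then show ?thesis by simp
qed

lemma bounded_linear_Rep_cube_C1: "bounded_linear (\<lambda>X. Rep_cube_C1 X x)"
  by (rule bounded_linear_intro[where K=1])
    (auto simp: plus_cube_C1.rep_eq scaleR_cube_C1.rep_eq norm_Rep_cube_C1_le)

definition jacobian :: "real^'n \<Rightarrow> 'n::finite cube_C1 \<Rightarrow> real^'n^'n" where
  "jacobian x X = matrix (frechet_derivative (Rep_cube_C1 X) (at x))"

lemma C1_on_cube_Rep: "C1_on_cube (Rep_cube_C1 X)"
  using Rep_cube_C1[of X] by simp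

lemma norm_frechet_derivative_le:
  assumes x: "x \<in> box 0 1"
  shows "norm (frechet_derivative (Rep_cube_C1 X) (at x) v) \<le> norm X * norm v"
proof -
  let ?D = "frechet_derivative (Rep_cube_C1 X)"
  note C = C1_on_cube_Rep[of X]
  have "norm (?D (at x) v) \<le> onorm (?D (at x)) * norm v"
    by (rule onorm[OF C1_bounded_linear[OF C x]])
  also have "\<dots> \<le> norm X * norm v"
  proof (rule mult_right_mono)
    have "onorm (?D (at x)) \<le> (SUP x\<in>box 0 1. onorm (?D (at x)))"
      by (rule cSUP_upper[OF x C1_bdd_above(2)[OF C]])
    then show "onorm (?D (at x)) \<le> norm X"
      using C1_norm_parts[OF C] by (simp add: norm_cube_C1.rep_eq C1_norm_def)
  qed simp
  finally show ?thesis .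
qed

lemma frechet_derivative_cube_C1:
  assumes x: "x \<in> box 0 1"
  shows "frechet_derivative (Rep_cube_C1 (X + Y)) (at x) v =
      frechet_derivative (Rep_cube_C1 X) (at x) v + frechet_derivative (Rep_cube_C1 Y) (at x) v"
    and "frechet_derivative (Rep_cube_C1 (c *\<^sub>R X)) (at x) v = c *\<^sub>R frechet_derivative (Rep_cube_C1 X) (at x) v"
proof -
  have "frechet_derivative (Rep_cube_C1 (X + Y)) (at x) =
      (\<lambda>v. frechet_derivative (Rep_cube_C1 X) (at x) v + frechet_derivative (Rep_cube_C1 Y) (at x) v)"
    unfolding plus_cube_C1.rep_eq
    by (intro frechet_derivative_at[symmetric] has_derivative_add C1_differentiable C1_on_cube_Rep x)
  then show "frechet_derivative (Rep_cube_C1 (X + Y)) (at x) v =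
      frechet_derivative (Rep_cube_C1 X) (at x) v + frechet_derivative (Rep_cube_C1 Y) (at x) v" by simp
  have "frechet_derivative (Rep_cube_C1 (c *\<^sub>R X)) (at x) =
      (\<lambda>v. c *\<^sub>R frechet_derivative (Rep_cube_C1 X) (at x) v)"
    unfolding scaleR_cube_C1.rep_eq
    by (intro frechet_derivative_at[symmetric] has_derivative_scaleR_right C1_differentiable C1_on_cube_Rep x)
  then show "frechet_derivative (Rep_cube_C1 (c *\<^sub>R X)) (at x) v = c *\<^sub>R frechet_derivative (Rep_cube_C1 X) (at x) v"
    by simp
qed

lemma bounded_linear_jacobian:
  fixes x :: "real^'n::finite"
  assumes x: "x \<in> box 0 1"
  shows "bounded_linear (jacobian x)"
proof (rule bounded_linear_intro)
  fix X Y :: "'n cube_C1" and c :: real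
  show "jacobian x (X + Y) = jacobian x X + jacobian x Y" "jacobian x (c *\<^sub>R X) = c *\<^sub>R jacobian x X"
    by (simp_all add: jacobian_def matrix_def vec_eq_iff frechet_derivative_cube_C1[OF x])
  have "norm (jacobian x X) \<le> (\<Sum>i\<in>UNIV. norm (jacobian x X $ i))"
    unfolding norm_vec_def[of "jacobian x X"] by (rule L2_set_le_sum) simp
  also have "\<dots> \<le> (\<Sum>i\<in>(UNIV::'n set). \<Sum>j\<in>(UNIV::'n set). norm X)"
  proof (rule sum_mono)
    fix i
    have "norm (jacobian x X $ i) \<le> (\<Sum>j\<in>UNIV. \<bar>jacobian x X $ i $ j\<bar>)" by (rule norm_le_l1_cart)
    also have "\<dots> \<le> (\<Sum>j\<in>(UNIV::'n set). norm X)"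
    proof (rule sum_mono)
      fix j
      have "\<bar>jacobian x X $ i $ j\<bar> \<le> norm (frechet_derivative (Rep_cube_C1 X) (at x) (axis j 1))"
        by (simp add: jacobian_def matrix_def component_le_norm_cart)
      also have "\<dots> \<le> norm X" using norm_frechet_derivative_le[OF x, of X "axis j 1"] by (simp add: norm_eq_sqrt_inner inner_axis_axis)
      finally show "\<bar>jacobian x X $ i $ j\<bar> \<le> norm X" .
    qed
    finally show "norm (jacobian x X $ i) \<le> (\<Sum>j\<in>(UNIV::'n set). norm X)" .
  qed
  finally show "norm (jacobian x X) \<le> norm X * (real CARD('n) * real CARD('n))"
    by (simp add: mult_ac)
qed

lemma cube_C1_of_linear:
  fixes M :: "real^'n^'n"
  shows "Rep_cube_C1 (cube_C1_of (\<lambda>x. M *v x)) = (\<lambda>x. if x \<in> cbox 0 1 then M *v x else 0)"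
proof (rule cube_C1_of_rep)
  have b: "bounded_linear (\<lambda>x. M *v x)" by (rule matrix_vector_mul_bounded_linear)
  show "((\<lambda>x. M *v x) has_derivative blinfun_apply ((\<lambda>_. Blinfun (\<lambda>x. M *v x)) x)) (at x)" for x
    by (simp add: bounded_linear_Blinfun_apply b bounded_linear_imp_has_derivative)
qed (intro continuous_intros)

text \<open>Linear maps show that \<open>jacobian x\<close> is onto, so that no nonzero functional
  on matrices vanishes on its range; this gives nondegeneracy of the Gaussian matrix.\<close>

lemma jacobian_linear:
  fixes M :: "real^'n^'n"
  assumes x: "x \<in> box 0 1"
  shows "jacobian x (cube_C1_of (\<lambda>x. M *v x)) = M"
proof -
  let ?F = "\<lambda>x. if x \<in> cbox 0 1 then M *v x else 0"
  have "((\<lambda>x. M *v x) has_derivative (\<lambda>x. M *v x)) (at x)"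
    by (intro bounded_linear_imp_has_derivative matrix_vector_mul_bounded_linear)
  then have "(?F has_derivative (\<lambda>x. M *v x)) (at x)"
    by (rule has_derivative_transform_eventually)
      (use x cbox_neighbourhood_eq[OF x, of "\<lambda>x. M *v x"] box_subset_cbox[of 0 "1::real^'n"]
       in \<open>auto simp: eventually_nhds_conv_at elim!: eventually_mono\<close>)
  then have "frechet_derivative ?F (at x) = (\<lambda>x. M *v x)" by (rule frechet_derivative_at[symmetric])
  then show ?thesis by (simp add: jacobian_def cube_C1_of_linear matrix_of_matrix_vector_mul)
qed

section \<open>Gaussian measures under bounded linear maps\<close>

lemma distributed_distr:
  assumes T: "T \<in> M \<rightarrow>\<^sub>M K" and l: "distributed M N (\<lambda>x. l (T x)) f" "l \<in> K \<rightarrow>\<^sub>M N"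
  shows "distributed (distr M K T) N l f"
  using l T unfolding distributed_def by (auto simp: distr_distr o_def)

lemma bounded_linear_borel_measurable:
  "bounded_linear T \<Longrightarrow> T \<in> borel_measurable borel"
  by (intro borel_measurable_continuous_onI linear_continuous_on)

text \<open>A functional on the target, composed with \<open>T\<close>, is a functional on the
  source; the hypothesis \<open>dense\<close> keeps it nonzero.\<close>

lemma nondegenerate_gaussian_image:
  fixes g :: "'a::real_normed_vector measure" and T :: "'a \<Rightarrow> 'b::real_normed_vector"
  assumes g: "nondegenerate_gaussian g" and T: "bounded_linear T"
    and dense: "\<And>l :: 'b \<Rightarrow>\<^sub>L real. l \<noteq> 0 \<Longrightarrow> \<exists>x. blinfun_apply l (T x) \<noteq> 0"
  shows "nondegenerate_gaussian (distr g borel T)"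
proof -
  interpret prob_space g using g by (simp add: nondegenerate_gaussian_def)
  have sets [measurable_cong]: "sets g = sets borel" using g by (simp add: nondegenerate_gaussian_def)
  have Tm: "T \<in> g \<rightarrow>\<^sub>M borel"
    using bounded_linear_borel_measurable[OF T] unfolding measurable_cong_sets[OF sets refl] .
  show ?thesis
    unfolding nondegenerate_gaussian_def
  proof (intro conjI allI impI)
    show "prob_space (distr g borel T)" by (rule prob_space_distr[OF Tm])
    fix l :: "'b \<Rightarrow>\<^sub>L real" assume l: "l \<noteq> 0"
    have b: "bounded_linear (\<lambda>x. blinfun_apply l (T x))"
      by (rule bounded_linear_compose[OF blinfun.bounded_linear_right T])
    then have a: "blinfun_apply (Blinfun (\<lambda>x. blinfun_apply l (T x))) = (\<lambda>x. blinfun_apply l (T x))" by (rule bounded_linear_Blinfun_apply)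
    obtain x where "blinfun_apply l (T x) \<noteq> 0" using dense[OF l] by blast
    then have "Blinfun (\<lambda>x. blinfun_apply l (T x)) \<noteq> 0" using a by (metis zero_blinfun.rep_eq)
    then obtain m \<sigma> where "\<sigma> > 0" "distributed g lborel (\<lambda>x. blinfun_apply l (T x)) (\<lambda>x. ennreal (normal_density m \<sigma> x))"
      using g a unfolding nondegenerate_gaussian_def by metis
    moreover have "blinfun_apply l \<in> borel \<rightarrow>\<^sub>M lborel"
      using bounded_linear_borel_measurable[OF blinfun.bounded_linear_right[of l]] by simp
    ultimately show "\<exists>m \<sigma>. \<sigma> > 0 \<and> distributed (distr g borel T) lborel (blinfun_apply l) (\<lambda>x. ennreal (normal_density m \<sigma> x))"
      by (intro exI[of _ m] exI[of _ \<sigma>] conjI distributed_distr[OF Tm]) auto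
  qed simp
qed

lemma gaussian_functional:
  fixes g :: "'a::real_normed_vector measure"
  assumes g: "nondegenerate_gaussian g" and l: "bounded_linear l" "l x \<noteq> 0"
  obtains m \<sigma> where "\<sigma> > 0" "distributed g lborel l (\<lambda>x. ennreal (normal_density m \<sigma> x))"
proof -
  have a: "blinfun_apply (Blinfun l) = l" by (rule bounded_linear_Blinfun_apply[OF l(1)])
  then have "Blinfun l \<noteq> 0" using l(2) by (metis zero_blinfun.rep_eq)
  then show ?thesis using g a that unfolding nondegenerate_gaussian_def by metis
qed

lemma nondegenerate_gaussian_jacobian:
  fixes g :: "'n::finite cube_C1 measure"
  assumes g: "nondegenerate_gaussian g" and x: "x \<in> box 0 1"
  shows "nondegenerate_gaussian (distr g borel (jacobian x))"
proof (rule nondegenerate_gaussian_image[OF g bounded_linear_jacobian[OF x]])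
  fix l :: "(real^'n^'n) \<Rightarrow>\<^sub>L real" assume "l \<noteq> 0"
  then obtain M where "blinfun_apply l M \<noteq> 0" by (metis blinfun_eqI zero_blinfun.rep_eq)
  then show "\<exists>X. blinfun_apply l (jacobian x X) \<noteq> 0" using jacobian_linear[OF x, of M] by metis
qed

lemma norm_C1_to_L2_le: "norm (C1_to_L2 X) \<le> norm X"
proof -
  interpret prob_space "cube_measure :: (real^'a) measure" by (rule prob_space_cube_measure)
  have "(norm (C1_to_L2 X))\<^sup>2 = (\<integral>x. (norm (Rep_cube_C1 X x))\<^sup>2 \<partial>cube_measure)"
    unfolding C1_to_L2_eq by (rule norm_abs_cube_L2[OF square_integrable_C1])
  also have "\<dots> \<le> (\<integral>x. (norm X)\<^sup>2 \<partial>(cube_measure :: (real^'a) measure))"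
    using square_integrable_C1[of X]
    by (intro integral_mono power_mono norm_Rep_cube_C1_le) (auto simp: square_integrable_def)
  also have "\<dots> = (norm X)\<^sup>2" using prob_space by simp
  finally show ?thesis by (rule power2_le_imp_le) simp
qed

lemma bounded_linear_C1_to_L2: "bounded_linear C1_to_L2"
  by (rule bounded_linear_intro[where K=1]) (auto simp: C1_to_L2_add C1_to_L2_scaleR norm_C1_to_L2_le)

lemma nondegenerate_gaussian_L2:
  fixes g :: "'n::finite cube_C1 measure"
  assumes g: "nondegenerate_gaussian g"
  shows "nondegenerate_gaussian (distr g borel C1_to_L2)"
proof (rule nondegenerate_gaussian_image[OF g bounded_linear_C1_to_L2], rule ccontr)
  fix l :: "'n cube_L2 \<Rightarrow>\<^sub>L real"
  assume l: "l \<noteq> 0" and "\<nexists>X. blinfun_apply l (C1_to_L2 X) \<noteq> 0"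
  then have "range C1_to_L2 \<subseteq> {Y. blinfun_apply l Y = 0}" by auto
  moreover have "closed {Y. blinfun_apply l Y = 0}"
    by (intro closed_Collect_eq continuous_intros linear_continuous_on blinfun.bounded_linear_right)
  ultimately have "closure (range C1_to_L2) \<subseteq> {Y. blinfun_apply l Y = 0}" by (rule closure_minimal)
  then have "\<And>Y. blinfun_apply l Y = 0" by (auto simp: closure_range_C1_to_L2)
  then have "l = 0" by (intro blinfun_eqI) simp
  with l show False by simp
qed

section \<open>Joint measurability of evaluation and Jacobian\<close>

lemma vec_count_space_measurable:
  fixes v :: "'a \<Rightarrow> int^'n::finite"
  assumes "\<And>i. (\<lambda>x. v x $ i) \<in> M \<rightarrow>\<^sub>M count_space UNIV"
  shows "v \<in> M \<rightarrow>\<^sub>M count_space UNIV"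
proof -
  have "v -` {w} \<inter> space M \<in> sets M" for w
  proof -
    have "{x \<in> space M. \<forall>i. v x $ i = w $ i} \<in> sets M"
    proof (rule sets.sets_Collect_countable_All)
      show "{x \<in> space M. v x $ i = w $ i} \<in> sets M" for i
        using measurable_sets[OF assms[of i], of "{w $ i}"] by (simp add: vimage_def Int_def conj_commute)
    qed
    moreover have "{x \<in> space M. \<forall>i. v x $ i = w $ i} = v -` {w} \<inter> space M" by (auto simp: vec_eq_iff)
    ultimately show ?thesis by simp
  qed
  then show ?thesis by (subst measurable_count_space_eq2_countable) auto
qed

lemma borel_measurable_vec_nth [measurable (raw)]:
  fixes f :: "'a \<Rightarrow> real^'n"
  shows "f \<in> borel_measurable M \<Longrightarrow> (\<lambda>x. f x $ i) \<in> borel_measurable M"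
  by (erule measurable_compose) (intro borel_measurable_continuous_onI continuous_intros)

text \<open>Cut off outside the open box, which carries \<open>cube_measure\<close>, to obtain a
  function of two variables on the whole product space.\<close>

definition cube_eval :: "'n::finite cube_C1 \<Rightarrow> real^'n \<Rightarrow> real^'n" where
  "cube_eval X x = (if x \<in> box 0 1 then Rep_cube_C1 X x else 0)"

lemma floor_grid_tendsto: "(\<lambda>k. of_int \<lfloor>real (Suc k) * t\<rfloor> / real (Suc k)) \<longlonglongrightarrow> t"
proof (rule real_tendsto_sandwich)
  have inv: "(\<lambda>k. 1 / real (Suc k)) \<longlonglongrightarrow> 0"
    using LIMSEQ_inverse_real_of_nat by (simp add: inverse_eq_divide)
  show "(\<lambda>k. t - 1 / real (Suc k)) \<longlonglongrightarrow> t" using tendsto_diff[OF tendsto_const[of t] inv] by simp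
  have "t - 1 / real (Suc k) \<le> of_int \<lfloor>real (Suc k) * t\<rfloor> / real (Suc k)" for k
  proof -
    have "real (Suc k) * t - 1 \<le> of_int \<lfloor>real (Suc k) * t\<rfloor>" by linarith
    then have "(real (Suc k) * t - 1) / real (Suc k) \<le> of_int \<lfloor>real (Suc k) * t\<rfloor> / real (Suc k)"
      by (rule divide_right_mono) simp
    then show ?thesis by (simp add: diff_divide_distrib del: of_nat_Suc)
  qed
  then show "\<forall>\<^sub>F k in sequentially. t - 1 / real (Suc k) \<le> of_int \<lfloor>real (Suc k) * t\<rfloor> / real (Suc k)"
    by (intro always_eventually allI)
  have "of_int \<lfloor>real (Suc k) * t\<rfloor> / real (Suc k) \<le> t" for k
  proof -
    have "of_int \<lfloor>real (Suc k) * t\<rfloor> / real (Suc k) \<le> (real (Suc k) * t) / real (Suc k)"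
      by (intro divide_right_mono of_int_floor_le) simp
    then show ?thesis by (simp del: of_nat_Suc)
  qed
  then show "\<forall>\<^sub>F k in sequentially. of_int \<lfloor>real (Suc k) * t\<rfloor> / real (Suc k) \<le> t"
    by (intro always_eventually allI)
qed (rule tendsto_const)

lemma mem_box_01: "x \<in> box 0 (1::real^'n) \<longleftrightarrow> (\<forall>i. 0 < x $ i \<and> x $ i < 1)"
  by (simp add: mem_box_cart)

lemma mem_cbox_01: "x \<in> cbox 0 (1::real^'n) \<longleftrightarrow> (\<forall>i. 0 \<le> x $ i \<and> x $ i \<le> 1)"
  by (simp add: mem_box_cart)

text \<open>The space of continuously differentiable maps is not known to be second countable here, so joint
  continuity does not give measurability for the product \<open>\<sigma>\<close>-algebra; rounding \<open>x\<close> to a grid does.\<close>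

lemma cube_eval_measurable [measurable]:
  "(\<lambda>z. cube_eval (fst z) (snd z)) \<in> borel_measurable ((borel :: 'n::finite cube_C1 measure) \<Otimes>\<^sub>M borel)"
proof -
  \<comment> \<open>\<open>v k x\<close> is the index of the grid point \<open>y k (v k x)\<close>
    below \<open>x\<close>. Indices range over a countable type, so they can be treated as
    parameters, and for a fixed grid point evaluation is a bounded functional.\<close>
  define v where "v k x = (\<chi> i. \<lfloor>real (Suc k) * x $ i\<rfloor>)" for k and x :: "real^'n"
  define y where "y k w = (\<chi> i. of_int (w $ i) / real (Suc k))" for k and w :: "int^'n"
  have v_meas [measurable]: "v k \<in> borel \<rightarrow>\<^sub>M count_space UNIV" for k
    by (rule vec_count_space_measurable) (simp add: v_def)
  have [measurable]: "(\<lambda>z. Rep_cube_C1 (fst z) (y k w)) \<in> borel_measurable ((borel :: 'n cube_C1 measure) \<Otimes>\<^sub>M (borel :: (real^'n) measure))" for k w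
    by (rule measurable_compose[OF measurable_fst bounded_linear_borel_measurable[OF bounded_linear_Rep_cube_C1]])
  let ?h = "\<lambda>k z. indicator (box 0 1) (snd z) *\<^sub>R Rep_cube_C1 (fst z) (y k (v k (snd z)))"
  have h: "?h k \<in> borel_measurable ((borel :: 'n cube_C1 measure) \<Otimes>\<^sub>M borel)" for k
  proof (intro borel_measurable_scaleR)
    show "(\<lambda>z. Rep_cube_C1 (fst z) (y k (v k (snd z)))) \<in> borel_measurable ((borel :: 'n cube_C1 measure) \<Otimes>\<^sub>M borel)"
      by (rule measurable_compose_countable[where g="\<lambda>z. v k (snd z)"]) measurable
    show "(\<lambda>z. indicator (box 0 1) (snd z) :: real) \<in> borel_measurable ((borel :: 'n cube_C1 measure) \<Otimes>\<^sub>M borel)"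
      by measurable
  qed
  have lim: "(\<lambda>k. ?h k z) \<longlonglongrightarrow> cube_eval (fst z) (snd z)" for z :: "'n cube_C1 \<times> (real^'n)"
  proof (cases "snd z \<in> box 0 1")
    case True
    let ?x = "snd z" and ?X = "fst z"
    have xc: "?x \<in> cbox 0 1" using True box_subset_cbox by blast
    have "(\<lambda>k. y k (v k ?x)) \<longlonglongrightarrow> ?x"
    proof (rule vec_tendstoI)
      show "(\<lambda>k. y k (v k ?x) $ i) \<longlonglongrightarrow> ?x $ i" for i
        using floor_grid_tendsto[of "?x $ i"] by (simp add: y_def v_def del: of_nat_Suc)
    qed
    \<comment> \<open>Rounding down may land on the boundary; hence the approximants use
      \<open>Rep_cube_C1\<close>, continuous on the closed cube, instead of
      \<open>cube_eval\<close>.\<close>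
    moreover have "y k (v k ?x) \<in> cbox 0 1" for k
    proof -
      have "0 \<le> (of_int \<lfloor>real (Suc k) * ?x $ i\<rfloor> :: real) / real (Suc k)" for i
        using True by (auto simp: mem_box_01 intro!: divide_nonneg_nonneg mult_nonneg_nonneg less_imp_le[of 0 "?x $ i"])
      moreover have "(of_int \<lfloor>real (Suc k) * ?x $ i\<rfloor> :: real) / real (Suc k) \<le> 1" for i
      proof -
        have "of_int \<lfloor>real (Suc k) * ?x $ i\<rfloor> \<le> real (Suc k) * ?x $ i" by (rule of_int_floor_le)
        also have "\<dots> \<le> real (Suc k) * 1"
          using True by (intro mult_left_mono) (auto simp: mem_box_01 less_imp_le)
        finally show ?thesis by (simp add: divide_le_eq del: of_nat_Suc)
      qed
      ultimately show ?thesis by (simp add: mem_cbox_01 y_def v_def del: of_nat_Suc)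
    qed
    moreover have "continuous_on (cbox 0 1) (Rep_cube_C1 ?X)"
      using C1_on_cube_Rep[of ?X] by (simp add: C1_on_cube_def)
    ultimately have "(\<lambda>k. Rep_cube_C1 ?X (y k (v k ?x))) \<longlonglongrightarrow> Rep_cube_C1 ?X ?x"
      using xc unfolding continuous_on_sequentially by (auto simp: o_def)
    then show ?thesis using True by (simp add: cube_eval_def)
  qed (simp add: cube_eval_def)
  show ?thesis
    by (rule borel_measurable_LIMSEQ_metric[OF h lim])
qed

text \<open>The entries of the Jacobian matrix inside the cube, written as limits of difference quotients to
  make their joint measurability evident; outside the cube the limit is meaningless.\<close>

definition cube_jac :: "'n::finite cube_C1 \<Rightarrow> real^'n \<Rightarrow> 'n \<Rightarrow> 'n \<Rightarrow> real" where
  "cube_jac X x i j = lim (\<lambda>k. real (Suc k) * (cube_eval X (x + (1 / real (Suc k)) *\<^sub>R axis j 1) $ i - cube_eval X x $ i))"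

lemma cube_jac_measurable [measurable]:
  "(\<lambda>z. cube_jac (fst z) (snd z) i j) \<in> borel_measurable ((borel :: 'n::finite cube_C1 measure) \<Otimes>\<^sub>M borel)"
proof -
  have [measurable]: "(\<lambda>z. cube_eval (fst z) (snd z + w) $ i) \<in> borel_measurable ((borel :: 'n cube_C1 measure) \<Otimes>\<^sub>M borel)" for w
  proof -
    have "(\<lambda>z. (fst z, snd z + w)) \<in> (borel :: 'n cube_C1 measure) \<Otimes>\<^sub>M borel \<rightarrow>\<^sub>M (borel :: 'n cube_C1 measure) \<Otimes>\<^sub>M borel"
      by measurable
    from measurable_compose[OF this cube_eval_measurable]
    have "(\<lambda>z. cube_eval (fst z) (snd z + w)) \<in> borel_measurable ((borel :: 'n cube_C1 measure) \<Otimes>\<^sub>M borel)" by simp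
    then show ?thesis by (rule borel_measurable_vec_nth)
  qed
  from this[of 0] have [measurable]: "(\<lambda>z. cube_eval (fst z) (snd z) $ i) \<in> borel_measurable ((borel :: 'n cube_C1 measure) \<Otimes>\<^sub>M borel)"
    by simp
  show ?thesis unfolding cube_jac_def by measurable
qed

lemma cube_jac_eq:
  assumes x: "x \<in> box 0 1"
  shows "cube_jac X x i j = jacobian x X $ i $ j"
proof -
  let ?f = "Rep_cube_C1 X" and ?D = "frechet_derivative (Rep_cube_C1 X) (at x)"
  have D: "(?f has_derivative ?D) (at x)" by (rule C1_differentiable[OF C1_on_cube_Rep x])
  have lin: "(\<lambda>t. x + t *\<^sub>R axis j 1) \<midarrow>0\<rightarrow> x" by (auto intro!: tendsto_eq_intros)
  have inv: "(\<lambda>k. 1 / real (Suc k)) \<longlonglongrightarrow> 0"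
    using LIMSEQ_inverse_real_of_nat by (simp add: inverse_eq_divide)
  have "((\<lambda>t. ?f (x + t *\<^sub>R axis j 1)) has_derivative (\<lambda>t. ?D (t *\<^sub>R axis j 1))) (at 0)"
    by (rule has_derivative_compose[where g="?f" and f="\<lambda>t. x + t *\<^sub>R axis j 1"])
      (auto intro!: derivative_eq_intros simp: D)
  from bounded_linear.has_derivative[OF bounded_linear_vec_nth this, of i]
  have "((\<lambda>t. ?f (x + t *\<^sub>R axis j 1) $ i) has_real_derivative ?D (axis j 1) $ i) (at 0)"
    unfolding has_field_derivative_def
    by (rule has_derivative_eq_rhs)
      (simp add: fun_eq_iff linear_scale[OF has_derivative_linear[OF D]] mult.commute)
  then have "(\<lambda>t. (?f (x + t *\<^sub>R axis j 1) $ i - ?f x $ i) / t) \<midarrow>0\<rightarrow> ?D (axis j 1) $ i"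
    by (simp add: DERIV_def)
  moreover have "filterlim (\<lambda>k. 1 / real (Suc k)) (at 0) sequentially"
    unfolding filterlim_at using inv by auto
  ultimately have "(\<lambda>k. (?f (x + (1 / real (Suc k)) *\<^sub>R axis j 1) $ i - ?f x $ i) / (1 / real (Suc k))) \<longlonglongrightarrow> ?D (axis j 1) $ i"
    by (rule filterlim_compose)
  then have "(\<lambda>k. real (Suc k) * (?f (x + (1 / real (Suc k)) *\<^sub>R axis j 1) $ i - ?f x $ i)) \<longlonglongrightarrow> ?D (axis j 1) $ i"
    by (simp add: mult.commute del: of_nat_Suc)
  \<comment> \<open>Once the shifted point lies in the open box, the cut-off in
    \<open>cube_eval\<close> is invisible to the difference quotient.\<close>
  moreover have "\<forall>\<^sub>F k in sequentially. x + (1 / real (Suc k)) *\<^sub>R axis j 1 \<in> box 0 1"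
  proof -
    have "(\<lambda>k. x + (1 / real (Suc k)) *\<^sub>R axis j 1) \<longlonglongrightarrow> x + 0 *\<^sub>R axis j 1" by (intro tendsto_intros inv)
    then show ?thesis using x by (intro topological_tendstoD[of _ x]) auto
  qed
  then have "\<forall>\<^sub>F k in sequentially. real (Suc k) * (?f (x + (1 / real (Suc k)) *\<^sub>R axis j 1) $ i - ?f x $ i) =
     real (Suc k) * (cube_eval X (x + (1 / real (Suc k)) *\<^sub>R axis j 1) $ i - cube_eval X x $ i)"
    by eventually_elim (simp add: cube_eval_def x)
  ultimately have "(\<lambda>k. real (Suc k) * (cube_eval X (x + (1 / real (Suc k)) *\<^sub>R axis j 1) $ i - cube_eval X x $ i)) \<longlonglongrightarrow> ?D (axis j 1) $ i"
    by (rule Lim_transform_eventually)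
  then show ?thesis unfolding cube_jac_def by (simp add: limI jacobian_def matrix_def)
qed

section \<open>Gaussian matrices are almost surely nonsingular\<close>

lemma measure_pair_Times:
  assumes "prob_space M" "prob_space N" "A \<in> sets M" "B \<in> sets N"
  shows "measure (M \<Otimes>\<^sub>M N) (A \<times> B) = measure M A * measure N B"
proof -
  interpret M: prob_space M by fact
  interpret N: prob_space N by fact
  show ?thesis using N.emeasure_pair_measure_Times[OF assms(3,4)]
    by (simp add: measure_def enn2real_mult)
qed

lemma det_scaleR: "det (c *\<^sub>R A) = c ^ CARD('n) * det A" for A :: "real^'n^'n"
  by (simp add: det_def prod.distrib sum_distrib_left mult_ac)

lemma real_polynomial_function_det:
  fixes M :: "real \<Rightarrow> real^'n^'n"
  assumes "\<And>i j. real_polynomial_function (\<lambda>s. M s $ i $ j)"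
  shows "real_polynomial_function (\<lambda>s. det (M s))"
  unfolding det_def
  by (intro real_polynomial_function_sum real_polynomial_function.intros(4) real_polynomial_function_prod
      real_polynomial_function.intros(2) assms) (auto simp: finite_permutations)

lemma real_polynomial_function_zero:
  fixes f :: "real \<Rightarrow> real"
  assumes f: "real_polynomial_function f" and inf: "infinite {s. f s = 0}"
  shows "f s = 0"
proof -
  obtain a n where a: "f = (\<lambda>x. \<Sum>i\<le>n. a i * x ^ i)"
    using f unfolding real_polynomial_function_iff_sum by blast
  have "a i = 0" if "i \<le> n" for i
    using inf that unfolding a polyfun_finite_roots by blast
  then show ?thesis by (simp add: a)
qed

text \<open>For every natural \<open>j\<close> the event \<open>det (T (real j) w) = 0\<close> has
  probability \<open>p\<close>, but a point outside \<open>?F\<close> lies in only finitely many of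
  these events. Their mass outside \<open>?F\<close> thus tends to 0, while \<open>?F\<close> has
  mass \<open>p * p\<close>.\<close>

theorem gaussian_det_null:
  fixes \<kappa> :: "(real^'n^'n) measure"
  assumes \<kappa>: "nondegenerate_gaussian \<kappa>"
  shows "emeasure \<kappa> {A. det A = 0} = 0"
proof -
  interpret prob_space \<kappa> using \<kappa> by (simp add: nondegenerate_gaussian_def)
  interpret PP: prob_space "\<kappa> \<Otimes>\<^sub>M \<kappa>" by (intro prob_space_pair prob_space_axioms)
  interpret P3: prob_space "\<kappa> \<Otimes>\<^sub>M (\<kappa> \<Otimes>\<^sub>M \<kappa>)" by (intro prob_space_pair prob_space_axioms PP.prob_space_axioms)
  have sets [measurable_cong]: "sets \<kappa> = sets borel" using \<kappa> by (simp add: nondegenerate_gaussian_def)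
  have sp: "space \<kappa> = UNIV" using sets by (simp add: sets_eq_imp_space_eq)
  have cdet: "continuous_on UNIV (det :: real^'n^'n \<Rightarrow> real)"
    unfolding det_def[abs_def] by (intro continuous_intros)
  then have [measurable]: "(det :: real^'n^'n \<Rightarrow> real) \<in> borel_measurable borel"
    by (rule borel_measurable_continuous_onI)
  let ?Z = "{A :: real^'n^'n. det A = 0}"
  have Z [measurable]: "?Z \<in> sets borel" by measurable
  define p where "p = measure \<kappa> ?Z"
  \<comment> \<open>The identity matrix lies in the open set of nonsingular matrices, so full
    support gives that set positive mass.\<close>
  have "open {A :: real^'n^'n. det A \<noteq> 0}"
    using open_Collect_neq[OF cdet continuous_on_const[of UNIV 0]] .
  moreover have "mat 1 \<in> {A :: real^'n^'n. det A \<noteq> 0}" by simp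
  ultimately have "emeasure \<kappa> {A. det A \<noteq> 0} > 0"
    using gaussian_full_support[OF \<kappa>] unfolding measure_support_def by blast
  moreover have "{A. det A \<noteq> 0} = space \<kappa> - ?Z" by (auto simp: sp)
  ultimately have p1: "p < 1"
    using prob_compl[of ?Z] by (auto simp: emeasure_eq_measure p_def sets)
  \<comment> \<open>\<open>(1 + s, s (1 + s), - s) / q s\<close> parametrises the triples of \<open>gaussian_rotation\<close>; \<open>s = 0\<close> and
    \<open>s = - 1\<close> give the first and the last copy.\<close>
  define q where "q s = 1 + s + s\<^sup>2" for s :: real
  have q: "q s > 0" if "s \<ge> 0" for s using that by (simp add: q_def add_pos_nonneg)
  define T where "T s = (\<lambda>(A, B, C). (1 + s) *\<^sub>R A + (s * (1 + s)) *\<^sub>R B + (- s) *\<^sub>R C :: real^'n^'n)" for s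
  let ?Q = "\<kappa> \<Otimes>\<^sub>M (\<kappa> \<Otimes>\<^sub>M \<kappa>)"
  have [measurable]: "T s \<in> ?Q \<rightarrow>\<^sub>M borel" for s unfolding T_def by measurable
  have E_p: "measure ?Q {w \<in> space ?Q. det (T s w) = 0} = p" if s: "s \<ge> 0" for s
  proof -
    define a b c where "a = (1 + s) / q s" and "b = s * (1 + s) / q s" and "c = - s / q s"
    have "a + b + c = 1" using q[OF s] unfolding a_def b_def c_def
      by (simp add: add_divide_distrib[symmetric] diff_divide_distrib[symmetric]) (simp add: q_def power2_eq_square algebra_simps)
    moreover have "a\<^sup>2 + b\<^sup>2 + c\<^sup>2 = ((1 + s)\<^sup>2 + (s * (1 + s))\<^sup>2 + s\<^sup>2) / (q s)\<^sup>2"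
      unfolding a_def b_def c_def power_divide by (simp only: add_divide_distrib power2_minus)
    then have "a\<^sup>2 + b\<^sup>2 + c\<^sup>2 = 1"
    proof -
      have "(1 + s)\<^sup>2 + (s * (1 + s))\<^sup>2 + s\<^sup>2 = (q s)\<^sup>2" unfolding q_def by (simp add: power2_eq_square algebra_simps)
      then show ?thesis using q[OF s] \<open>a\<^sup>2 + b\<^sup>2 + c\<^sup>2 = _\<close> by simp
    qed
    ultimately have rot: "distr ?Q borel (\<lambda>(x, y, z). a *\<^sub>R x + b *\<^sub>R y + c *\<^sub>R z) = \<kappa>"
      by (rule gaussian_rotation[OF \<kappa>])
    have Tm: "(\<lambda>(x, y, z). a *\<^sub>R x + b *\<^sub>R y + c *\<^sub>R z) \<in> ?Q \<rightarrow>\<^sub>M borel" by measurable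
    have "p = measure (distr ?Q borel (\<lambda>(x, y, z). a *\<^sub>R x + b *\<^sub>R y + c *\<^sub>R z)) ?Z"
      by (simp only: rot p_def)
    also have "\<dots> = measure ?Q ((\<lambda>(x, y, z). a *\<^sub>R x + b *\<^sub>R y + c *\<^sub>R z) -` ?Z \<inter> space ?Q)"
      by (rule measure_distr[OF Tm Z])
    also have "(\<lambda>(x, y, z). a *\<^sub>R x + b *\<^sub>R y + c *\<^sub>R z) -` ?Z \<inter> space ?Q = {w \<in> space ?Q. det (T s w) = 0}"
    proof -
      \<comment> \<open>Multiplication by \<open>q s\<close>, which is positive, clears the
        denominators: the zeros of the determinant stay the same and \<open>T s\<close> becomes
        polynomial in \<open>s\<close>.\<close>
      have "det (a *\<^sub>R x + b *\<^sub>R y + c *\<^sub>R z) = 0 \<longleftrightarrow> det (T s (x, y, z)) = 0" for x y z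
      proof -
        have "T s (x, y, z) = q s *\<^sub>R (a *\<^sub>R x + b *\<^sub>R y + c *\<^sub>R z)"
          using q[OF s] by (simp add: T_def a_def b_def c_def scaleR_add_right scaleR_diff_right)
        then have "det (T s (x, y, z)) = q s ^ CARD('n) * det (a *\<^sub>R x + b *\<^sub>R y + c *\<^sub>R z)"
          by (simp add: det_scaleR)
        then show ?thesis using q[OF s] by simp
      qed
      then show ?thesis by (auto simp: case_prod_beta')
    qed
    finally show ?thesis by simp
  qed
  \<comment> \<open>Both the first and the last copy singular, the middle one arbitrary:
    independence gives the square of \<open>p\<close>.\<close>
  let ?F = "?Z \<times> (UNIV \<times> ?Z)"
  have F_sets [measurable]: "?F \<in> sets ?Q" using Z by (intro pair_measureI) (auto simp: sets)
  have "measure ?Q ?F = p * (1 * p)"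
  proof -
    have "?Z \<in> sets \<kappa>" "UNIV \<in> sets \<kappa>" using Z by (simp_all add: sets)
    moreover from this have "UNIV \<times> ?Z \<in> sets (\<kappa> \<Otimes>\<^sub>M \<kappa>)" by (rule pair_measureI[rotated])
    moreover have "measure \<kappa> UNIV = 1" using prob_space by (simp add: sp)
    ultimately show ?thesis
    by (simp add: measure_pair_Times[OF prob_space_axioms PP.prob_space_axioms]
        measure_pair_Times[OF prob_space_axioms prob_space_axioms] p_def)
  qed
  define D where "D j = {w \<in> space ?Q. det (T (real j) w) = 0 \<and> w \<notin> ?F}" for j
  have D_sets [measurable]: "D j \<in> sets ?Q" for j unfolding D_def by measurable
  have ev: "\<forall>\<^sub>F j in sequentially. w \<notin> D j" for w
  proof (cases "w \<in> ?F")
    case False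
    obtain A B C where w: "w = (A, B, C)" by (cases w) auto
    let ?f = "\<lambda>s. det (T s w)"
    have pf: "real_polynomial_function ?f"
    proof (rule real_polynomial_function_det)
      have id: "real_polynomial_function (\<lambda>s::real. s)"
        by (intro real_polynomial_function.intros(1) bounded_linear_ident)
      show "real_polynomial_function (\<lambda>s. T s w $ i $ j)" for i j
        unfolding T_def w
        by (simp, intro real_polynomial_function_diff real_polynomial_function.intros(2-4) id)
    qed
    \<comment> \<open>The events use only \<open>s \<ge> 0\<close>, but a polynomial with infinitely
      many zeros also vanishes at -1, where the last copy appears.\<close>
    have T0: "T 0 w = A" "T (-1) w = C" by (simp_all add: T_def w)
    have "finite {s. ?f s = 0}"
    proof (rule ccontr)
      assume "infinite {s. ?f s = 0}"
      from real_polynomial_function_zero[OF pf this] have "?f 0 = 0" "?f (-1) = 0" by blast+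
      then show False using False by (simp add: T0) (simp add: w)
    qed
    then have "finite (real -` {s. ?f s = 0})" by (rule finite_vimageI) (simp add: inj_on_def)
    then have "\<forall>\<^sub>F j in sequentially. j \<notin> real -` {s. ?f s = 0}"
      by (simp add: cofinite_eq_sequentially[symmetric] eventually_cofinite)
    then show ?thesis by eventually_elim (simp add: D_def)
  qed (simp add: D_def)
  have "(\<lambda>j. \<integral>w. indicator (D j) w \<partial>?Q) \<longlonglongrightarrow> (\<integral>w. 0 \<partial>?Q :: real)"
  proof (rule integral_dominated_convergence[where w="\<lambda>_. 1"])
    show "AE w in ?Q. (\<lambda>j. indicator (D j) w :: real) \<longlonglongrightarrow> 0"
    proof (rule AE_I2)
      fix w
      have "\<forall>\<^sub>F j in sequentially. indicator (D j) w = (0::real)" using ev[of w] by eventually_elim simp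
      then show "(\<lambda>j. indicator (D j) w :: real) \<longlonglongrightarrow> 0" by (rule tendsto_eventually)
    qed
  qed (auto simp: indicator_def)
  then have lim: "(\<lambda>j. measure ?Q (D j)) \<longlonglongrightarrow> 0" by simp
  have "p - p * p \<le> measure ?Q (D j)" for j
  proof -
    have "p = measure ?Q {w \<in> space ?Q. det (T (real j) w) = 0}" by (rule E_p[symmetric]) simp
    also have "\<dots> \<le> measure ?Q (?F \<union> D j)"
      by (intro P3.finite_measure_mono) (auto simp: D_def)
    also have "\<dots> \<le> measure ?Q ?F + measure ?Q (D j)" by (intro measure_Un_le) auto
    finally show ?thesis using \<open>measure ?Q ?F = p * (1 * p)\<close> by simp
  qed
  then have "p - p * p \<le> 0" by (intro LIMSEQ_le_const[OF lim]) auto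
  moreover have "p \<ge> 0" by (simp add: p_def)
  ultimately have "p * (1 - p) \<le> 0" by (simp add: algebra_simps)
  then have "p = 0" using p1 \<open>p \<ge> 0\<close> by (auto simp: mult_le_0_iff)
  then show ?thesis by (simp add: p_def emeasure_eq_measure)
qed

section \<open>Gaussian measures on continuously differentiable maps\<close>

text \<open>The density is at most \<open>1 / (2 \<sigma>)\<close>, which bounds \<open>\<sigma>\<close>; then Chebyshev's inequality bounds
  \<open>m\<close>, and \<open>136 = 2 (2\<^sup>2 + 8\<^sup>2)\<close>.\<close>

lemma gaussian_second_moment_le:
  assumes M: "prob_space M" and s: "\<sigma> > 0"
    and d: "distributed M lborel l (\<lambda>x. ennreal (normal_density m \<sigma> x))"
    and R: "R > 0" "measure M {x \<in> space M. \<bar>l x\<bar> \<le> R} \<ge> 3/4"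
  shows "(\<integral>\<^sup>+x. ennreal ((l x)\<^sup>2) \<partial>M) \<le> ennreal (136 * R\<^sup>2)"
proof -
  interpret prob_space M by fact
  have [measurable]: "l \<in> borel_measurable M" using d by (simp add: distributed_def)
  have var: "(\<integral>\<^sup>+x. ennreal ((l x - m)\<^sup>2) \<partial>M) = ennreal (\<sigma>\<^sup>2)"
  proof -
    have "(\<integral>\<^sup>+x. ennreal ((l x - m)\<^sup>2) \<partial>M) = (\<integral>\<^sup>+x. ennreal (normal_density m \<sigma> x) * ennreal ((x - m)\<^sup>2) \<partial>lborel)"
      by (rule distributed_nn_integral[OF d, symmetric]) simp
    also have "\<dots> = (\<integral>\<^sup>+x. ennreal (normal_density m \<sigma> x * (x - m)\<^sup>2) \<partial>lborel)"
      by (simp add: ennreal_mult'[symmetric])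
    also have "\<dots> = ennreal (\<integral>x. normal_density m \<sigma> x * (x - m)\<^sup>2 \<partial>lborel)"
      using s by (intro nn_integral_eq_integral integrable_normal_moment) auto
    also have "(\<integral>x. normal_density m \<sigma> x * (x - m)\<^sup>2 \<partial>lborel) = \<sigma>\<^sup>2"
      using integral_normal_moment_even[OF s, of m 1] by (simp add: numeral_2_eq_2)
    finally show ?thesis .
  qed
  have meas: "{x \<in> space M. \<bar>l x\<bar> \<le> R} \<in> sets M" by measurable
  have sR: "\<sigma> \<le> 2 * R"
  proof -
    have "normal_density m \<sigma> x \<le> 1 / (2 * \<sigma>)" for x
    proof -
      have "2 * \<sigma> \<le> sqrt (2 * pi * \<sigma>\<^sup>2)"
        using mult_right_mono[OF pi_ge_two, of "\<sigma>\<^sup>2"] s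
        by (intro real_le_rsqrt) (simp add: power_mult_distrib)
      then have "1 / sqrt (2 * pi * \<sigma>\<^sup>2) \<le> 1 / (2 * \<sigma>)" using s by (intro divide_left_mono) auto
      moreover have "exp (- (x - m)\<^sup>2 / (2 * \<sigma>\<^sup>2)) \<le> 1" by simp
      ultimately have "1 / sqrt (2 * pi * \<sigma>\<^sup>2) * exp (- (x - m)\<^sup>2 / (2 * \<sigma>\<^sup>2)) \<le> 1 / (2 * \<sigma>) * 1"
        using s by (intro mult_mono) auto
      then show ?thesis by (simp add: normal_density_def)
    qed
    note dens = this
    have "ennreal (3/4) \<le> emeasure M {x \<in> space M. \<bar>l x\<bar> \<le> R}"
      using R(2) by (simp add: emeasure_eq_measure ennreal_leI del: ennreal_numeral)
    also have "{x \<in> space M. \<bar>l x\<bar> \<le> R} = l -` {-R..R} \<inter> space M" by (auto simp: abs_le_iff)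
    also have "emeasure M \<dots> = (\<integral>\<^sup>+x. ennreal (normal_density m \<sigma> x) * indicator {-R..R} x \<partial>lborel)"
      by (rule distributed_emeasure[OF d]) simp
    also have "\<dots> \<le> (\<integral>\<^sup>+x. ennreal (1 / (2 * \<sigma>)) * indicator {-R..R} x \<partial>lborel)"
      by (intro nn_integral_mono mult_right_mono ennreal_leI dens) auto
    also have "\<dots> = ennreal (1 / (2 * \<sigma>)) * ennreal (2 * R)"
      using R by (subst nn_integral_cmult_indicator) auto
    also have "\<dots> = ennreal (R / \<sigma>)" using s R by (simp add: ennreal_mult'[symmetric])
    finally have "3/4 \<le> R / \<sigma>" using R s by (subst (asm) ennreal_le_iff) auto
    then have "3 / 4 * \<sigma> \<le> R" using s by (simp add: pos_le_divide_eq)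
    then show ?thesis using R by linarith
  qed
  \<comment> \<open>Otherwise \<open>l\<close> would differ from its mean by at least
    \<open>3 * \<sigma>\<close> with probability 3/4, whereas Chebyshev's inequality allows at most
    1/9.\<close>
  have mR: "\<bar>m\<bar> \<le> R + 3 * \<sigma>"
  proof (rule ccontr)
    assume no: "\<not> \<bar>m\<bar> \<le> R + 3 * \<sigma>"
    have "ennreal (3/4) \<le> emeasure M {x \<in> space M. \<bar>l x\<bar> \<le> R}"
      using R(2) by (simp add: emeasure_eq_measure ennreal_leI del: ennreal_numeral)
    also have "\<dots> = (\<integral>\<^sup>+x. indicator {x \<in> space M. \<bar>l x\<bar> \<le> R} x \<partial>M)" using meas by simp
    also have "\<dots> \<le> (\<integral>\<^sup>+x. ennreal (1 / (3 * \<sigma>)\<^sup>2) * ennreal ((l x - m)\<^sup>2) \<partial>M)"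
    proof (rule nn_integral_mono)
      fix x
      show "indicator {x \<in> space M. \<bar>l x\<bar> \<le> R} x \<le> ennreal (1 / (3 * \<sigma>)\<^sup>2) * ennreal ((l x - m)\<^sup>2)"
      proof (cases "\<bar>l x\<bar> \<le> R")
        case True
        then have "3 * \<sigma> \<le> \<bar>l x - m\<bar>" using no by linarith
        then have "(3 * \<sigma>)\<^sup>2 \<le> \<bar>l x - m\<bar>\<^sup>2" using s by (intro power_mono) auto
        then have "1 \<le> 1 / (3 * \<sigma>)\<^sup>2 * (l x - m)\<^sup>2" using s by (simp add: pos_le_divide_eq)
        then have "ennreal 1 \<le> ennreal (1 / (3 * \<sigma>)\<^sup>2 * (l x - m)\<^sup>2)" by (rule ennreal_leI)
        also have "\<dots> = ennreal (1 / (3 * \<sigma>)\<^sup>2) * ennreal ((l x - m)\<^sup>2)" by (rule ennreal_mult') simp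
        finally show ?thesis by (auto simp: indicator_def)
      qed (auto simp: indicator_def)
    qed
    also have "\<dots> = ennreal (1 / (3 * \<sigma>)\<^sup>2) * ennreal (\<sigma>\<^sup>2)" by (simp add: nn_integral_cmult var)
    also have "\<dots> = ennreal (1 / 9)" using s by (simp add: ennreal_mult'[symmetric] power_mult_distrib del: ennreal_numeral)
    finally show False by (subst (asm) ennreal_le_iff) auto
  qed
  have "(l x)\<^sup>2 \<le> 2 * (l x - m)\<^sup>2 + 2 * m\<^sup>2" for x
  proof -
    have "2 * (l x - m) * m \<le> (l x - m)\<^sup>2 + m\<^sup>2" by (rule sum_squares_bound)
    then show ?thesis by (simp add: power2_eq_square algebra_simps)
  qed
  then have "(\<integral>\<^sup>+x. ennreal ((l x)\<^sup>2) \<partial>M) \<le> (\<integral>\<^sup>+x. ennreal (2 * (l x - m)\<^sup>2 + 2 * m\<^sup>2) \<partial>M)"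
    by (intro nn_integral_mono ennreal_leI)
  also have "\<dots> = (\<integral>\<^sup>+x. 2 * ennreal ((l x - m)\<^sup>2) + ennreal (2 * m\<^sup>2) \<partial>M)"
    by (simp add: ennreal_plus ennreal_mult')
  also have "\<dots> = 2 * (\<integral>\<^sup>+x. ennreal ((l x - m)\<^sup>2) \<partial>M) + ennreal (2 * m\<^sup>2)"
    by (subst nn_integral_add) (auto simp: nn_integral_cmult emeasure_space_1)
  also have "\<dots> = ennreal (2 * \<sigma>\<^sup>2 + 2 * m\<^sup>2)"
    by (simp add: var ennreal_plus ennreal_mult')
  also have "\<dots> \<le> ennreal (136 * R\<^sup>2)"
  proof (rule ennreal_leI)
    have "\<sigma>\<^sup>2 \<le> (2 * R)\<^sup>2" using s sR by (intro power_mono) auto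
    moreover have "m\<^sup>2 \<le> (8 * R)\<^sup>2"
    proof -
      have "\<bar>m\<bar> \<le> 8 * R" using mR sR R by linarith
      then have "\<bar>m\<bar>\<^sup>2 \<le> (8 * R)\<^sup>2" by (intro power_mono) auto
      then show ?thesis by simp
    qed
    ultimately show "2 * \<sigma>\<^sup>2 + 2 * m\<^sup>2 \<le> 136 * R\<^sup>2" by (simp add: power_mult_distrib)
  qed
  finally show ?thesis .
qed

lemma cube_C1_of_const:
  fixes c :: "real^'n"
  shows "Rep_cube_C1 (cube_C1_of (\<lambda>_. c)) = (\<lambda>x. if x \<in> cbox 0 1 then c else 0)"
  by (rule cube_C1_of_rep[where f'="\<lambda>_. 0"]) (auto simp: zero_blinfun.rep_eq)

text \<open>Coordinates of evaluations are bounded by the norm of \<open>X\<close>, so one radius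
  \<open>R\<close> serves for all points and coordinates. The second moments are then bounded
  uniformly, and Tonelli's theorem integrates them over the cube.\<close>

lemma gaussian_C1_second_moment:
  fixes g :: "'n::finite cube_C1 measure"
  assumes g: "nondegenerate_gaussian g"
  shows "(\<integral>\<^sup>+X. ennreal ((norm (C1_to_L2 X))\<^sup>2) \<partial>g) < \<infinity>"
proof -
  let ?\<mu> = "cube_measure :: (real^'n) measure"
  interpret G: prob_space g using g by (simp add: nondegenerate_gaussian_def)
  interpret Q: prob_space ?\<mu> by (rule prob_space_cube_measure)
  interpret P: pair_prob_space g ?\<mu> ..
  have sets [measurable_cong]: "sets g = sets borel" using g by (simp add: nondegenerate_gaussian_def)
  have sp: "space g = UNIV" using sets by (simp add: sets_eq_imp_space_eq)
  have id [measurable]: "(\<lambda>x. x) \<in> ?\<mu> \<rightarrow>\<^sub>M borel"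
    by (simp add: cube_measure_def measurable_restrict_space1)
  have norm_m [measurable]: "(\<lambda>X. norm X) \<in> borel_measurable g"
    unfolding measurable_cong_sets[OF sets refl] by (intro borel_measurable_continuous_onI continuous_intros)
  have "(\<lambda>n. measure g {X \<in> space g. norm X \<le> real n}) \<longlonglongrightarrow> measure g (\<Union>n. {X \<in> space g. norm X \<le> real n})"
    by (intro G.finite_Lim_measure_incseq) (auto simp: incseq_def)
  moreover have "(\<Union>n. {X \<in> space g. norm X \<le> real n}) = space g" by (auto simp: real_arch_simple)
  ultimately have "\<forall>\<^sub>F n in sequentially. measure g {X \<in> space g. norm X \<le> real n} > 3/4"
    using G.prob_space by (intro order_tendstoD) auto
  then obtain N where N: "\<And>n. n \<ge> N \<Longrightarrow> measure g {X \<in> space g. norm X \<le> real n} > 3/4"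
    by (auto simp: eventually_sequentially)
  define R where "R = real (Suc N)"
  have R: "R > 0" "measure g {X \<in> space g. norm X \<le> R} \<ge> 3/4" using N[of "Suc N"] by (auto simp: R_def)
  have m2: "(\<integral>\<^sup>+X. ennreal ((cube_eval X x $ i)\<^sup>2) \<partial>g) \<le> ennreal (136 * R\<^sup>2)" if x: "x \<in> box 0 1" for x i
  proof -
    let ?l = "\<lambda>X. Rep_cube_C1 X x $ i"
    have bl: "bounded_linear ?l"
      by (rule bounded_linear_compose[OF bounded_linear_vec_nth bounded_linear_Rep_cube_C1])
    have xc: "x \<in> cbox 0 1" using x box_subset_cbox by blast
    have "?l (cube_C1_of (\<lambda>_. axis i 1)) \<noteq> 0" using xc by (simp add: cube_C1_of_const axis_def)
    from gaussian_functional[OF g bl this] obtain m \<sigma> where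
      ms: "\<sigma> > 0" "distributed g lborel ?l (\<lambda>x. ennreal (normal_density m \<sigma> x))" by blast
    have lm [measurable]: "?l \<in> borel_measurable g" using ms(2) by (simp add: distributed_def)
    have "3/4 \<le> measure g {X \<in> space g. norm X \<le> R}" by (rule R)
    also have "\<dots> \<le> measure g {X \<in> space g. \<bar>?l X\<bar> \<le> R}"
    proof (rule G.finite_measure_mono)
      show "{X \<in> space g. norm X \<le> R} \<subseteq> {X \<in> space g. \<bar>?l X\<bar> \<le> R}"
        by (auto intro: order_trans[OF component_le_norm_cart order_trans[OF norm_Rep_cube_C1_le]])
      show "{X \<in> space g. \<bar>?l X\<bar> \<le> R} \<in> sets g" by measurable
    qed
    finally have "(\<integral>\<^sup>+X. ennreal ((?l X)\<^sup>2) \<partial>g) \<le> ennreal (136 * R\<^sup>2)"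
      by (intro gaussian_second_moment_le[OF G.prob_space_axioms ms R(1)])
    then show ?thesis using x by (simp add: cube_eval_def)
  qed
  have em [measurable]: "(\<lambda>z. cube_eval (fst z) (snd z)) \<in> borel_measurable (g \<Otimes>\<^sub>M ?\<mu>)"
  proof -
    have "(\<lambda>z. (fst z, snd z)) \<in> g \<Otimes>\<^sub>M ?\<mu> \<rightarrow>\<^sub>M (borel :: 'n cube_C1 measure) \<Otimes>\<^sub>M borel"
      by (intro measurable_Pair measurable_compose[OF measurable_snd id]) measurable
    from measurable_compose[OF this cube_eval_measurable] show ?thesis by simp
  qed
  have nsq: "ennreal ((norm v)\<^sup>2) = (\<Sum>i\<in>UNIV. ennreal ((v $ i)\<^sup>2))" for v :: "real^'n"
    by (subst sum_ennreal) (auto simp: norm_vec_def L2_set_def sum_nonneg)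
  have "(\<integral>\<^sup>+X. ennreal ((norm (C1_to_L2 X))\<^sup>2) \<partial>g) = (\<integral>\<^sup>+X. \<integral>\<^sup>+x. ennreal ((norm (cube_eval X x))\<^sup>2) \<partial>?\<mu> \<partial>g)"
  proof (rule nn_integral_cong)
    fix X :: "'n cube_C1"
    have "ennreal ((norm (C1_to_L2 X))\<^sup>2) = (\<integral>\<^sup>+x. ennreal ((norm (Rep_cube_C1 X x))\<^sup>2) \<partial>?\<mu>)"
      unfolding C1_to_L2_eq by (rule nn_integral_norm_abs_cube_L2[OF square_integrable_C1, symmetric])
    also have "\<dots> = (\<integral>\<^sup>+x. ennreal ((norm (cube_eval X x))\<^sup>2) \<partial>?\<mu>)"
      by (intro nn_integral_cong) (simp add: cube_eval_def space_cube_measure)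
    finally show "ennreal ((norm (C1_to_L2 X))\<^sup>2) = (\<integral>\<^sup>+x. ennreal ((norm (cube_eval X x))\<^sup>2) \<partial>?\<mu>)" .
  qed
  also have "\<dots> = (\<integral>\<^sup>+x. \<integral>\<^sup>+X. ennreal ((norm (cube_eval X x))\<^sup>2) \<partial>g \<partial>?\<mu>)"
    by (rule P.Fubini'[symmetric]) (simp add: case_prod_beta')
  also have "\<dots> \<le> (\<integral>\<^sup>+x. (\<Sum>i\<in>(UNIV::'n set). ennreal (136 * R\<^sup>2)) \<partial>?\<mu>)"
  proof (rule nn_integral_mono)
    fix x assume "x \<in> space ?\<mu>"
    then have x: "x \<in> box 0 1" by (simp add: space_cube_measure)
    have "(\<lambda>X. cube_eval X x) \<in> borel_measurable g"
      using x bounded_linear_borel_measurable[OF bounded_linear_Rep_cube_C1, of x]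
      by (simp add: cube_eval_def measurable_cong_sets[OF sets refl])
    then have [measurable]: "(\<lambda>X. cube_eval X x $ i) \<in> borel_measurable g" for i by (rule borel_measurable_vec_nth)
    have "(\<integral>\<^sup>+X. ennreal ((norm (cube_eval X x))\<^sup>2) \<partial>g) = (\<Sum>i\<in>UNIV. \<integral>\<^sup>+X. ennreal ((cube_eval X x $ i)\<^sup>2) \<partial>g)"
      unfolding nsq by (rule nn_integral_sum) measurable
    also have "\<dots> \<le> (\<Sum>i\<in>(UNIV::'n set). ennreal (136 * R\<^sup>2))" by (intro sum_mono m2 x)
    finally show "(\<integral>\<^sup>+X. ennreal ((norm (cube_eval X x))\<^sup>2) \<partial>g) \<le> (\<Sum>i\<in>(UNIV::'n set). ennreal (136 * R\<^sup>2))" .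
  qed
  also have "\<dots> < \<infinity>" by (simp add: Q.emeasure_space_1 ennreal_mult_less_top ennreal_of_nat_eq_real_of_nat)
  finally show ?thesis .
qed

text \<open>At each fixed point, \<open>gaussian_det_null\<close> excludes singular Jacobians almost
  surely. Exchanging the two almost-everywhere quantifiers requires joint measurability, for which
  the determinant is formed from \<open>cube_jac\<close>.\<close>

lemma gaussian_jacobian_nonsingular:
  fixes g :: "'n::finite cube_C1 measure"
  assumes g: "nondegenerate_gaussian g"
  shows "AE X in g. AE x in cube_measure. det (jacobian x X) \<noteq> 0"
proof -
  let ?\<mu> = "cube_measure :: (real^'n) measure"
  interpret G: prob_space g using g by (simp add: nondegenerate_gaussian_def)
  interpret Q: prob_space ?\<mu> by (rule prob_space_cube_measure)
  interpret P: pair_prob_space g ?\<mu> ..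
  have sets [measurable_cong]: "sets g = sets borel" using g by (simp add: nondegenerate_gaussian_def)
  have id [measurable]: "(\<lambda>x. x) \<in> ?\<mu> \<rightarrow>\<^sub>M borel"
    by (simp add: cube_measure_def measurable_restrict_space1)
  define d where "d z = det (\<chi> i j. cube_jac (fst z) (snd z) i j)" for z :: "'n cube_C1 \<times> (real^'n)"
  have jm: "(\<lambda>z. cube_jac (fst z) (snd z) i j) \<in> borel_measurable (g \<Otimes>\<^sub>M ?\<mu>)" for i j
  proof -
    have "(\<lambda>z. (fst z, snd z)) \<in> g \<Otimes>\<^sub>M ?\<mu> \<rightarrow>\<^sub>M (borel :: 'n cube_C1 measure) \<Otimes>\<^sub>M borel"
      by (intro measurable_Pair measurable_compose[OF measurable_snd id]) measurable
    from measurable_compose[OF this cube_jac_measurable] show ?thesis by simp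
  qed
  have [measurable]: "d \<in> borel_measurable (g \<Otimes>\<^sub>M ?\<mu>)"
    unfolding d_def[abs_def] det_def
    by (intro borel_measurable_sum borel_measurable_times borel_measurable_prod borel_measurable_const) (simp add: jm)
  have d_eq: "d (X, x) = det (jacobian x X)" if "x \<in> box 0 1" for X x
    using that by (simp add: d_def cube_jac_eq)
  have "AE x in ?\<mu>. AE X in g. d (X, x) \<noteq> 0"
  proof (rule AE_I2)
    fix x assume "x \<in> space ?\<mu>"
    then have x: "x \<in> box 0 1" by (simp add: space_cube_measure)
    let ?Z = "{A :: real^'n^'n. det A = 0}"
    have Z: "?Z \<in> sets borel"
      by (intro borel_closed closed_Collect_eq continuous_intros) (auto simp: det_def[abs_def] intro!: continuous_intros)
    have J: "jacobian x \<in> g \<rightarrow>\<^sub>M borel"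
      using bounded_linear_borel_measurable[OF bounded_linear_jacobian[OF x]]
      by (simp add: measurable_cong_sets[OF sets refl])
    have "emeasure (distr g borel (jacobian x)) ?Z = 0"
      by (rule gaussian_det_null[OF nondegenerate_gaussian_jacobian[OF g x]])
    then have "emeasure g (jacobian x -` ?Z \<inter> space g) = 0" by (simp add: emeasure_distr[OF J Z])
    then have "jacobian x -` ?Z \<inter> space g \<in> null_sets g"
      using measurable_sets[OF J Z] by (auto simp: null_sets_def)
    then show "AE X in g. d (X, x) \<noteq> 0"
      by (rule AE_I') (auto simp: d_eq[OF x])
  qed
  moreover have "{z \<in> space (g \<Otimes>\<^sub>M ?\<mu>). d z \<noteq> 0} \<in> sets (g \<Otimes>\<^sub>M ?\<mu>)" by measurable
  then have "(AE X in g. AE x in ?\<mu>. d (X, x) \<noteq> 0) \<longleftrightarrow> (AE x in ?\<mu>. AE X in g. d (X, x) \<noteq> 0)"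
    by (intro P.AE_commute) (simp add: case_prod_beta')
  ultimately have "AE X in g. AE x in ?\<mu>. d (X, x) \<noteq> 0" by simp
  then show ?thesis
  proof eventually_elim
    case (elim X)
    then show ?case
      by (rule AE_mp) (auto intro!: AE_I2 simp: d_eq space_cube_measure)
  qed
qed

text \<open>Near a point with nonsingular Jacobian, the inverse function theorem exhibits the
  preimage of \<open>N\<close> as a differentiable image of a null set. Local negligibility implies
  global negligibility, and the singular points are null by \<open>nz\<close>.\<close>

lemma cube_C1_vimage_null:
  fixes X :: "'n::finite cube_C1"
  assumes nz: "AE x in cube_measure. det (jacobian x X) \<noteq> 0" and N: "N \<in> null_sets lborel"
  shows "emeasure (distr cube_measure borel (Rep_cube_C1 X)) N = 0"
proof -
  let ?f = "Rep_cube_C1 X" and ?\<mu> = "cube_measure :: (real^'n) measure"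
  obtain f' where f'c: "continuous_on (cbox 0 1) f'"
    and f'd: "\<And>x. x \<in> box 0 1 \<Longrightarrow> (?f has_derivative blinfun_apply (f' x)) (at x)"
    using C1_on_cube_Rep[of X] unfolding C1_on_cube_def by blast
  have f'c': "continuous_on (box 0 1) f'" using f'c box_subset_cbox continuous_on_subset by blast
  define W where "W = {x \<in> box 0 1. det (jacobian x X) \<noteq> 0 \<and> ?f x \<in> N}"
  have Nn: "negligible N" using N by (simp add: negligible_iff_null_sets null_sets_completionI)
  have "negligible W"
  proof (subst locally_negligible_alt, rule ballI)
    fix x0 assume x0: "x0 \<in> W"
    then have x0b: "x0 \<in> box 0 1" and det0: "det (jacobian x0 X) \<noteq> 0" by (auto simp: W_def)
    let ?A = "jacobian x0 X"
    have f'A: "blinfun_apply (f' x0) v = ?A *v v" for v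
    proof -
      have "frechet_derivative ?f (at x0) = blinfun_apply (f' x0)"
        by (rule frechet_derivative_at[OF f'd[OF x0b], symmetric])
      then show ?thesis
        by (simp add: jacobian_def matrix_works bounded_linear.linear[OF blinfun.bounded_linear_right])
    qed
    obtain B where inv: "B ** ?A = mat 1"
      using det0 unfolding invertible_det_nz[symmetric] invertible_def by blast
    define invf where "invf = Blinfun (\<lambda>v. B *v v)"
    have inv': "invf o\<^sub>L f' x0 = id_blinfun"
      by (rule blinfun_eqI)
        (simp add: invf_def bounded_linear_Blinfun_apply matrix_vector_mul_bounded_linear f'A matrix_vector_mul_assoc inv)
    have "\<exists>U h V. open U \<and> x0 \<in> U \<and> homeomorphism U V ?f h \<and> (\<forall>y\<in>V. h differentiable (at y))"
    proof (rule inverse_function_theorem[where f="?f", OF open_box _ f'c' x0b inv'])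
      show "(?f has_derivative blinfun_apply (f' x)) (at x)" if "x \<in> box 0 1" for x
        by (rule f'd[OF that])
      fix U V h h'
      assume "open U" "x0 \<in> U" "homeomorphism U V ?f h" "\<And>y. y \<in> V \<Longrightarrow> (h has_derivative h' y) (at y)"
      then show "\<exists>U h V. open U \<and> x0 \<in> U \<and> homeomorphism U V ?f h \<and> (\<forall>y\<in>V. h differentiable (at y))"
        by (intro exI[of _ U] exI[of _ h] exI[of _ V]) (auto simp: differentiable_def)
    qed
    then obtain U h V where U: "open U" "x0 \<in> U" and hom: "homeomorphism U V ?f h"
      and h': "\<And>y. y \<in> V \<Longrightarrow> h differentiable (at y)"
      by blast
    have "negligible (h ` (N \<inter> V))"
    proof (rule negligible_differentiable_image_negligible)
      show "negligible (N \<inter> V)" using Nn by (rule negligible_subset) auto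
      show "h differentiable_on N \<inter> V"
        unfolding differentiable_on_def using h' differentiable_at_withinI by blast
    qed simp
    moreover have "W \<inter> U \<subseteq> h ` (N \<inter> V)"
    proof
      fix x assume x: "x \<in> W \<inter> U"
      then have "?f x \<in> V" "h (?f x) = x" using hom by (auto simp: homeomorphism_def)
      then show "x \<in> h ` (N \<inter> V)" using x by (force simp: W_def)
    qed
    ultimately have "negligible (W \<inter> U)" by (rule negligible_subset)
    moreover have "openin (top_of_set W) (W \<inter> U)" using U by (simp add: openin_open_Int)
    ultimately show "\<exists>U. openin (top_of_set W) U \<and> x0 \<in> U \<and> negligible U" using x0 U by blast
  qed
  then have Wn: "W \<in> null_sets lebesgue" by (simp add: negligible_iff_null_sets)
  \<comment> \<open>\<open>W\<close> is only known to be null for the completed measure; a Borel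
    null set around it allows the return to \<open>lborel\<close>.\<close>
  obtain W' where W': "W' \<in> null_sets lborel" "W \<subseteq> W'"
    using Wn unfolding null_sets_completion_iff2 by auto
  have "AE x in ?\<mu>. x \<notin> W'"
  proof -
    have "AE x in lborel. x \<notin> W'" using W'(1) by (rule AE_not_in)
    then show ?thesis unfolding cube_measure_def
      by (subst AE_restrict_space_iff) auto
  qed
  moreover have "AE x in ?\<mu>. x \<in> box 0 1" by (rule AE_I2) (simp add: space_cube_measure)
  ultimately have "AE x in ?\<mu>. ?f x \<notin> N"
    using nz by eventually_elim (use W'(2) in \<open>auto simp: W_def\<close>)
  have fm: "?f \<in> ?\<mu> \<rightarrow>\<^sub>M borel" using square_integrable_C1[of X] by (simp add: square_integrable_def)
  have Nb: "N \<in> sets borel" using N by auto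
  have "emeasure (distr ?\<mu> borel ?f) N = emeasure ?\<mu> (?f -` N \<inter> space ?\<mu>)"
    by (rule emeasure_distr[OF fm Nb])
  also have "\<dots> = 0"
    using \<open>AE x in ?\<mu>. ?f x \<notin> N\<close> measurable_sets[OF fm Nb]
    by (subst (asm) AE_iff_measurable[of "?f -` N \<inter> space ?\<mu>"]) auto
  finally show ?thesis .
qed

section \<open>Density of the laws of square integrable maps\<close>

lemma distr_component_cube:
  "distr cube_measure borel (\<lambda>x::real^'n. x $ i) = distr (restrict_space lborel {0<..<1::real}) borel (\<lambda>t. t)"
proof (rule measure_eqI_generator_eq[where E="range lessThan" and \<Omega>=UNIV and A="\<lambda>n. {..<real n}"])
  interpret C: prob_space "cube_measure :: (real^'n) measure" by (rule prob_space_cube_measure)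
  have id: "(\<lambda>x. x) \<in> (cube_measure :: (real^'n) measure) \<rightarrow>\<^sub>M borel"
    by (simp add: cube_measure_def measurable_restrict_space1)
  have m: "(\<lambda>x::real^'n. x $ i) \<in> cube_measure \<rightarrow>\<^sub>M borel"
    using borel_measurable_vec_nth[OF id] .
  have m2: "(\<lambda>t::real. t) \<in> restrict_space lborel {0<..<1} \<rightarrow>\<^sub>M borel"
    by (simp add: measurable_restrict_space1)
  show "Int_stable (range (lessThan :: real \<Rightarrow> real set))"
  proof (rule Int_stableI, safe)
    fix a b :: real
    have "{..<a} \<inter> {..<b} = {..<min a b}" by auto
    then show "{..<a} \<inter> {..<b} \<in> range lessThan" by blast
  qed
  show "sets (distr cube_measure borel (\<lambda>x::real^'n. x $ i)) = sigma_sets UNIV (range lessThan)"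
    "sets (distr (restrict_space lborel {0<..<1::real}) borel (\<lambda>t. t)) = sigma_sets UNIV (range lessThan)"
    by (simp_all add: borel_Iio)
  show "(\<Union>n. {..<real n}) = UNIV" by (auto simp: reals_Archimedean2)
  fix X assume "X \<in> range (lessThan :: real \<Rightarrow> real set)"
  then obtain a where X: "X = {..<a}" by blast
  \<comment> \<open>Clamping \<open>a\<close> to the unit interval turns the part of the cube below
    \<open>a\<close> into the box whose \<open>i\<close>-th side is \<open>c\<close> and whose other
    sides are 1.\<close>
  define c where "c = max 0 (min 1 a)"
  have c: "0 \<le> c" "c \<le> 1" by (auto simp: c_def)
  have "emeasure (distr (restrict_space lborel {0<..<1::real}) borel (\<lambda>t. t)) X
      = emeasure lborel {0<..<c}"
  proof -
    have "t < c \<longleftrightarrow> t < a \<and> t < 1" if "0 < t" for t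
      using that by (simp add: c_def less_max_iff_disj conj_commute)
    then have "{..<a} \<inter> {0<..<1} = {0<..<c}" by auto
    then show ?thesis unfolding X
      using c by (simp add: emeasure_distr[OF m2] space_restrict_space)
        (subst emeasure_restrict_space; force)
  qed
  also have "\<dots> = ennreal c" using c by simp
  finally have 1: "emeasure (distr (restrict_space lborel {0<..<1::real}) borel (\<lambda>t. t)) X = ennreal c" .
  define u :: "real^'n" where "u = (\<chi> j. if j = i then c else 1)"
  have "emeasure (distr cube_measure borel (\<lambda>x::real^'n. x $ i)) X = emeasure lborel (box 0 u)"
  proof -
    have eq: "x $ i < a \<and> x \<in> box 0 1 \<longleftrightarrow> x \<in> box 0 u" for x :: "real^'n"
    proof
      assume x: "x $ i < a \<and> x \<in> box 0 1"
      then have x01: "0 < x $ j \<and> x $ j < 1" for j unfolding mem_box_01 by blast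
      have "x $ i < c" using x x01[of i] unfolding c_def by (simp only: max_def min_def) (simp split: if_split)
      then show "x \<in> box 0 u" using x01 by (simp add: mem_box_cart u_def)
    next
      assume "x \<in> box 0 u"
      then have *: "0 < x $ j \<and> x $ j < (if j = i then c else 1)" for j by (simp add: mem_box_cart u_def)
      have xi: "0 < x $ i" "x $ i < c" using *[of i] by simp_all
      then have "x $ i < 1" "x $ i < a" unfolding c_def by linarith+
      moreover have "0 < x $ j \<and> x $ j < 1" for j
        using *[of j] \<open>x $ i < 1\<close> by (cases "j = i") simp_all
      ultimately show "x $ i < a \<and> x \<in> box 0 1" unfolding mem_box_01 by blast
    qed
    then have "(\<lambda>x::real^'n. x $ i) -` {..<a} \<inter> box 0 1 = box 0 u" by blast
    moreover have "box 0 u \<subseteq> box 0 1" using eq by blast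
    ultimately show ?thesis unfolding X
      by (subst emeasure_distr[OF m]) (auto simp: space_cube_measure, simp add: cube_measure_def emeasure_restrict_space)
  qed
  also have "\<dots> = ennreal (\<Prod>b\<in>Basis. (u - 0) \<bullet> b)"
    using c by (intro emeasure_lborel_box) (auto simp: Basis_vec_def inner_axis u_def)
  also have "(\<Prod>b\<in>Basis. (u - 0) \<bullet> b) = (\<Prod>j\<in>UNIV. u $ j)"
  proof (rule prod.reindex_bij_betw[of "\<lambda>j. axis j 1" UNIV Basis "\<lambda>b. (u - 0) \<bullet> b", symmetric, THEN trans])
    show "bij_betw (\<lambda>j. axis j 1 :: real^'n) UNIV Basis"
      by (auto simp: bij_betw_def inj_on_def axis_eq_axis Basis_vec_def)
  qed (simp add: inner_axis)
  also have "\<dots> = c" by (simp add: u_def prod.delta)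
  finally show "emeasure (distr cube_measure borel (\<lambda>x::real^'n. x $ i)) X =
    emeasure (distr (restrict_space lborel {0<..<1::real}) borel (\<lambda>t. t)) X" using 1 by simp
next
  interpret C: prob_space "cube_measure :: (real^'n) measure" by (rule prob_space_cube_measure)
  have id: "(\<lambda>x. x) \<in> (cube_measure :: (real^'n) measure) \<rightarrow>\<^sub>M borel"
    by (simp add: cube_measure_def measurable_restrict_space1)
  interpret D: prob_space "distr cube_measure borel (\<lambda>x::real^'n. x $ i)"
    by (rule C.prob_space_distr[OF borel_measurable_vec_nth[OF id]])
  show "emeasure (distr cube_measure borel (\<lambda>x::real^'n. x $ i)) {..<real n} \<noteq> \<infinity>" for n :: nat
    by simp
qed auto

text \<open>A coordinate on the cube is uniform on the unit interval, and the quantile function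
  \<open>I\<close> sends the uniform law to \<open>L\<close>. \<open>J\<close> extends
  \<open>I\<close> by 0 to a Borel function on the whole line.\<close>

lemma cube_quantile:
  assumes "real_distribution L"
  obtains Q :: "real^'n \<Rightarrow> real" where "Q \<in> borel_measurable cube_measure" "distr cube_measure borel Q = L"
proof -
  interpret cdf_distribution L using assms by (simp add: cdf_distribution_def)
  let ?\<Omega> = "restrict_space lborel {0<..<1::real}"
  define J where "J t = (if t \<in> {0<..<1} then I t else 0)" for t
  have J [measurable]: "J \<in> borel_measurable borel"
    unfolding J_def using measurable_CI
    by (subst measurable_restrict_space_iff[symmetric]) auto
  have id: "(\<lambda>x. x) \<in> (cube_measure :: (real^'n) measure) \<rightarrow>\<^sub>M borel"
    by (simp add: cube_measure_def measurable_restrict_space1)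
  fix i0 :: 'n
  have m: "(\<lambda>x::real^'n. x $ i0) \<in> cube_measure \<rightarrow>\<^sub>M borel" using borel_measurable_vec_nth[OF id] .
  have m2: "(\<lambda>t::real. t) \<in> ?\<Omega> \<rightarrow>\<^sub>M borel" by (simp add: measurable_restrict_space1)
  have "distr cube_measure borel (\<lambda>x::real^'n. J (x $ i0)) = distr (distr cube_measure borel (\<lambda>x::real^'n. x $ i0)) borel J"
    by (subst distr_distr[OF J m]) (simp add: o_def)
  also have "\<dots> = distr ?\<Omega> borel J"
    unfolding distr_component_cube by (subst distr_distr[OF J m2]) (simp add: o_def)
  also have "\<dots> = distr ?\<Omega> borel I"
    by (intro distr_cong) (auto simp: J_def space_restrict_space)
  also have "\<dots> = L" by (rule distr_I_eq_M)
  finally show ?thesis using that measurable_compose[OF m J] by blast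
qed

text \<open>Rounding \<open>\<mu>\<close> to a grid makes its law discrete; an integer code of the grid point can then be simulated
  from a single coordinate on the cube by the quantile transform on the line.\<close>

lemma range_iota_dense:
  fixes \<mu> :: "(real^'n::finite) P2"
  assumes e: "e > 0"
  obtains X where "W2 (iota X) \<mu> < e"
proof -
  interpret M: prob_space "measure_of_P2 \<mu>" by (rule prob_space_P2)
  have sp: "space (measure_of_P2 \<mu>) = UNIV"
    using sets_P2 by (metis sets_eq_imp_space_eq space_borel)
  \<comment> \<open>Rounding moves each coordinate by at most \<open>1 / N\<close>, hence each point
    by at most \<open>real CARD('n) / N\<close>, which is to be below \<open>e\<close>.\<close>
  obtain k where k: "real CARD('n) / e < real (Suc k)" using reals_Archimedean2 less_trans of_nat_less_iff lessI by metis
  define N where "N = real (Suc k)"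
  have N: "N > 0" "real CARD('n) / N < e" using k e by (auto simp: N_def field_simps)
  define v where "v x = (\<chi> i. \<lfloor>N * x $ i\<rfloor>)" for x :: "real^'n"
  define y where "y w = (\<chi> i. of_int (w $ i) / N)" for w :: "int^'n"
  \<comment> \<open>The grid index becomes a natural number and thus a real random variable. Floor
    and \<open>from_nat\<close> invert the code, so simulating the law of \<open>enc\<close> on the
    cube simulates the rounded point.\<close>
  define enc where "enc x = real (to_nat (v x))" for x
  define dec where "dec r = y (from_nat (nat \<lfloor>r\<rfloor>))" for r :: real
  let ?T = "\<lambda>x. y (v x)"
  have v_meas [measurable]: "v \<in> borel \<rightarrow>\<^sub>M count_space UNIV"
    by (rule vec_count_space_measurable) (simp add: v_def)
  have y_meas [measurable]: "(\<lambda>x. y (v x)) \<in> borel \<rightarrow>\<^sub>M borel"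
    by (rule measurable_compose[OF v_meas]) simp
  have enc_meas [measurable]: "enc \<in> borel \<rightarrow>\<^sub>M borel" unfolding enc_def
    by (rule measurable_compose[OF v_meas]) simp
  have dec_meas [measurable]: "dec \<in> borel \<rightarrow>\<^sub>M borel" unfolding dec_def
    by (rule measurable_compose[of "\<lambda>r. \<lfloor>r\<rfloor>" _ "count_space UNIV"]) simp_all
  have dec_enc: "dec (enc x) = ?T x" for x by (simp add: dec_def enc_def)
  have close: "dist (?T x) x \<le> real CARD('n) / N" for x
  proof -
    have "norm (?T x - x) \<le> (\<Sum>i\<in>UNIV. \<bar>(?T x - x) $ i\<bar>)" by (rule norm_le_l1_cart)
    also have "\<dots> \<le> (\<Sum>i\<in>(UNIV::'n set). 1 / N)"
    proof (rule sum_mono)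
      fix i
      have "(?T x - x) $ i = (of_int \<lfloor>N * x $ i\<rfloor> - N * x $ i) / N"
        using N by (simp add: y_def v_def diff_divide_distrib)
      moreover have "\<bar>of_int \<lfloor>N * x $ i\<rfloor> - N * x $ i\<bar> \<le> 1" by linarith
      ultimately show "\<bar>(?T x - x) $ i\<bar> \<le> 1 / N"
        using N by (simp add: divide_right_mono)
    qed
    finally show ?thesis by (simp add: dist_norm)
  qed
  have L: "real_distribution (distr (measure_of_P2 \<mu>) borel enc)"
    unfolding real_distribution_def real_distribution_axioms_def
    using M.prob_space_distr[of enc borel] by (simp add: measurable_cong_sets[OF sets_P2 refl])
  obtain Q :: "real^'n \<Rightarrow> real" where Q [measurable]: "Q \<in> borel_measurable cube_measure"
    and Qd: "distr cube_measure borel Q = distr (measure_of_P2 \<mu>) borel enc"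
    by (rule cube_quantile[OF L])
  define f where "f x = dec (Q x)" for x
  have f [measurable]: "f \<in> borel_measurable cube_measure" unfolding f_def by measurable
  have fd: "distr cube_measure borel f = distr (measure_of_P2 \<mu>) borel ?T"
  proof -
    have "distr cube_measure borel f = distr (distr cube_measure borel Q) borel dec"
      by (subst distr_distr) (auto simp: f_def[abs_def] o_def)
    also have "\<dots> = distr (measure_of_P2 \<mu>) borel (\<lambda>x. dec (enc x))"
      unfolding Qd by (subst distr_distr) (auto simp: o_def)
    finally show ?thesis by (simp add: dec_enc)
  qed
  let ?c = "real CARD('n) / N"
  have sq: "square_integrable f"
  proof (rule square_integrableI[OF f])
    have "(\<integral>\<^sup>+x. ennreal ((norm (f x))\<^sup>2) \<partial>cube_measure) = (\<integral>\<^sup>+z. ennreal ((norm z)\<^sup>2) \<partial>distr cube_measure borel f)"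
      by (subst nn_integral_distr) auto
    also have "\<dots> = (\<integral>\<^sup>+x. ennreal ((norm (?T x))\<^sup>2) \<partial>measure_of_P2 \<mu>)"
      unfolding fd by (subst nn_integral_distr) auto
    also have "\<dots> \<le> (\<integral>\<^sup>+x. ennreal (2 * (norm x)\<^sup>2 + 2 * ?c\<^sup>2) \<partial>measure_of_P2 \<mu>)"
    proof (intro nn_integral_mono ennreal_leI)
      fix x
      have "norm (?T x) \<le> norm x + ?c" using close[of x] norm_triangle_sub[of "?T x" x] by (simp add: dist_norm)
      then have "(norm (?T x))\<^sup>2 \<le> (norm x + ?c)\<^sup>2" by (intro power_mono) auto
      also have "\<dots> \<le> 2 * (norm x)\<^sup>2 + 2 * ?c\<^sup>2"
        using sum_squares_bound[of "norm x" ?c] by (simp add: power2_sum)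
      finally show "(norm (?T x))\<^sup>2 \<le> 2 * (norm x)\<^sup>2 + 2 * ?c\<^sup>2" .
    qed
    also have "\<dots> < \<infinity>"
    proof -
      have "integrable (measure_of_P2 \<mu>) (\<lambda>x. 2 * (norm x)\<^sup>2 + 2 * ?c\<^sup>2)"
        using integrable_P2[of \<mu>] by (intro Bochner_Integration.integrable_add integrable_mult_right) auto
      then show ?thesis by (subst nn_integral_eq_integral) auto
    qed
    finally show "(\<integral>\<^sup>+x. ennreal ((norm (f x))\<^sup>2) \<partial>cube_measure) < \<infinity>" .
  qed
  \<comment> \<open>The joint law of the rounded and the original point: its first marginal is also
    the law of \<open>f\<close>, and its cost is at most the squared rounding error.\<close>
  let ?\<gamma> = "distr (measure_of_P2 \<mu>) borel (\<lambda>x. (?T x, x))"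
  have p: "(\<lambda>x. (?T x, x)) \<in> measure_of_P2 \<mu> \<rightarrow>\<^sub>M borel" by measurable
  have "distr (measure_of_P2 \<mu>) borel (\<lambda>x. x) = measure_of_P2 \<mu>"
    by (rule distr_id2[OF sets_P2[symmetric], unfolded id_def])
  then have "?\<gamma> \<in> couplings (measure_of_P2 (iota (abs_cube_L2 f))) (measure_of_P2 \<mu>)"
    unfolding couplings_def measure_of_iota[OF sq] fd
    by (simp add: distr_distr[OF measurable_couplings(1)[OF refl] p] distr_distr[OF measurable_couplings(2)[OF refl] p] o_def)
  moreover have "(\<integral>\<^sup>+ z. ennreal ((dist (fst z) (snd z))\<^sup>2) \<partial>?\<gamma>) \<le> ennreal (?c\<^sup>2)"
  proof -
    note [measurable] = measurable_couplings[OF refl]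
    have "(\<integral>\<^sup>+ z. ennreal ((dist (fst z) (snd z))\<^sup>2) \<partial>?\<gamma>) = (\<integral>\<^sup>+ x. ennreal ((dist (?T x) x)\<^sup>2) \<partial>measure_of_P2 \<mu>)"
      by (subst nn_integral_distr[OF p]) simp_all
    also have "\<dots> \<le> (\<integral>\<^sup>+ x. ennreal (?c\<^sup>2) \<partial>measure_of_P2 \<mu>)"
      by (intro nn_integral_mono ennreal_leI power_mono close) simp
    also have "\<dots> = ennreal (?c\<^sup>2)" using M.emeasure_space_1 by simp
    finally show ?thesis .
  qed
  ultimately have "W2 (iota (abs_cube_L2 f)) \<mu> \<le> ?c" using N by (intro W2_le) auto
  then show ?thesis using N that by (meson le_less_trans)
qed

section \<open>The main theorem\<close>

theorem theorem6p25:
  fixes g :: "'n::finite cube_C1 measure"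
  assumes "CARD('n) > 1"
    and "nondegenerate_gaussian g"
  shows "distr g borel (\<lambda>X. iota (C1_to_L2 X)) \<in> P2_P2 \<and>
    super_G_regular (distr g borel (\<lambda>X. iota (C1_to_L2 X))) \<and>
    measure_support (distr g borel (\<lambda>X. iota (C1_to_L2 X))) = UNIV"
proof -
  note g = assms(2)
  interpret prob_space g using g by (simp add: nondegenerate_gaussian_def)
  have sets: "sets g = sets borel" using g by (simp add: nondegenerate_gaussian_def)
  have J: "C1_to_L2 \<in> g \<rightarrow>\<^sub>M borel"
    unfolding measurable_cong_sets[OF sets refl]
    by (rule bounded_linear_borel_measurable[OF bounded_linear_C1_to_L2])
  let ?T = "\<lambda>X. iota (C1_to_L2 X)"
  let ?h = "distr g borel C1_to_L2"
  have T: "?T \<in> g \<rightarrow>\<^sub>M borel" by (rule measurable_compose[OF J iota_measurable])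
  have h: "nondegenerate_gaussian ?h" by (rule nondegenerate_gaussian_L2[OF g])
  have em: "emeasure (distr g borel ?T) B = emeasure ?h (iota -` B)" if B: "B \<in> sets borel" for B
  proof -
    have "iota -` B \<in> sets (borel :: 'n cube_L2 measure)"
      using measurable_sets[OF iota_measurable B] by simp
    then show ?thesis
      by (subst emeasure_distr[OF T B], subst emeasure_distr[OF J]) (auto intro!: arg_cong2[where f=emeasure])
  qed
  \<comment> \<open>The reference measure \<open>iota 0\<close> is the point mass at the origin, so
    its distance to the law of a map is at most the \<open>L^2\<close> norm of the map.\<close>
  have "(\<integral>\<^sup>+ \<mu>. ennreal ((W2 \<mu> (iota 0))\<^sup>2) \<partial>distr g borel ?T)
      \<le> (\<integral>\<^sup>+ X. ennreal ((W2 (?T X) (iota 0))\<^sup>2) \<partial>g)"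
    by (rule nn_integral_distr_le[OF T])
  also have "\<dots> \<le> (\<integral>\<^sup>+ X. ennreal ((norm (C1_to_L2 X))\<^sup>2) \<partial>g)"
  proof (intro nn_integral_mono ennreal_leI power_mono)
    show "W2 (?T X) (iota 0) \<le> norm (C1_to_L2 X)" for X
      using W2_iota_le[of "C1_to_L2 X" 0] by simp
  qed (simp add: W2_def)
  also have "\<dots> < \<infinity>" by (rule gaussian_C1_second_moment[OF g])
  finally have "distr g borel ?T \<in> P2_P2"
    unfolding P2_P2_def using prob_space_distr[OF T] by auto
  moreover have "AE \<mu> in distr g borel ?T. \<mu> \<in> P2_regular"
  proof -
    have "AE X in g. ?T X \<in> P2_ac"
      using gaussian_jacobian_nonsingular[OF g]
    proof eventually_elim
      case (elim X)
      then show ?case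
        by (intro P2_acI) (simp add: C1_to_L2_eq measure_of_iota square_integrable_C1 cube_C1_vimage_null)
    qed
    then have "AE \<mu> in distr g borel ?T. \<mu> \<in> P2_ac"
      by (subst AE_distr_iff[OF T]) (simp_all add: P2_ac_borel)
    then show ?thesis by eventually_elim (use P2_ac_subset_regular in blast)
  qed
  moreover have "emeasure (distr g borel ?T) B = 0"
    if "B \<in> sets borel" "gaussian_null (iota -` B :: 'n cube_L2 set)" for B
    using that h by (auto simp: em gaussian_null_def)
  moreover have "measure_support (distr g borel ?T) = UNIV"
  proof -
    have "emeasure (distr g borel ?T) U > 0" if U: "open U" "\<mu> \<in> U" for U and \<mu> :: "(real^'n) P2"
    proof -
      obtain e where e: "e > 0" "\<And>\<nu>. W2 \<nu> \<mu> < e \<Longrightarrow> \<nu> \<in> U"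
        using U unfolding open_P2_def by blast
      \<comment> \<open>An open ball around \<mu> contains the law of some \<open>X\<close>, so the
        preimage of \<open>U\<close> is a nonempty open subset of \<open>L^2\<close> and is charged
        by the Gaussian image.\<close>
      obtain X where "W2 (iota X) \<mu> < e" by (rule range_iota_dense[OF e(1)])
      then have "X \<in> iota -` U" using e by simp
      moreover have "open (iota -` U :: 'n cube_L2 set)" by (rule open_iota_vimage[OF U(1)])
      ultimately have "emeasure ?h (iota -` U) > 0"
        using gaussian_full_support[OF h] unfolding measure_support_def by blast
      then show ?thesis by (simp add: em U)
    qed
    then show ?thesis by (auto simp: measure_support_def)
  qed
  ultimately show ?thesis unfolding super_G_regular_def by blast
qed

end
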